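(* Let $\mathcal{G}_1$ be the diagonal comb metric graph with parameter $\alpha = 1$. Then there exist constants $c, C > 0$ such that for all sufficiently large $k \in \mathbb{N}$ \[ c\, \frac{k^2}{\ln(k)^4} \leq \lambda_k(\mathcal{G}_1) \leq C\, \frac{k^2}{\ln(k)^2}, \] where $\lambda_k(\mathcal{G}_1)$ denotes the $k$-th eigenvalue of the Neumann Laplacian on $\mathcal{G}_1$.
   Context: A metric graph $\mathcal{G}$ is a countable collection of intervals (edges) $(\mathsf{e})_{\mathsf{e}\in\mathsf{E}}$ of finite lengths $\ell_{\mathsf{e}}\in(0,\infty)$, glued at their endpoints to form a graph-like space, endowed with the shortest-path metric and the measure inherited from the Lebesgue measure on the edges. For $\alpha>0$ the diagonal comb $\mathcal{G}_\alpha$ is obtained by taking the interval $(0,1]$ as a "backbone" and attaching, for every $n=1,2,\dots$, an edge ("tooth") of length $n^{-\alpha}$ by one of its endpoints to the point $n^{-\alpha}\in(0,1]$. Thus the edges are the teeth, of lengths $n^{-\alpha}$ ($n\ge 1$), and the backbone edges of lengths $n^{-\alpha}-(n+1)^{-\alpha}$ ($n\geq 1$) joining the foot points of the $n$-th and $(n+1)$-st teeth. The point $0$ does not belong to $\mathcal{G}_\alpha$. $H^1(\mathcal{G})$ is the space of continuous functions $\phi:\mathcal{G}\to\mathbb{C}$ whose restriction to each edge $\mathsf{e}$ lies in $H^1(\mathsf{e})$ and for which $\sum_{\mathsf{e}\in\mathsf{E}}\|\phi|_{\mathsf{e}}\|_{H^1(\mathsf{e})}^2<\infty$. The Neumann Laplacian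 on $\mathcal{G}$ is the nonnegative self-adjoint operator in $L^2(\mathcal{G})$ associated with the quadratic form $\phi\mapsto\sum_{\mathsf{e}\in\mathsf{E}}\int_{\mathsf{e}}|\phi'(x)|^2\,\mathrm{d}x$ with domain $H^1(\mathcal{G})$. It is known that the Neumann Laplacian on $\mathcal{G}_\alpha$ has purely discrete spectrum if and only if $\alpha>\frac12$; in that case $\{\lambda_k(\mathcal{G}_\alpha)\}_{k\ge1}$ denotes its eigenvalues enumerated increasingly and counted with multiplicity. *)

theory Defs
  imports "HOL-Analysis.Analysis" "HOL-Library.Function_Algebras"
begin

section \<open>Metric graphs\<close>

text \<open>Edge \<open>e\<close> is a copy of the interval \<open>[0, elen G e]\<close>; its endpoint \<open>0\<close> is glued to the vertex
  \<open>src G e\<close> and its endpoint \<open>elen G e\<close> to the vertex \<open>tgt G e\<close>.\<close>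

record ('v, 'e) metric_graph =
  edges :: "'e set"
  elen :: "'e \<Rightarrow> real"
  src :: "'e \<Rightarrow> 'v"
  tgt :: "'e \<Rightarrow> 'v"

definition metric_graph :: "('v, 'e) metric_graph \<Rightarrow> bool" where
  "metric_graph G \<longleftrightarrow> countable (edges G) \<and> (\<forall>e\<in>edges G. 0 < elen G e)"

text \<open>Points of the graph are represented by pairs of an edge and a coordinate, before gluing.\<close>

definition points :: "('v, 'e) metric_graph \<Rightarrow> ('e \<times> real) set" where
  "points G = (SIGMA e:edges G. {0..elen G e})"

inductive at_vertex :: "('v, 'e) metric_graph \<Rightarrow> 'e \<times> real \<Rightarrow> 'v \<Rightarrow> bool" for G where
  src: "e \<in> edges G \<Longrightarrow> at_vertex G (e, 0) (src G e)"
| tgt: "e \<in> edges G \<Longrightarrow> at_vertex G (e, elen G e) (tgt G e)"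

text \<open>\<open>walk G p q L\<close>: there is a path of length \<open>L\<close> from \<open>p\<close> to \<open>q\<close>, composed of finitely many
  segments inside edges and of passages (of length \<open>0\<close>) through vertices.\<close>

inductive walk :: "('v, 'e) metric_graph \<Rightarrow> 'e \<times> real \<Rightarrow> 'e \<times> real \<Rightarrow> real \<Rightarrow> bool" for G where
  refl: "p \<in> points G \<Longrightarrow> walk G p p 0"
| edge: "walk G p (e, x) L \<Longrightarrow> y \<in> {0..elen G e} \<Longrightarrow> walk G p (e, y) (L + \<bar>x - y\<bar>)"
| vertex: "walk G p q L \<Longrightarrow> at_vertex G q v \<Longrightarrow> at_vertex G r v \<Longrightarrow> walk G p r L"

text \<open>The shortest-path metric (\<open>\<infinity>\<close> between different components). Glued points have distance \<open>0\<close>.\<close>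

definition path_dist :: "('v, 'e) metric_graph \<Rightarrow> 'e \<times> real \<Rightarrow> 'e \<times> real \<Rightarrow> ereal" where
  "path_dist G p q = (INF L\<in>{L. walk G p q L}. ereal L)"

text \<open>Continuity with respect to the shortest-path metric. As glued points have distance \<open>0\<close>, a
  continuous function takes equal values at them, so it is a function on the glued space.\<close>

definition graph_continuous :: "('v, 'e) metric_graph \<Rightarrow> ('e \<times> real \<Rightarrow> complex) \<Rightarrow> bool" where
  "graph_continuous G \<phi> \<longleftrightarrow> (\<forall>p\<in>points G. \<forall>\<epsilon>>0. \<exists>\<delta>>0. \<forall>q\<in>points G.
     path_dist G p q < ereal \<delta> \<longrightarrow> cmod (\<phi> q - \<phi> p) < \<epsilon>)"


section \<open>Sobolev spaces\<close>

definition L2_interval :: "real \<Rightarrow> (real \<Rightarrow> complex) set" where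
  "L2_interval l = {f. f \<in> borel_measurable (lebesgue_on {0..l}) \<and>
     integrable (lebesgue_on {0..l}) (\<lambda>x. (cmod (f x))\<^sup>2)}"

text \<open>Weak derivatives on \<open>(0, l)\<close>, tested against \<open>C\<^sup>1\<close> functions with compact support in the open
  interval; by linearity real-valued test functions suffice.\<close>

definition is_weak_deriv :: "real \<Rightarrow> (real \<Rightarrow> complex) \<Rightarrow> (real \<Rightarrow> complex) \<Rightarrow> bool" where
  "is_weak_deriv l f g \<longleftrightarrow> (\<forall>(\<psi> :: real \<Rightarrow> real) \<psi>'.
     (\<forall>x. (\<psi> has_real_derivative \<psi>' x) (at x)) \<and> continuous_on UNIV \<psi>' \<and>
     (\<exists>a b. 0 < a \<and> b < l \<and> (\<forall>x. x \<notin> {a..b} \<longrightarrow> \<psi> x = 0)) \<longrightarrow>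
     integral\<^sup>L (lebesgue_on {0..l}) (\<lambda>x. f x * of_real (\<psi>' x)) =
     - integral\<^sup>L (lebesgue_on {0..l}) (\<lambda>x. g x * of_real (\<psi> x)))"

definition H1_interval :: "real \<Rightarrow> (real \<Rightarrow> complex) set" where
  "H1_interval l = {f \<in> L2_interval l. \<exists>g\<in>L2_interval l. is_weak_deriv l f g}"

text \<open>A representative of the weak derivative, which is unique almost everywhere.\<close>

definition weak_deriv :: "real \<Rightarrow> (real \<Rightarrow> complex) \<Rightarrow> real \<Rightarrow> complex" where
  "weak_deriv l f = (SOME g. g \<in> L2_interval l \<and> is_weak_deriv l f g)"

definition H1_norm_sq :: "real \<Rightarrow> (real \<Rightarrow> complex) \<Rightarrow> real" where
  "H1_norm_sq l f =
     integral\<^sup>L (lebesgue_on {0..l}) (\<lambda>x. (cmod (f x))\<^sup>2) +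
     integral\<^sup>L (lebesgue_on {0..l}) (\<lambda>x. (cmod (weak_deriv l f x))\<^sup>2)"

definition restr :: "('e \<times> real \<Rightarrow> complex) \<Rightarrow> 'e \<Rightarrow> real \<Rightarrow> complex" where
  "restr \<phi> e = (\<lambda>x. \<phi> (e, x))"

text \<open>The measure on the graph is the sum of the Lebesgue measures on the edges. Elements of \<open>L2\<close>
  are representatives of classes modulo null sets.\<close>

definition L2 :: "('v, 'e) metric_graph \<Rightarrow> ('e \<times> real \<Rightarrow> complex) set" where
  "L2 G = {f. (\<forall>e\<in>edges G. restr f e \<in> L2_interval (elen G e)) \<and>
     (\<lambda>e. integral\<^sup>L (lebesgue_on {0..elen G e}) (\<lambda>x. (cmod (restr f e x))\<^sup>2)) summable_on edges G}"

definition L2_inner ::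
    "('v, 'e) metric_graph \<Rightarrow> ('e \<times> real \<Rightarrow> complex) \<Rightarrow> ('e \<times> real \<Rightarrow> complex) \<Rightarrow> complex" where
  "L2_inner G f h = (\<Sum>\<^sub>\<infinity>e\<in>edges G.
     integral\<^sup>L (lebesgue_on {0..elen G e}) (\<lambda>x. restr f e x * cnj (restr h e x)))"

text \<open>Functions are extended by \<open>0\<close> outside the graph, so that equality in the type
  \<open>'e \<times> real \<Rightarrow> complex\<close> is equality of functions on the graph.\<close>

definition H1 :: "('v, 'e) metric_graph \<Rightarrow> ('e \<times> real \<Rightarrow> complex) set" where
  "H1 G = {\<phi>. graph_continuous G \<phi> \<and> (\<forall>p. p \<notin> points G \<longrightarrow> \<phi> p = 0) \<and>
     (\<forall>e\<in>edges G. restr \<phi> e \<in> H1_interval (elen G e)) \<and>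
     (\<lambda>e. H1_norm_sq (elen G e) (restr \<phi> e)) summable_on edges G}"


section \<open>The Neumann Laplacian and its eigenvalues\<close>

text \<open>The sesquilinear form with domain \<open>H1 G\<close> whose quadratic form is the sum over all edges \<open>e\<close>
  of the integrals of \<open>|\<phi>'|\<^sup>2\<close>.\<close>

definition energy_form ::
    "('v, 'e) metric_graph \<Rightarrow> ('e \<times> real \<Rightarrow> complex) \<Rightarrow> ('e \<times> real \<Rightarrow> complex) \<Rightarrow> complex" where
  "energy_form G \<phi> \<psi> = (\<Sum>\<^sub>\<infinity>e\<in>edges G. integral\<^sup>L (lebesgue_on {0..elen G e})
     (\<lambda>x. weak_deriv (elen G e) (restr \<phi> e) x * cnj (weak_deriv (elen G e) (restr \<psi> e) x)))"

text \<open>The operator associated with the form, given by its graph: \<open>neumann_laplacian G \<phi> f\<close> says that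
  \<open>\<phi>\<close> belongs to the domain of the operator and is mapped to (the class of) \<open>f\<close>.\<close>

definition neumann_laplacian ::
    "('v, 'e) metric_graph \<Rightarrow> ('e \<times> real \<Rightarrow> complex) \<Rightarrow> ('e \<times> real \<Rightarrow> complex) \<Rightarrow> bool" where
  "neumann_laplacian G \<phi> f \<longleftrightarrow>
     \<phi> \<in> H1 G \<and> f \<in> L2 G \<and> (\<forall>\<psi>\<in>H1 G. energy_form G \<phi> \<psi> = L2_inner G f \<psi>)"

definition eigenspace :: "('v, 'e) metric_graph \<Rightarrow> real \<Rightarrow> ('e \<times> real \<Rightarrow> complex) set" where
  "eigenspace G \<mu> = {\<phi>. neumann_laplacian G \<phi> (\<lambda>p. of_real \<mu> * \<phi> p)}"

interpretation cfun: vector_space "\<lambda>(c::complex) (f :: 'a \<Rightarrow> complex) p. c * f p"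
  by unfold_locales (auto simp: fun_eq_iff algebra_simps)

definition has_finite_dim :: "('a \<Rightarrow> complex) set \<Rightarrow> nat \<Rightarrow> bool" where
  "has_finite_dim V n \<longleftrightarrow>
     (\<exists>B. finite B \<and> card B = n \<and> cfun.independent B \<and> cfun.span B = V)"

text \<open>\<open>ev 1 \<le> ev 2 \<le> \<dots>\<close> lists the eigenvalues of the (nonnegative, self-adjoint) Neumann Laplacian,
  each one as often as its multiplicity; \<open>ev 0\<close> is irrelevant. Numbers \<open>\<mu>\<close> that are not eigenvalues
  have a zero-dimensional eigenspace and so do not occur.\<close>

definition enumerates_eigenvalues :: "('v, 'e) metric_graph \<Rightarrow> (nat \<Rightarrow> real) \<Rightarrow> bool" where
  "enumerates_eigenvalues G ev \<longleftrightarrow>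
     mono_on {1..} ev \<and>
     (\<forall>\<mu>. finite {k. 1 \<le> k \<and> ev k = \<mu>} \<and>
       has_finite_dim (eigenspace G \<mu>) (card {k. 1 \<le> k \<and> ev k = \<mu>}))"

text \<open>The \<open>k\<close>-th eigenvalue, for \<open>k \<ge> 1\<close>. It is only meaningful if the eigenvalues can be enumerated in
  this way, as is the case for purely discrete spectrum.\<close>

definition neumann_eigenvalue :: "('v, 'e) metric_graph \<Rightarrow> nat \<Rightarrow> real" where
  "neumann_eigenvalue G k = (THE x. \<exists>ev. enumerates_eigenvalues G ev \<and> x = ev k)"


section \<open>The diagonal comb\<close>

text \<open>\<open>Foot n\<close> is the backbone point \<open>n powr -\<alpha>\<close> and \<open>Tip n\<close> the free end of the \<open>n\<close>-th tooth.
  \<open>Backbone n\<close> joins \<open>Foot (n + 1)\<close> to \<open>Foot n\<close>.\<close>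

datatype comb_vertex = Foot nat | Tip nat

datatype comb_edge = Tooth nat | Backbone nat

fun comb_len :: "real \<Rightarrow> comb_edge \<Rightarrow> real" where
  "comb_len \<alpha> (Tooth n) = real n powr (-\<alpha>)"
| "comb_len \<alpha> (Backbone n) = real n powr (-\<alpha>) - real (n + 1) powr (-\<alpha>)"

fun comb_src :: "comb_edge \<Rightarrow> comb_vertex" where
  "comb_src (Tooth n) = Foot n"
| "comb_src (Backbone n) = Foot (n + 1)"

fun comb_tgt :: "comb_edge \<Rightarrow> comb_vertex" where
  "comb_tgt (Tooth n) = Tip n"
| "comb_tgt (Backbone n) = Foot n"

definition diagonal_comb :: "real \<Rightarrow> (comb_vertex, comb_edge) metric_graph" where
  "diagonal_comb \<alpha> = \<lparr>edges = Tooth ` {1..} \<union> Backbone ` {1..},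
     elen = comb_len \<alpha>, src = comb_src, tgt = comb_tgt\<rparr>"

lemma metric_graph_diagonal_comb:
  assumes "\<alpha> > 0"
  shows "metric_graph (diagonal_comb \<alpha>)"
  using assms
  by (auto simp: metric_graph_def diagonal_comb_def intro!: powr_less_mono2_neg)

end

theory Submission
  imports Defs "HOL-Complex_Analysis.Great_Picard" "HOL-Real_Asymp.Real_Asymp"
begin

text \<open>Near the missing point \<open>0\<close> the comb has infinitely many teeth, of infinite total length. A square
integrable function of finite energy therefore takes arbitrarily small values at foot points near
\<open>0\<close> (\<open>foot_small\<close>), and since the backbone from the \<open>n\<close>-th foot to \<open>0\<close> has length \<open>1/n\<close>, the
Cauchy-Schwarz inequality along it gives \<open>|\<phi>|\<^sup>2 \<le> (4/n) E(\<phi>)\<close> on the \<open>n\<close>-th tooth and the \<open>n\<close>-th backbone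
edge, where \<open>E\<close> is the energy (\<open>comb_pointwise\<close>). These edges have length at most \<open>1/n\<close>, so the mass beyond
the \<open>M\<close>-th tooth is at most \<open>(8/M) E(\<phi>)\<close> (\<open>comb_tail\<close>), and bounded energy implies precompactness in
\<open>L2\<close> (\<open>energy_compact\<close>).

The eigenvalues come from minimizing the energy on the \<open>L2\<close> unit sphere, each time orthogonally to
the eigenfunctions already found. A minimizing sequence has an \<open>L2\<close> Cauchy subsequence; by the
parallelogram law this is Cauchy for the energy too, and the form domain is complete
(\<open>minimizer_exists\<close>, \<open>energy_complete\<close>). The minimizers span all eigenspaces (\<open>sys_complete\<close>), so their
energies enumerate the eigenvalues, and only one enumeration is possible (\<open>enumerates_unique\<close>).

Lower bound. Let \<open>u\<^sub>1, ..., u\<^sub>N\<close> be orthonormal eigenfunctions with eigenvalues at most \<open>K\<^sup>2\<close>. Then \<open>N\<close> is the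
integral over the graph of the sum of the \<open>|u\<^sub>i(p)|\<^sup>2\<close>, and this sum is the maximum of \<open>|\<phi>(p)|\<^sup>2\<close> over
the unit vectors \<open>\<phi>\<close> of the span, which all satisfy \<open>E(\<phi>) \<le> K\<^sup>2\<close>. On edges of index \<open>n \<le> K\<close> averaging
over a segment of length \<open>1/K\<close> bounds it by \<open>10 K\<close>; on edges of index \<open>n > K\<close> the decay above bounds it by
\<open>4 K\<^sup>2/n\<close>. Multiplying by the lengths and summing over \<open>n\<close> gives \<open>N = O(K ln K)\<close> (\<open>counting_bound\<close>).
With \<open>K\<close> about \<open>k/(ln k)\<^sup>2\<close> this is less than \<open>k\<close>, so the \<open>k\<close>-th eigenvalue exceeds \<open>K\<^sup>2\<close>.

Upper bound. Tooth \<open>n\<close> has room for the integer part of \<open>K/n\<close> disjoint bumps of width \<open>1/K\<close>, each with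
Rayleigh quotient at most \<open>405 K\<^sup>2\<close>. Altogether these are at least \<open>K ln K - K\<close> bumps, and the min-max
principle (\<open>sys_minmax\<close>) applies with \<open>K\<close> about \<open>4 k/ln k\<close>.\<close>

section \<open>Hermitian forms\<close>

text \<open>Both the \<open>L2\<close> inner product and the energy are instances, on different domains. Definiteness is not
part of the locale, so that differences such as \<open>E - \<mu> L\<close> on a constraint space are also covered.\<close>

locale hermitian_form =
  fixes H :: "('a \<Rightarrow> complex) set" and Q :: "('a \<Rightarrow> complex) \<Rightarrow> ('a \<Rightarrow> complex) \<Rightarrow> complex"
  assumes subspace: "cfun.subspace H"
    and add_left: "f \<in> H \<Longrightarrow> g \<in> H \<Longrightarrow> h \<in> H \<Longrightarrow> Q (f + g) h = Q f h + Q g h"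
    and scale_left: "f \<in> H \<Longrightarrow> h \<in> H \<Longrightarrow> Q (\<lambda>p. c * f p) h = c * Q f h"
    and sym: "f \<in> H \<Longrightarrow> g \<in> H \<Longrightarrow> Q g f = cnj (Q f g)"
    and nonneg: "f \<in> H \<Longrightarrow> 0 \<le> Re (Q f f)"
begin

definition nsq :: "('a \<Rightarrow> complex) \<Rightarrow> real" where "nsq f = Re (Q f f)"

lemma closed_scale: "f \<in> H \<Longrightarrow> (\<lambda>p. c * f p) \<in> H"
  using cfun.subspace_scale[OF subspace] by blast

lemma closed_add: "f \<in> H \<Longrightarrow> g \<in> H \<Longrightarrow> f + g \<in> H"
  using cfun.subspace_add[OF subspace] by blast

lemma closed_diff: "f \<in> H \<Longrightarrow> g \<in> H \<Longrightarrow> f - g \<in> H"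
  using cfun.subspace_diff[OF subspace] by blast

lemma closed_zero: "0 \<in> H"
  using cfun.subspace_0[OF subspace] .

lemma closed_sum: "(\<And>i. i \<in> I \<Longrightarrow> f i \<in> H) \<Longrightarrow> (\<Sum>i\<in>I. f i) \<in> H"
  using cfun.subspace_sum[OF subspace] by blast

lemma zero_left: "h \<in> H \<Longrightarrow> Q 0 h = 0"
  using scale_left[OF closed_zero, of h 0] by (simp add: zero_fun_def)

lemma diff_left: "f \<in> H \<Longrightarrow> g \<in> H \<Longrightarrow> h \<in> H \<Longrightarrow> Q (f - g) h = Q f h - Q g h"
  using add_left[of "f - g" g h] closed_diff by (simp add: algebra_simps)

lemma sum_left:
  assumes "finite I" "\<And>i. i \<in> I \<Longrightarrow> f i \<in> H" "h \<in> H"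
  shows "Q (\<Sum>i\<in>I. f i) h = (\<Sum>i\<in>I. Q (f i) h)"
  using assms by (induction I) (simp_all add: zero_left add_left closed_sum)

lemma scale_right: "f \<in> H \<Longrightarrow> h \<in> H \<Longrightarrow> Q f (\<lambda>p. c * h p) = cnj c * Q f h"
  using sym[of f "\<lambda>p. c * h p"] sym[of h f] sym[of f h] scale_left[of h f c] closed_scale[of h c]
  by (metis complex_cnj_cnj complex_cnj_mult)

lemma add_right: "f \<in> H \<Longrightarrow> g \<in> H \<Longrightarrow> h \<in> H \<Longrightarrow> Q h (f + g) = Q h f + Q h g"
  using sym[of "f + g" h] sym[of f h] sym[of g h] add_left[of f g h] closed_add[of f g] by simp

lemma diff_right: "f \<in> H \<Longrightarrow> g \<in> H \<Longrightarrow> h \<in> H \<Longrightarrow> Q h (f - g) = Q h f - Q h g"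
  using sym[of "f - g" h] sym[of f h] sym[of g h] diff_left[of f g h] closed_diff[of f g] by simp

lemma sum_right:
  assumes "finite I" "\<And>i. i \<in> I \<Longrightarrow> f i \<in> H" "h \<in> H"
  shows "Q h (\<Sum>i\<in>I. f i) = (\<Sum>i\<in>I. Q h (f i))"
  using assms
  by (induction I) (simp_all add: add_right closed_sum sym[OF closed_zero, of h, simplified] zero_left)

lemma Q_self: "f \<in> H \<Longrightarrow> Q f f = of_real (nsq f)"
  unfolding nsq_def using sym[of f f]
  by (simp add: complex_eq_iff complex_is_Real_iff)

lemma nsq_nonneg: "f \<in> H \<Longrightarrow> 0 \<le> nsq f"
  unfolding nsq_def by (rule nonneg)

lemma nsq_scale: "f \<in> H \<Longrightarrow> nsq (\<lambda>p. c * f p) = (cmod c)\<^sup>2 * nsq f"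
proof -
  assume f: "f \<in> H"
  have "Q (\<lambda>p. c * f p) (\<lambda>p. c * f p) = (c * cnj c) * of_real (nsq f)"
    using f closed_scale[OF f] by (simp add: scale_left scale_right Q_self)
  then show ?thesis
    unfolding nsq_def[of "\<lambda>p. c * f p"] by (simp flip: complex_norm_square of_real_mult)
qed

lemma nsq_add: "f \<in> H \<Longrightarrow> g \<in> H \<Longrightarrow> nsq (f + g) = nsq f + nsq g + 2 * Re (Q f g)"
  unfolding nsq_def by (simp add: add_left add_right closed_add sym[of f g])

lemma nsq_diff: "f \<in> H \<Longrightarrow> g \<in> H \<Longrightarrow> nsq (f - g) = nsq f + nsq g - 2 * Re (Q f g)"
  unfolding nsq_def by (simp add: diff_left diff_right closed_diff sym[of f g])

lemma parallelogram: "f \<in> H \<Longrightarrow> g \<in> H \<Longrightarrow> nsq (f + g) + nsq (f - g) = 2 * nsq f + 2 * nsq g"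
  by (simp add: nsq_add nsq_diff)

lemma nsq_add_le: "f \<in> H \<Longrightarrow> g \<in> H \<Longrightarrow> nsq (f + g) \<le> 2 * nsq f + 2 * nsq g"
  using parallelogram[of f g] nsq_nonneg[OF closed_diff, of f g] by simp

text \<open>The proof must allow \<open>nsq g = 0\<close>: the quadratic polynomial \<open>s \<mapsto> nsq (f - s Q f g g)\<close> is nonnegative for
all real \<open>s\<close>, and if its leading coefficient vanishes, so does its linear one.\<close>

lemma Cauchy_Schwarz:
  assumes f: "f \<in> H" and g: "g \<in> H"
  shows "(cmod (Q f g))\<^sup>2 \<le> nsq f * nsq g"
proof -
  let ?z = "Q f g"
  have key: "0 \<le> nsq f + s\<^sup>2 * (cmod ?z)\<^sup>2 * nsq g - 2 * s * (cmod ?z)\<^sup>2" for s :: real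
  proof -
    let ?h = "\<lambda>p. (of_real s * ?z) * g p"
    have h: "?h \<in> H" using closed_scale[OF g] .
    have "nsq ?h = (s * cmod ?z)\<^sup>2 * nsq g"
      using nsq_scale[OF g, of "of_real s * ?z"] by (simp add: norm_mult power_mult_distrib)
    moreover have "Q f ?h = of_real (s * (cmod ?z)\<^sup>2)"
      using scale_right[OF f g, of "of_real s * ?z"]
      by (simp add: complex_norm_square mult_ac del: of_real_power)
    ultimately show ?thesis
      using nsq_nonneg[OF closed_diff[OF f h]] nsq_diff[OF f h] by (simp add: power_mult_distrib)
  qed
  show ?thesis
  proof (cases "nsq g = 0")
    case True
    show ?thesis
    proof (rule ccontr)
      assume "\<not> ?thesis"
      then have z: "(cmod ?z)\<^sup>2 > 0" using True by simp
      define s where "s = (nsq f + 1) / (2 * (cmod ?z)\<^sup>2)"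
      have "2 * s * (cmod ?z)\<^sup>2 = nsq f + 1" using z by (simp add: s_def field_simps)
      then show False using key[of s] True by simp
    qed
  next
    case False
    then have pos: "nsq g > 0" using nsq_nonneg[OF g] by simp
    have "0 \<le> nsq f - (cmod ?z)\<^sup>2 / nsq g"
      using key[of "1 / nsq g"] pos by (simp add: power2_eq_square field_simps)
    then show ?thesis using pos by (simp add: field_simps)
  qed
qed

lemma orthogonal_combination:
  assumes "finite I" "\<And>i. i \<in> I \<Longrightarrow> u i \<in> H"
    and "\<And>i j. i \<in> I \<Longrightarrow> j \<in> I \<Longrightarrow> i \<noteq> j \<Longrightarrow> Q (u i) (u j) = 0"
  shows "nsq (\<Sum>i\<in>I. (\<lambda>p. c i * u i p)) = (\<Sum>i\<in>I. (cmod (c i))\<^sup>2 * nsq (u i))"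
proof -
  have "Q (\<Sum>i\<in>I. (\<lambda>p. c i * u i p)) (\<Sum>i\<in>I. (\<lambda>p. c i * u i p))
     = (\<Sum>i\<in>I. \<Sum>j\<in>I. c i * cnj (c j) * Q (u i) (u j))"
    using assms(1,2)
    by (subst sum.swap)
      (simp add: sum_left sum_right closed_sum closed_scale scale_left scale_right sum_distrib_left mult_ac)
  also have "\<dots> = (\<Sum>i\<in>I. \<Sum>j\<in>I. if i = j then c i * cnj (c i) * Q (u i) (u i) else 0)"
    by (intro sum.cong HOL.refl) (auto simp: assms(3))
  also have "\<dots> = (\<Sum>i\<in>I. of_real ((cmod (c i))\<^sup>2 * nsq (u i)))"
  proof (rule sum.cong[OF HOL.refl])
    fix i assume i: "i \<in> I"
    have "c i * cnj (c i) * Q (u i) (u i) = of_real ((cmod (c i))\<^sup>2 * nsq (u i))"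
      unfolding Q_self[OF assms(2)[OF i]] of_real_mult complex_norm_square by simp
    then show "(\<Sum>j\<in>I. if i = j then c i * cnj (c i) * Q (u i) (u i) else 0)
        = of_real ((cmod (c i))\<^sup>2 * nsq (u i))"
      using assms(1) i by simp
  qed
  finally show ?thesis unfolding nsq_def by simp
qed

lemma tendsto_nsq:
  assumes "\<And>n. f n \<in> H" "g \<in> H" "(\<lambda>n. nsq (f n - g)) \<longlonglongrightarrow> 0"
  shows "(\<lambda>n. nsq (f n)) \<longlonglongrightarrow> nsq g"
    and "h \<in> H \<Longrightarrow> (\<lambda>n. Q (f n) h) \<longlonglongrightarrow> Q g h"
proof -
  have Q0: "(\<lambda>n. Q (f n - g) h) \<longlonglongrightarrow> 0" if h: "h \<in> H" for h
  proof (rule tendsto_norm_zero_cancel, rule tendsto_sandwich[OF _ _ tendsto_const])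
    show "\<forall>\<^sub>F n in sequentially. norm (Q (f n - g) h) \<le> sqrt (nsq (f n - g) * nsq h)"
      using Cauchy_Schwarz[OF closed_diff[OF assms(1,2)] h] by (intro always_eventually allI real_le_rsqrt) simp
    show "(\<lambda>n. sqrt (nsq (f n - g) * nsq h)) \<longlonglongrightarrow> 0"
      using tendsto_real_sqrt[OF tendsto_mult_right[OF assms(3), of "nsq h"]] by simp
  qed simp
  show *: "(\<lambda>n. Q (f n) h) \<longlonglongrightarrow> Q g h" if "h \<in> H" for h
    using tendsto_add[OF Q0[OF that] tendsto_const[of "Q g h"]] assms(1,2) that by (simp add: diff_left)
  have "(\<lambda>n. nsq (f n - g) - nsq g + 2 * Re (Q (f n) g)) \<longlonglongrightarrow> 0 - nsq g + 2 * Re (Q g g)"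
    by (intro tendsto_intros assms(3) *[OF assms(2)])
  then show "(\<lambda>n. nsq (f n)) \<longlonglongrightarrow> nsq g"
    using assms(1,2) by (simp add: nsq_diff flip: nsq_def)
qed

text \<open>Applied to \<open>E - m L\<close>, where \<open>m\<close> is the minimal Rayleigh quotient, this is the Euler-Lagrange equation.\<close>

lemma null_vector_in_kernel:
  assumes "f \<in> H" "g \<in> H" "nsq f = 0"
  shows "Q f g = 0"
  using Cauchy_Schwarz[OF assms(1,2)] assms(3) by simp

end

text \<open>Gaussian elimination: one equation with a nonzero coefficient is solved for the variable \<open>i0\<close>, and
\<open>b\<close> is the matrix of the remaining equations after this substitution.\<close>

lemma underdetermined_linear_system:
  fixes a :: "'j \<Rightarrow> 'i \<Rightarrow> complex"
  assumes "finite J" "finite I" "card J < card I"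
  shows "\<exists>c. (\<exists>i\<in>I. c i \<noteq> 0) \<and> (\<forall>j\<in>J. (\<Sum>i\<in>I. c i * a j i) = 0)"
  using assms
proof (induction J arbitrary: I a rule: finite_induct)
  case empty
  then show ?case by (intro exI[of _ "\<lambda>_. 1"]) (use card_gt_0_iff in fastforce)
next
  case (insert j0 J)
  show ?case
  proof (cases "\<forall>i\<in>I. a j0 i = 0")
    case True
    obtain c where "\<exists>i\<in>I. c i \<noteq> 0" "\<forall>j\<in>J. (\<Sum>i\<in>I. c i * a j i) = 0"
      using insert.IH[of I a] insert.prems insert.hyps by auto
    then show ?thesis using True by (intro exI[of _ c]) auto
  next
    case False
    then obtain i0 where i0: "i0 \<in> I" "a j0 i0 \<noteq> 0" by blast
    let ?I = "I - {i0}"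
    define b where "b j i = a j i - a j i0 * a j0 i / a j0 i0" for j i
    have "card J < card ?I" using insert.prems insert.hyps i0 by simp
    then obtain c where c: "\<exists>i\<in>?I. c i \<noteq> 0" "\<forall>j\<in>J. (\<Sum>i\<in>?I. c i * b j i) = 0"
      using insert.IH[of ?I b] insert.prems by auto
    define s where "s = (\<Sum>i\<in>?I. c i * a j0 i)"
    define d where "d = c(i0 := - s / a j0 i0)"
    have split: "(\<Sum>i\<in>I. d i * a j i) = - s / a j0 i0 * a j i0 + (\<Sum>i\<in>?I. c i * a j i)" for j
    proof -
      have "(\<Sum>i\<in>?I. d i * a j i) = (\<Sum>i\<in>?I. c i * a j i)"
        by (intro sum.cong) (auto simp: d_def)
      then show ?thesis
        using sum.remove[OF insert.prems(1) i0(1), of "\<lambda>i. d i * a j i"] by (simp add: d_def)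
    qed
    have "(\<Sum>i\<in>I. d i * a j i) = 0" if "j \<in> J" for j
    proof -
      have "(\<Sum>i\<in>?I. c i * b j i) = (\<Sum>i\<in>?I. c i * a j i) - s * a j i0 / a j0 i0"
        by (simp add: b_def s_def algebra_simps sum_subtractf sum_distrib_left sum_divide_distrib)
      then show ?thesis using c(2) that by (simp add: split)
    qed
    moreover have "(\<Sum>i\<in>I. d i * a j0 i) = 0"
      using i0(2) by (simp add: split flip: s_def)
    moreover have "\<exists>i\<in>I. d i \<noteq> 0" using c(1) by (auto simp: d_def)
    ultimately show ?thesis by (intro exI[of _ d]) auto
  qed
qed

section \<open>Successive minimization of a Rayleigh quotient\<close>

text \<open>\<open>L\<close> plays the role of the inner product of the Hilbert space and \<open>E\<close> that of the form of the operator.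
Compactness of the embedding of the form domain and completeness are stated by sequences, so no
completion of \<open>H\<close> with respect to \<open>L\<close> has to be mentioned.\<close>

locale form_pair = L: hermitian_form H L + E: hermitian_form H E
  for H :: "('a \<Rightarrow> complex) set" and L E +
  assumes L_definite: "f \<in> H \<Longrightarrow> L.nsq f = 0 \<Longrightarrow> f = 0"
    and L_le_E: "\<exists>C>0. \<forall>f\<in>H. L.nsq f \<le> C * E.nsq f"
    and compact: "(\<And>k. F k \<in> H) \<Longrightarrow> (\<And>k. E.nsq (F k) \<le> B) \<Longrightarrow>
      \<exists>r :: nat \<Rightarrow> nat. strict_mono r \<and> (\<forall>\<epsilon>>0. \<exists>N. \<forall>m\<ge>N. \<forall>n\<ge>N. L.nsq (F (r m) - F (r n)) < \<epsilon>)"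
    and complete: "(\<And>k::nat. F k \<in> H) \<Longrightarrow> (\<And>\<epsilon>. \<epsilon> > 0 \<Longrightarrow> \<exists>N. \<forall>m\<ge>N. \<forall>n\<ge>N. E.nsq (F m - F n) < \<epsilon>) \<Longrightarrow>
      \<exists>g\<in>H. (\<lambda>n. E.nsq (F n - g)) \<longlonglongrightarrow> 0"
    and infinite_dim: "finite S \<Longrightarrow> S \<subseteq> H \<Longrightarrow> \<exists>w\<in>H. w \<noteq> 0 \<and> (\<forall>s\<in>S. L w s = 0)"
begin

definition orth :: "('a \<Rightarrow> complex) set \<Rightarrow> ('a \<Rightarrow> complex) set" where
  "orth S = {w\<in>H. \<forall>s\<in>S. L w s = 0}"

lemma L_nsq_pos: "f \<in> H \<Longrightarrow> f \<noteq> 0 \<Longrightarrow> 0 < L.nsq f"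
  using L_definite[of f] L.nsq_nonneg[of f] by force

text \<open>The direct method. A minimizing sequence has a subsequence that is Cauchy for \<open>L\<close>; the parallelogram
law turns this into the Cauchy property for \<open>E\<close>, and completeness provides the minimizer.\<close>

lemma minimizer_exists:
  assumes S: "finite S" "S \<subseteq> H"
  shows "\<exists>u\<in>orth S. L.nsq u = 1 \<and> (\<forall>w\<in>orth S. E.nsq u * L.nsq w \<le> E.nsq w)"
proof -
  have normalize: "\<exists>c. c > 0 \<and> (\<lambda>p. of_real c * w p) \<in> orth S \<and> L.nsq (\<lambda>p. of_real c * w p) = 1
      \<and> c\<^sup>2 * L.nsq w = 1" if w: "w \<in> orth S" "w \<noteq> 0" for w
  proof -
    have H: "w \<in> H" using w by (simp add: orth_def)
    have pos: "L.nsq w > 0" using L_nsq_pos[OF H w(2)] .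
    define c where "c = 1 / sqrt (L.nsq w)"
    have c: "c > 0" "c\<^sup>2 * L.nsq w = 1" using pos by (auto simp: c_def power_divide)
    have "(\<lambda>p. of_real c * w p) \<in> orth S"
      using w L.closed_scale[OF H] L.scale_left[OF H] S(2) by (auto simp: orth_def)
    then show ?thesis using c L.nsq_scale[OF H, of "of_real c"] by auto
  qed
  define U where "U = {w\<in>orth S. L.nsq w = 1}"
  define m where "m = Inf (E.nsq ` U)"
  obtain w0 where "w0 \<in> orth S" "w0 \<noteq> 0" using infinite_dim[OF S] by (auto simp: orth_def)
  then have U_ne: "U \<noteq> {}" using normalize unfolding U_def by blast
  have U_H: "w \<in> H" if "w \<in> U" for w using that by (simp add: U_def orth_def)
  have bdd: "bdd_below (E.nsq ` U)" using E.nsq_nonneg U_H by (intro bdd_belowI[of _ 0]) auto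
  have m_le: "m \<le> E.nsq w" if "w \<in> U" for w unfolding m_def by (rule cInf_lower) (use that bdd in auto)
  have m_orth: "m * L.nsq w \<le> E.nsq w" if w: "w \<in> orth S" for w
  proof (cases "w = 0")
    case True
    then show ?thesis
      using L.zero_left[OF L.closed_zero] E.zero_left[OF E.closed_zero] by (simp add: L.nsq_def E.nsq_def)
  next
    case False
    have H: "w \<in> H" using w by (simp add: orth_def)
    obtain c where c: "c > 0" "(\<lambda>p. of_real c * w p) \<in> U" "c\<^sup>2 * L.nsq w = 1"
      using normalize[OF w False] by (auto simp: U_def)
    have "m \<le> c\<^sup>2 * E.nsq w" using m_le[OF c(2)] E.nsq_scale[OF H, of "of_real c"] by simp
    then have "c\<^sup>2 * (m * L.nsq w) \<le> c\<^sup>2 * E.nsq w"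
      using c(3) by (metis mult.left_commute mult.right_neutral)
    then show ?thesis using c(1) by simp
  qed
  have "\<exists>w\<in>U. E.nsq w < m + 1 / real (Suc k)" for k
    using cInf_lessD[of "E.nsq ` U" "m + 1 / real (Suc k)"] U_ne unfolding m_def[symmetric] by auto
  then obtain f where f: "\<And>k. f k \<in> U" "\<And>k. E.nsq (f k) < m + 1 / real (Suc k)" by metis
  have fB: "E.nsq (f k) \<le> m + 1" for k
    using f(2)[of k] by (smt (verit) divide_le_eq_1 of_nat_0_le_iff of_nat_Suc)
  obtain r :: "nat \<Rightarrow> nat" where r: "strict_mono r"
    and r_Cauchy: "\<And>\<epsilon>. \<epsilon> > 0 \<Longrightarrow> \<exists>N. \<forall>a\<ge>N. \<forall>b\<ge>N. L.nsq (f (r a) - f (r b)) < \<epsilon>"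
    using compact[of f "m + 1"] f(1) fB U_H by blast
  define g where "g n = f (r n)" for n
  have gU: "g n \<in> U" for n unfolding g_def by (rule f)
  have gH: "g n \<in> H" for n using gU U_H by blast
  have g_E: "E.nsq (g n) < m + 1 / real (Suc n)" for n
  proof -
    have "1 / real (Suc (r n)) \<le> 1 / real (Suc n)"
      using seq_suble[OF r, of n] by (intro divide_left_mono) auto
    then show ?thesis using f(2)[of "r n"] unfolding g_def by linarith
  qed
  have m0: "0 \<le> m" unfolding m_def using U_ne E.nsq_nonneg U_H by (intro cInf_greatest) auto
  have E_diff: "E.nsq (g a - g b) \<le> 2 / real (Suc a) + 2 / real (Suc b) + m * L.nsq (g a - g b)" for a b
  proof -
    have "g a + g b \<in> orth S"
      using gU[of a] gU[of b] L.closed_add L.add_left S(2) by (auto simp: U_def orth_def)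
    from m_orth[OF this] have "m * L.nsq (g a + g b) \<le> E.nsq (g a + g b)" .
    moreover have "L.nsq (g a + g b) = 4 - L.nsq (g a - g b)"
      using L.parallelogram[OF gH[of a] gH[of b]] gU[of a] gU[of b] by (simp add: U_def)
    ultimately show ?thesis
      using E.parallelogram[OF gH[of a] gH[of b]] g_E[of a] g_E[of b] by (simp add: algebra_simps)
  qed
  have "\<exists>N. \<forall>a\<ge>N. \<forall>b\<ge>N. E.nsq (g a - g b) < \<epsilon>" if "\<epsilon> > 0" for \<epsilon>
  proof -
    have "\<epsilon> / (2 * (m + 1)) > 0" using that m0 by simp
    then obtain N where N: "\<forall>a\<ge>N. \<forall>b\<ge>N. L.nsq (g a - g b) < \<epsilon> / (2 * (m + 1))"
      using r_Cauchy unfolding g_def by blast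
    obtain M where M: "8 / \<epsilon> < real M" using reals_Archimedean2 by blast
    have small: "2 / real (Suc a) < \<epsilon> / 4" if "a \<ge> M" for a
    proof -
      have "8 / \<epsilon> < real (Suc a)" using M that by simp
      then show ?thesis using \<open>\<epsilon> > 0\<close> by (simp add: field_simps)
    qed
    have "E.nsq (g a - g b) < \<epsilon>" if ab: "a \<ge> max M N" "b \<ge> max M N" for a b
    proof -
      have "m * L.nsq (g a - g b) \<le> (m + 1) * (\<epsilon> / (2 * (m + 1)))"
        using N ab m0 L.nsq_nonneg[OF L.closed_diff[OF gH gH]]
        by (intro mult_mono) (auto intro!: less_imp_le)
      also have "\<dots> = \<epsilon> / 2" using m0 by (simp add: divide_simps)
      finally show ?thesis using E_diff[of a b] small[of a] small[of b] ab by simp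
    qed
    then show ?thesis by blast
  qed
  from complete[of g, OF gH this] obtain u where u: "u \<in> H" and lim: "(\<lambda>n. E.nsq (g n - u)) \<longlonglongrightarrow> 0"
    by blast
  obtain C where C: "C > 0" "\<forall>f\<in>H. L.nsq f \<le> C * E.nsq f" using L_le_E by blast
  have L_lim: "(\<lambda>n. L.nsq (g n - u)) \<longlonglongrightarrow> 0"
  proof (rule tendsto_sandwich[OF _ _ tendsto_const])
    show "(\<lambda>n. C * E.nsq (g n - u)) \<longlonglongrightarrow> 0" using tendsto_mult_left[OF lim, of C] by simp
  qed (use C L.closed_diff[OF gH u] L.nsq_nonneg in auto)
  have "L.nsq u = 1"
    using L.tendsto_nsq(1)[OF gH u L_lim] gU by (simp add: U_def LIMSEQ_const_iff)
  moreover have "u \<in> orth S"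
  proof -
    have "L u s = 0" if "s \<in> S" for s
      using L.tendsto_nsq(2)[OF gH u L_lim, of s] gU S(2) that by (auto simp: U_def orth_def LIMSEQ_const_iff)
    then show ?thesis using u by (simp add: orth_def)
  qed
  moreover have "E.nsq u \<le> m"
  proof (rule LIMSEQ_le[OF E.tendsto_nsq(1)[OF gH u lim]])
    show "(\<lambda>n. m + 1 / real (Suc n)) \<longlonglongrightarrow> m"
      using tendsto_add[OF tendsto_const[of m] LIMSEQ_inverse_real_of_nat] by (simp add: inverse_eq_divide)
  qed (use g_E less_imp_le in blast)
  moreover have "E.nsq u * L.nsq w \<le> E.nsq w" if "w \<in> orth S" for w
  proof -
    have "w \<in> H" using that by (simp add: orth_def)
    then show ?thesis
      using m_orth[OF that] mult_right_mono[OF \<open>E.nsq u \<le> m\<close> L.nsq_nonneg[OF \<open>w \<in> H\<close>]] by linarith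
  qed
  ultimately show ?thesis by blast
qed

text \<open>The form \<open>E - m L\<close> is nonnegative on \<open>D\<close> and vanishes at the minimizer, which thus lies in its kernel.\<close>

lemma Euler_Lagrange:
  assumes D: "cfun.subspace D" "D \<subseteq> H" and u: "u \<in> D" "L.nsq u = 1"
    and min: "\<And>w. w \<in> D \<Longrightarrow> E.nsq u * L.nsq w \<le> E.nsq w" and w: "w \<in> D"
  shows "E u w = of_real (E.nsq u) * L u w"
proof -
  define Q where "Q f g = E f g - of_real (E.nsq u) * L f g" for f g
  have DH: "f \<in> H" if "f \<in> D" for f using that D(2) by blast
  interpret Q: hermitian_form D Q
  proof
    fix f g assume f: "f \<in> D" and g: "g \<in> D"
    show "Q g f = cnj (Q f g)"
      using L.sym[OF DH[OF f] DH[OF g]] E.sym[OF DH[OF f] DH[OF g]] by (simp add: Q_def)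
    show "0 \<le> Re (Q f f)" using min[OF f] by (simp add: Q_def L.nsq_def E.nsq_def)
  qed (use D in \<open>auto simp: Q_def L.add_left E.add_left L.scale_left E.scale_left DH algebra_simps\<close>)
  have "Q.nsq u = 0" unfolding Q.nsq_def using u DH by (simp add: Q_def L.Q_self E.Q_self)
  from Q.null_vector_in_kernel[OF u(1) w this] show ?thesis by (simp add: Q_def)
qed

definition eigen :: "real \<Rightarrow> ('a \<Rightarrow> complex) set" where
  "eigen \<mu> = {\<phi>\<in>H. \<forall>\<psi>\<in>H. E \<phi> \<psi> = of_real \<mu> * L \<phi> \<psi>}"

lemma subspace_orth: "S \<subseteq> H \<Longrightarrow> cfun.subspace (orth S)"
  unfolding orth_def
  by (intro cfun.subspaceI)
    (auto simp: L.closed_zero L.closed_add L.closed_scale L.zero_left L.add_left L.scale_left subset_iff)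

lemma eigen_orthogonal:
  assumes "f \<in> eigen a" "g \<in> eigen b" "a \<noteq> b"
  shows "L f g = 0"
proof -
  have H: "f \<in> H" "g \<in> H" using assms by (auto simp: eigen_def)
  have "E f g = of_real a * L f g" using assms H by (simp add: eigen_def)
  moreover have "E g f = of_real b * L g f" using assms H by (simp add: eigen_def)
  ultimately have "of_real a * L f g = of_real b * L f g"
    using L.sym[OF H] E.sym[OF H] by (metis complex_cnj_cnj complex_cnj_complex_of_real complex_cnj_mult)
  then show ?thesis using assms(3) by simp
qed

text \<open>Each \<open>u k\<close> is a unit vector that minimizes the energy orthogonally to its predecessors; the energies
of the \<open>u k\<close> are the eigenvalues in increasing order.\<close>

definition eigensystem :: "(nat \<Rightarrow> 'a \<Rightarrow> complex) \<Rightarrow> bool" where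
  "eigensystem u \<longleftrightarrow> (\<forall>k. u k \<in> orth (u ` {..<k}) \<and> L.nsq (u k) = 1 \<and>
     (\<forall>w\<in>orth (u ` {..<k}). E.nsq (u k) * L.nsq w \<le> E.nsq w))"

lemma eigensystem_exists: "\<exists>u. eigensystem u"
proof -
  define P where "P f k u \<longleftrightarrow> (u \<in> H \<and> (f ` {..<k} \<subseteq> H \<longrightarrow> u \<in> orth (f ` {..<k}) \<and> L.nsq u = 1 \<and>
    (\<forall>w\<in>orth (f ` {..<k}). E.nsq u * L.nsq w \<le> E.nsq w)))" for f :: "nat \<Rightarrow> 'a \<Rightarrow> complex" and k u
  have "\<exists>u. \<forall>k. P u k (u k)"
  proof (rule dependent_wellorder_choice)
    fix r :: "'a \<Rightarrow> complex" and f g :: "nat \<Rightarrow> 'a \<Rightarrow> complex" and x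
    assume "\<And>y. y < x \<Longrightarrow> f y = g y"
    then have "f ` {..<x} = g ` {..<x}" by auto
    then show "P f x r = P g x r" by (simp add: P_def)
  next
    fix x and f :: "nat \<Rightarrow> 'a \<Rightarrow> complex"
    assume "\<And>y. y < x \<Longrightarrow> P f y (f y)"
    then have "f ` {..<x} \<subseteq> H" by (auto simp: P_def)
    from minimizer_exists[OF _ this] show "\<exists>r. P f x r" by (auto simp: P_def orth_def)
  qed
  then obtain u where u: "\<And>k. P u k (u k)" by blast
  then have "u k \<in> H" for k by (simp add: P_def)
  then have "u ` {..<k} \<subseteq> H" for k by blast
  then have "eigensystem u" using u by (simp add: P_def eigensystem_def)
  then show ?thesis by (intro exI[of _ u])
qed

context
  fixes u assumes sys: "eigensystem u"
begin

lemma sys_H: "u k \<in> H"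
  using sys by (simp add: eigensystem_def orth_def)

lemma sys_norm: "L.nsq (u k) = 1"
  using sys by (simp add: eigensystem_def)

lemma sys_orthogonal: "j \<noteq> k \<Longrightarrow> L (u j) (u k) = 0"
proof (induction j k rule: linorder_wlog)
  case (le a b)
  then have "L (u b) (u a) = 0" using sys by (simp add: eigensystem_def orth_def)
  then show ?case using L.sym[OF sys_H sys_H, of b a] by simp
next
  case (sym a b)
  then show ?case using L.sym[OF sys_H sys_H, of a b] by simp
qed

lemma sys_min: "w \<in> orth (u ` {..<k}) \<Longrightarrow> E.nsq (u k) * L.nsq w \<le> E.nsq w"
  using sys by (simp add: eigensystem_def)

lemma sys_mono: "i \<le> j \<Longrightarrow> E.nsq (u i) \<le> E.nsq (u j)"
  using sys_min[of "u j" i] sys_norm[of j] sys_H sys_orthogonal by (auto simp: orth_def)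

lemma sys_proj:
  assumes w: "w \<in> H" and K: "finite K"
  defines "v \<equiv> w - (\<Sum>i\<in>K. (\<lambda>p. L w (u i) * u i p))"
  shows "v \<in> H" "k \<in> K \<Longrightarrow> L v (u k) = 0" "k \<notin> K \<Longrightarrow> L v (u k) = L w (u k)"
proof -
  let ?s = "\<Sum>i\<in>K. (\<lambda>p. L w (u i) * u i p)"
  have s: "?s \<in> H" by (intro L.closed_sum L.closed_scale sys_H)
  show "v \<in> H" unfolding v_def by (intro L.closed_diff w s)
  have "L ?s (u k) = (\<Sum>i\<in>K. L w (u i) * L (u i) (u k))" for k
    using K by (simp add: L.sum_left L.closed_scale sys_H L.scale_left)
  moreover have "(\<Sum>i\<in>K. L w (u i) * L (u i) (u k)) = (\<Sum>i\<in>K. if i = k then L w (u k) else 0)" for k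
    by (intro sum.cong) (auto simp: sys_orthogonal L.Q_self sys_H sys_norm)
  ultimately have "L ?s (u k) = (if k \<in> K then L w (u k) else 0)" for k using K by simp
  then show "k \<in> K \<Longrightarrow> L v (u k) = 0" "k \<notin> K \<Longrightarrow> L v (u k) = L w (u k)"
    by (simp_all add: v_def L.diff_left w s sys_H)
qed

text \<open>The Euler-Lagrange equation holds against vectors orthogonal to the predecessors of \<open>u k\<close>. Against
the predecessors both sides vanish, because these are eigenvectors themselves.\<close>

lemma sys_eigen: "u k \<in> eigen (E.nsq (u k))"
proof (induction k rule: less_induct)
  case (less k)
  have "E (u k) w = of_real (E.nsq (u k)) * L (u k) w" if w: "w \<in> H" for w
  proof -
    let ?s = "\<Sum>i<k. (\<lambda>p. L w (u i) * u i p)" and ?D = "orth (u ` {..<k})"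
    have s: "?s \<in> H" by (intro L.closed_sum L.closed_scale sys_H)
    have v: "w - ?s \<in> ?D" using sys_proj[OF w, of "{..<k}"] by (auto simp: orth_def)
    have 1: "E (u k) (w - ?s) = of_real (E.nsq (u k)) * L (u k) (w - ?s)"
    proof (rule Euler_Lagrange[of ?D])
      show "cfun.subspace ?D" using sys_H by (intro subspace_orth) auto
      show "u k \<in> ?D" using sys by (simp add: eigensystem_def)
    qed (use v sys_min sys_norm in \<open>auto simp: orth_def\<close>)
    have 0: "E (u k) (u i) = 0" if "i < k" for i
    proof -
      have "E (u i) (u k) = 0" using less.IH[OF that] that sys_H by (simp add: eigen_def sys_orthogonal)
      then show ?thesis using E.sym[OF sys_H sys_H, of i k] by simp
    qed
    have "E (u k) ?s = 0" "L (u k) ?s = 0"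
      using 0 by (simp_all add: E.sum_right L.sum_right L.closed_scale sys_H E.scale_right L.scale_right sys_orthogonal)
    then show ?thesis using 1 by (simp add: E.diff_right L.diff_right w s sys_H)
  qed
  then show ?case by (simp add: eigen_def sys_H)
qed

lemma sys_E_orthogonal: "j \<noteq> k \<Longrightarrow> E (u j) (u k) = 0"
  using sys_eigen[of j] sys_H[of k] by (simp add: eigen_def sys_orthogonal)

text \<open>An orthonormal sequence has no \<open>L\<close> Cauchy subsequence, as its members are at squared distance \<open>2\<close>.\<close>

lemma sys_unbounded: "\<exists>k. E.nsq (u k) > B"
proof (rule ccontr)
  assume "\<not> ?thesis"
  then obtain r :: "nat \<Rightarrow> nat" where r: "strict_mono r"
    "\<forall>\<epsilon>>0. \<exists>N. \<forall>m\<ge>N. \<forall>n\<ge>N. L.nsq (u (r m) - u (r n)) < \<epsilon>"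
    using compact[of u B] sys_H by (meson leI)
  then obtain N where "L.nsq (u (r N) - u (r (Suc N))) < 1"
    by (metis le_Suc_eq zero_less_one order_refl)
  moreover have "r N \<noteq> r (Suc N)" using r(1) by (metis strict_mono_eq n_not_Suc_n)
  ultimately show False
    using L.nsq_diff[OF sys_H sys_H, of "r N" "r (Suc N)"] by (simp add: sys_norm sys_orthogonal)
qed

lemma sys_finite: "finite {k. E.nsq (u k) \<le> B}"
proof -
  obtain k where "E.nsq (u k) > B" using sys_unbounded by blast
  then have "{k. E.nsq (u k) \<le> B} \<subseteq> {..<k}" using sys_mono by (force simp: not_le)
  then show ?thesis using finite_subset by blast
qed

text \<open>The part of an eigenvector orthogonal to the listed eigenvectors of the same eigenvalue is orthogonal
to all \<open>u k\<close>. It is a competitor in every minimization problem, so its Rayleigh quotient \<open>\<mu>\<close> would bound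
all energies of the \<open>u k\<close> unless it is zero.\<close>

lemma sys_complete:
  assumes \<phi>: "\<phi> \<in> eigen \<mu>"
  shows "\<phi> = (\<Sum>i\<in>{k. E.nsq (u k) = \<mu>}. (\<lambda>p. L \<phi> (u i) * u i p))" (is "\<phi> = ?s")
proof -
  let ?K = "{k. E.nsq (u k) = \<mu>}"
  have K: "finite ?K" by (rule finite_subset[OF _ sys_finite[of \<mu>]]) auto
  have H: "\<phi> \<in> H" using \<phi> by (simp add: eigen_def)
  note P = sys_proj[OF H K]
  have s: "?s \<in> H" by (intro L.closed_sum L.closed_scale sys_H)
  have "L (\<phi> - ?s) (u k) = 0" for k
    using P(2,3)[of k] eigen_orthogonal[OF \<phi> sys_eigen, of k] by (cases "k \<in> ?K") auto
  then have orth: "\<phi> - ?s \<in> orth (u ` {..<k})" for k using P(1) by (simp add: orth_def image_subset_iff)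
  have "?s \<in> eigen \<mu>"
  proof -
    have "E ?s \<psi> = of_real \<mu> * L ?s \<psi>" if \<psi>: "\<psi> \<in> H" for \<psi>
    proof -
      have "E (u i) \<psi> = of_real \<mu> * L (u i) \<psi>" if "i \<in> ?K" for i
        using sys_eigen[of i] that \<psi> by (simp add: eigen_def)
      then have "(\<Sum>i\<in>?K. L \<phi> (u i) * E (u i) \<psi>) = of_real \<mu> * (\<Sum>i\<in>?K. L \<phi> (u i) * L (u i) \<psi>)"
        unfolding sum_distrib_left by (intro sum.cong) (auto simp: mult_ac)
      then show ?thesis
        using \<psi> K by (simp add: E.sum_left L.sum_left L.closed_scale sys_H E.scale_left L.scale_left)
    qed
    then show ?thesis using s by (simp add: eigen_def)
  qed
  then have "\<phi> - ?s \<in> eigen \<mu>"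
    using \<phi> P(1) by (auto simp: eigen_def E.diff_left L.diff_left algebra_simps)
  then have "E (\<phi> - ?s) (\<phi> - ?s) = of_real \<mu> * L (\<phi> - ?s) (\<phi> - ?s)" using P(1) by (simp add: eigen_def)
  then have E: "E.nsq (\<phi> - ?s) = \<mu> * L.nsq (\<phi> - ?s)" by (simp add: E.nsq_def L.nsq_def)
  obtain k where "E.nsq (u k) > \<mu>" using sys_unbounded by blast
  moreover have "(E.nsq (u k) - \<mu>) * L.nsq (\<phi> - ?s) \<le> 0"
    using sys_min[OF orth, of k] E by (simp add: algebra_simps)
  ultimately have "L.nsq (\<phi> - ?s) = 0"
    using L.nsq_nonneg[OF P(1)] by (auto simp: mult_le_0_iff)
  from L_definite[OF P(1) this] show ?thesis by simp
qed

lemma sys_inj: "inj u"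
  by (rule injI) (metis L.Q_self of_real_1 sys_H sys_norm sys_orthogonal zero_neq_one)

lemma sys_independent: "finite K \<Longrightarrow> cfun.independent (u ` K)"
proof -
  assume K: "finite K"
  have inj: "inj_on u K" using sys_inj by (rule inj_on_subset) auto
  show ?thesis
    unfolding cfun.independent_explicit_finite_subsets
  proof (intro allI impI ballI)
    fix A c v assume A: "A \<subseteq> u ` K" "finite A" and 0: "(\<Sum>v\<in>A. (\<lambda>p. c v * v p)) = 0" and v: "v \<in> A"
    obtain k where k: "v = u k" using A v by blast
    have AH: "a \<in> H" if "a \<in> A" for a using that A sys_H by blast
    have "0 = L (\<Sum>v\<in>A. (\<lambda>p. c v * v p)) v" by (simp add: 0 L.zero_left AH v)
    also have "\<dots> = (\<Sum>a\<in>A. c a * L a v)"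
      using A(2) by (simp add: L.sum_left L.closed_scale AH v L.scale_left)
    also have "\<dots> = (\<Sum>a\<in>A. if a = v then c v else 0)"
    proof (rule sum.cong[OF HOL.refl])
      fix a assume "a \<in> A"
      then obtain j where "a = u j" using A by blast
      then show "c a * L a v = (if a = v then c v else 0)"
        using k inj_eq[OF sys_inj] by (cases "j = k") (auto simp: sys_orthogonal L.Q_self sys_H sys_norm)
    qed
    finally show "c v = 0" using A(2) v by simp
  qed
qed

lemma sys_dim: "has_finite_dim (eigen \<mu>) (card {k. E.nsq (u k) = \<mu>})"
proof -
  let ?K = "{k. E.nsq (u k) = \<mu>}"
  have K: "finite ?K" by (rule finite_subset[OF _ sys_finite[of \<mu>]]) auto
  have "cfun.subspace (eigen \<mu>)"
    by (intro cfun.subspaceI) (auto simp: eigen_def L.closed_zero L.closed_add L.closed_scale L.zero_left L.add_left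
        L.scale_left E.zero_left E.add_left E.scale_left algebra_simps)
  then have "cfun.span (u ` ?K) \<subseteq> eigen \<mu>"
    using sys_eigen by (intro cfun.span_minimal) auto
  moreover have "eigen \<mu> \<subseteq> cfun.span (u ` ?K)"
  proof
    fix \<phi> assume "\<phi> \<in> eigen \<mu>"
    from sys_complete[OF this] show "\<phi> \<in> cfun.span (u ` ?K)"
      by (rule ssubst) (intro cfun.span_sum cfun.span_scale cfun.span_base imageI)
  qed
  ultimately show ?thesis
    unfolding has_finite_dim_def using sys_independent[OF K] card_image[OF inj_on_subset[OF sys_inj subset_UNIV]] K
    by (intro exI[of _ "u ` ?K"]) auto
qed

text \<open>Some combination of the more than \<open>m\<close> test vectors is orthogonal to \<open>u 0, ..., u (m - 1)\<close>, and its
Rayleigh quotient is at most that of the worst test vector since these are orthogonal for both forms.\<close>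

lemma sys_minmax:
  assumes I: "finite I" "m < card I" and w: "\<And>i. i \<in> I \<Longrightarrow> w i \<in> H" "\<And>i. i \<in> I \<Longrightarrow> w i \<noteq> 0"
    and orthL: "\<And>i j. i \<in> I \<Longrightarrow> j \<in> I \<Longrightarrow> i \<noteq> j \<Longrightarrow> L (w i) (w j) = 0"
    and orthE: "\<And>i j. i \<in> I \<Longrightarrow> j \<in> I \<Longrightarrow> i \<noteq> j \<Longrightarrow> E (w i) (w j) = 0"
    and le: "\<And>i. i \<in> I \<Longrightarrow> E.nsq (w i) \<le> B * L.nsq (w i)"
  shows "E.nsq (u m) \<le> B"
proof -
  obtain c where c: "\<exists>i\<in>I. c i \<noteq> 0" "\<forall>j\<in>{..<m}. (\<Sum>i\<in>I. c i * L (w i) (u j)) = 0"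
    using underdetermined_linear_system[of "{..<m}" I "\<lambda>j i. L (w i) (u j)"] I by auto
  let ?v = "\<Sum>i\<in>I. (\<lambda>p. c i * w i p)"
  have vH: "?v \<in> H" by (intro L.closed_sum L.closed_scale w)
  have "?v \<in> orth (u ` {..<m})"
    using c(2) I(1) w vH by (auto simp: orth_def L.sum_left L.closed_scale sys_H L.scale_left)
  from sys_min[OF this] have 1: "E.nsq (u m) * L.nsq ?v \<le> E.nsq ?v" .
  have L: "L.nsq ?v = (\<Sum>i\<in>I. (cmod (c i))\<^sup>2 * L.nsq (w i))"
    by (rule L.orthogonal_combination) (use I w orthL in auto)
  have E: "E.nsq ?v = (\<Sum>i\<in>I. (cmod (c i))\<^sup>2 * E.nsq (w i))"
    by (rule E.orthogonal_combination) (use I w orthE in auto)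
  have "E.nsq ?v \<le> B * L.nsq ?v"
    unfolding L E sum_distrib_left using mult_left_mono[OF le, of _ "(cmod (c _))\<^sup>2"]
    by (intro sum_mono) (simp add: mult_ac)
  moreover have "L.nsq ?v > 0"
  proof -
    obtain i where i: "i \<in> I" "c i \<noteq> 0" using c by blast
    show ?thesis unfolding L
      by (rule sum_pos2[OF I(1) i(1)]) (use i w L_nsq_pos L.nsq_nonneg in auto)
  qed
  ultimately have "E.nsq (u m) * L.nsq ?v \<le> B * L.nsq ?v" using 1 by linarith
  then show ?thesis using \<open>L.nsq ?v > 0\<close> by (rule mult_right_le_imp_le)
qed

end

end

section \<open>Square integrable functions\<close>

definition sqint :: "'a measure \<Rightarrow> ('a \<Rightarrow> complex) \<Rightarrow> bool" where
  "sqint M f \<longleftrightarrow> f \<in> borel_measurable M \<and> integrable M (\<lambda>x. (cmod (f x))\<^sup>2)"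

definition ip :: "'a measure \<Rightarrow> ('a \<Rightarrow> complex) \<Rightarrow> ('a \<Rightarrow> complex) \<Rightarrow> complex" where
  "ip M f g = (\<integral>x. f x * cnj (g x) \<partial>M)"

lemma cnj_borel_measurable [measurable (raw)]:
  "f \<in> borel_measurable M \<Longrightarrow> (\<lambda>x. cnj (f x)) \<in> borel_measurable M"
  by (rule measurable_compose[OF _ borel_measurable_continuous_onI]) (auto intro: continuous_intros)

lemma sqint_measurable: "sqint M f \<Longrightarrow> f \<in> borel_measurable M"
  by (simp add: sqint_def)

lemma cmod_add_sq_le: "(cmod (a + b))\<^sup>2 \<le> 2 * (cmod a)\<^sup>2 + 2 * (cmod b)\<^sup>2"
proof -
  have "(cmod (a + b))\<^sup>2 \<le> (cmod a + cmod b)\<^sup>2" by (intro power_mono norm_triangle_ineq norm_ge_zero)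
  also have "\<dots> \<le> 2 * (cmod a)\<^sup>2 + 2 * (cmod b)\<^sup>2"
    using zero_le_power2[of "cmod a - cmod b"] by (simp add: power2_sum power2_diff)
  finally show ?thesis .
qed

lemma sqint_add: assumes "sqint M f" "sqint M g" shows "sqint M (f + g)"
proof -
  have [measurable]: "f \<in> borel_measurable M" "g \<in> borel_measurable M" using assms sqint_measurable by auto
  have "integrable M (\<lambda>x. (cmod (f x + g x))\<^sup>2)"
  proof (rule Bochner_Integration.integrable_bound)
    show "integrable M (\<lambda>x. 2 * (cmod (f x))\<^sup>2 + 2 * (cmod (g x))\<^sup>2)" using assms by (simp add: sqint_def)
    show "AE x in M. norm ((cmod (f x + g x))\<^sup>2) \<le> norm (2 * (cmod (f x))\<^sup>2 + 2 * (cmod (g x))\<^sup>2)"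
      using cmod_add_sq_le by (intro AE_I2) simp
  qed measurable
  then show ?thesis by (simp add: sqint_def plus_fun_def)
qed

lemma sqint_scale: "sqint M f \<Longrightarrow> sqint M (\<lambda>x. c * f x)"
  unfolding sqint_def by (auto simp: norm_mult power_mult_distrib)

lemma integrable_ip: assumes "sqint M f" "sqint M g" shows "integrable M (\<lambda>x. f x * cnj (g x))"
proof (rule Bochner_Integration.integrable_bound)
  have [measurable]: "f \<in> borel_measurable M" "g \<in> borel_measurable M" using assms sqint_measurable by auto
  show "integrable M (\<lambda>x. (cmod (f x))\<^sup>2 + (cmod (g x))\<^sup>2)" using assms by (simp add: sqint_def)
  show "(\<lambda>x. f x * cnj (g x)) \<in> borel_measurable M" by measurable
  have "a * b \<le> a\<^sup>2 + b\<^sup>2" if "a \<ge> 0" "b \<ge> 0" for a b :: real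
    using sum_squares_bound[of a b] mult_nonneg_nonneg[OF that] by simp
  then show "AE x in M. norm (f x * cnj (g x)) \<le> norm ((cmod (f x))\<^sup>2 + (cmod (g x))\<^sup>2)"
    by (intro AE_I2) (simp add: norm_mult)
qed

lemma hermitian_form_ip: "hermitian_form (Collect (sqint M)) (ip M)"
proof
  show "cfun.subspace (Collect (sqint M))"
  proof (rule cfun.subspaceI)
    show "0 \<in> Collect (sqint M)" by (simp add: sqint_def zero_fun_def)
  qed (auto intro: sqint_add sqint_scale)
  fix f g h :: "'a \<Rightarrow> complex" and c
  assume "f \<in> Collect (sqint M)" "g \<in> Collect (sqint M)" and "h \<in> Collect (sqint M)"
  then show "ip M (f + g) h = ip M f h + ip M g h"
    unfolding ip_def by (simp add: distrib_right integrable_ip)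
next
  fix f h :: "'a \<Rightarrow> complex" and c
  assume "f \<in> Collect (sqint M)" "h \<in> Collect (sqint M)"
  then show "ip M (\<lambda>p. c * f p) h = c * ip M f h"
    unfolding ip_def by (simp add: mult.assoc)
next
  fix f g :: "'a \<Rightarrow> complex"
  assume "f \<in> Collect (sqint M)" "g \<in> Collect (sqint M)"
  show "ip M g f = cnj (ip M f g)"
    unfolding ip_def Bochner_Integration.integral_cnj[symmetric] by (simp add: mult.commute)
next
  fix f :: "'a \<Rightarrow> complex"
  assume "f \<in> Collect (sqint M)"
  have "ip M f f = of_real (\<integral>x. (cmod (f x))\<^sup>2 \<partial>M)"
    unfolding ip_def integral_complex_of_real[symmetric] by (simp add: complex_norm_square del: of_real_power)
  then show "0 \<le> Re (ip M f f)" by simp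
qed

lemma ip_self: "ip M f f = of_real (\<integral>x. (cmod (f x))\<^sup>2 \<partial>M)"
  unfolding ip_def integral_complex_of_real[symmetric] by (simp add: complex_norm_square del: of_real_power)

lemma nsq_ip: "hermitian_form.nsq (ip M) f = (\<integral>x. (cmod (f x))\<^sup>2 \<partial>M)"
  unfolding hermitian_form.nsq_def[OF hermitian_form_ip] ip_self by simp

lemma sqint_indicator:
  assumes "finite_measure M" "A \<in> sets M"
  shows "sqint M (\<lambda>x. of_real (indicator A x))"
    and "(\<integral>x. (cmod (of_real (indicator A x)))\<^sup>2 \<partial>M) = measure M A"
proof -
  interpret finite_measure M by fact
  have eq: "(\<lambda>x. (cmod (of_real (indicator A x)))\<^sup>2) = (\<lambda>x. indicator A x :: real)"
    by (auto simp: indicator_def)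
  have "integrable M (\<lambda>x. indicator A x :: real)"
    using assms(2) by (simp add: emeasure_eq_measure)
  then show "sqint M (\<lambda>x. of_real (indicator A x))" 
    unfolding sqint_def eq using assms(2) by simp
  show "(\<integral>x. (cmod (of_real (indicator A x)))\<^sup>2 \<partial>M) = measure M A"
    unfolding eq using assms(2) by simp
qed

lemma sqint_integrable:
  assumes "finite_measure M" "sqint M f" shows "integrable M f"
    and "A \<in> sets M \<Longrightarrow> (cmod (\<integral>x. indicator A x *\<^sub>R f x \<partial>M))\<^sup>2 \<le> measure M A * (\<integral>x. (cmod (f x))\<^sup>2 \<partial>M)"
proof -
  interpret h: hermitian_form "Collect (sqint M)" "ip M" by (rule hermitian_form_ip)
  have 1: "sqint M (\<lambda>x. of_real (indicator (space M) x))"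
    using sqint_indicator(1)[OF assms(1) sets.top] .
  show "integrable M f"
    using integrable_ip[OF assms(2) 1] by (rule Bochner_Integration.integrable_cong[THEN iffD1, rotated 2]) auto
  assume A: "A \<in> sets M"
  have "ip M f (\<lambda>x. of_real (indicator A x)) = (\<integral>x. indicator A x *\<^sub>R f x \<partial>M)"
    unfolding ip_def by (rule Bochner_Integration.integral_cong) (auto simp: indicator_def)
  then show "(cmod (\<integral>x. indicator A x *\<^sub>R f x \<partial>M))\<^sup>2 \<le> measure M A * (\<integral>x. (cmod (f x))\<^sup>2 \<partial>M)"
    using h.Cauchy_Schwarz[of f "\<lambda>x. of_real (indicator A x)"] assms(2) sqint_indicator[OF assms(1) A]
    by (simp add: nsq_ip mult.commute)
qed

text \<open>On a finite measure space an \<open>L2\<close> Cauchy sequence is an \<open>L1\<close> Cauchy sequence, hence some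
subsequence converges almost everywhere. Fatou's lemma then bounds the \<open>L2\<close> distance to that limit.\<close>

lemma Riesz_Fischer:
  assumes fin: "finite_measure M" and f: "\<And>k. sqint M (f k)"
    and Cauchy: "\<And>\<epsilon>. \<epsilon> > 0 \<Longrightarrow> \<exists>N. \<forall>m\<ge>N. \<forall>n\<ge>N. (\<integral>x. (cmod (f m x - f n x))\<^sup>2 \<partial>M) < \<epsilon>"
  shows "\<exists>g. sqint M g \<and> (\<lambda>n. \<integral>x. (cmod (f n x - g x))\<^sup>2 \<partial>M) \<longlonglongrightarrow> 0"
proof -
  interpret finite_measure M by fact
  interpret h: hermitian_form "Collect (sqint M)" "ip M" by (rule hermitian_form_ip)
  note [measurable] = sqint_measurable[OF f]
  have diff: "sqint M (\<lambda>x. f m x - f n x)" for m n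
    using h.closed_diff[of "f m" "f n"] f by (simp add: fun_diff_def)
  have nn: "sqint M (\<lambda>x. of_real (cmod (f m x - f n x)))" for m n
    using diff[of m n] by (auto simp: sqint_def)
  have L1: "(\<integral>x. cmod (f m x - f n x) \<partial>M) \<le> sqrt (measure M (space M) * (\<integral>x. (cmod (f m x - f n x))\<^sup>2 \<partial>M))" for m n
  proof -
    have "(\<integral>x. indicator (space M) x *\<^sub>R complex_of_real (cmod (f m x - f n x)) \<partial>M)
        = (\<integral>x. complex_of_real (cmod (f m x - f n x)) \<partial>M)"
      by (rule Bochner_Integration.integral_cong) auto
    then have "(\<integral>x. cmod (f m x - f n x) \<partial>M)\<^sup>2 \<le> measure M (space M) * (\<integral>x. (cmod (f m x - f n x))\<^sup>2 \<partial>M)"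
      using sqint_integrable(2)[OF fin nn[of m n] sets.top] by simp
    then show ?thesis by (rule real_le_rsqrt)
  qed
  obtain r :: "nat \<Rightarrow> nat" where r: "strict_mono r" "AE x in M. Cauchy (\<lambda>i. f (r i) x)"
  proof (rule cauchy_L1_AE_cauchy_subseq[of M f])
    show "integrable M (f n)" for n using sqint_integrable(1)[OF fin f] .
    fix e :: real assume e: "e > 0"
    have "e\<^sup>2 / (measure M (space M) + 1) > 0" using e by (simp add: add_nonneg_pos)
    from Cauchy[OF this] obtain N where
      N: "\<forall>m\<ge>N. \<forall>n\<ge>N. (\<integral>x. (cmod (f m x - f n x))\<^sup>2 \<partial>M) < e\<^sup>2 / (measure M (space M) + 1)" by blast
    have "(\<integral>x. cmod (f m x - f n x) \<partial>M) < e" if "m \<ge> N" "n \<ge> N" for m n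
    proof -
      let ?I = "(\<integral>x. (cmod (f m x - f n x))\<^sup>2 \<partial>M)" and ?c = "measure M (space M)"
      have "?c * ?I \<le> (?c + 1) * ?I" by (intro mult_right_mono) auto
      also have "\<dots> < (?c + 1) * (e\<^sup>2 / (?c + 1))"
        using N that by (intro mult_strict_left_mono) (auto simp: add_nonneg_pos)
      also have "\<dots> = e\<^sup>2" using measure_nonneg[of M "space M"] by (simp add: add_nonneg_eq_0_iff)
      finally have "sqrt (?c * ?I) < e" using e by (simp add: real_less_lsqrt)
      then show ?thesis using L1[of m n] by simp
    qed
    then show "\<exists>N. \<forall>i\<ge>N. \<forall>j\<ge>N. (\<integral>x. cmod (f i x - f j x) \<partial>M) < e" by blast
  qed blast
  define g where "g x = lim (\<lambda>i. f (r i) x)" for x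
  have gm[measurable]: "g \<in> borel_measurable M" unfolding g_def by measurable
  have lim: "AE x in M. (\<lambda>i. f (r i) x) \<longlonglongrightarrow> g x"
    using r(2) by eventually_elim (simp add: g_def Cauchy_convergent_iff convergent_LIMSEQ_iff)
  have Fatou: "(\<integral>\<^sup>+x. ennreal ((cmod (f n x - g x))\<^sup>2) \<partial>M) \<le> ennreal \<epsilon>"
    if N: "\<forall>m\<ge>N. \<forall>n\<ge>N. (\<integral>x. (cmod (f m x - f n x))\<^sup>2 \<partial>M) < \<epsilon>" and n: "n \<ge> N" for \<epsilon> N n
  proof -
    have "(\<integral>\<^sup>+x. ennreal ((cmod (f n x - g x))\<^sup>2) \<partial>M)
        = (\<integral>\<^sup>+x. liminf (\<lambda>i. ennreal ((cmod (f n x - f (r i) x))\<^sup>2)) \<partial>M)"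
    proof (rule nn_integral_cong_AE, use lim in eventually_elim)
      fix x assume "(\<lambda>i. f (r i) x) \<longlonglongrightarrow> g x"
      then have "(\<lambda>i. ennreal ((cmod (f n x - f (r i) x))\<^sup>2)) \<longlonglongrightarrow> ennreal ((cmod (f n x - g x))\<^sup>2)"
        by (intro tendsto_intros tendsto_ennrealI)
      then show "ennreal ((cmod (f n x - g x))\<^sup>2) = liminf (\<lambda>i. ennreal ((cmod (f n x - f (r i) x))\<^sup>2))"
        using lim_imp_Liminf[OF sequentially_bot] by metis
    qed
    also have "\<dots> \<le> liminf (\<lambda>i. \<integral>\<^sup>+x. ennreal ((cmod (f n x - f (r i) x))\<^sup>2) \<partial>M)"
      by (rule nn_integral_liminf) measurable
    also have "\<dots> \<le> liminf (\<lambda>i. ennreal \<epsilon>)"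
    proof (rule Liminf_mono, rule eventually_sequentiallyI[of N])
      fix i assume "i \<ge> N"
      then have "r i \<ge> N" using seq_suble[OF r(1), of i] by simp
      then have "(\<integral>x. (cmod (f n x - f (r i) x))\<^sup>2 \<partial>M) \<le> \<epsilon>" using N n by (simp add: less_imp_le)
      moreover have "(\<integral>\<^sup>+x. ennreal ((cmod (f n x - f (r i) x))\<^sup>2) \<partial>M) = ennreal (\<integral>x. (cmod (f n x - f (r i) x))\<^sup>2 \<partial>M)"
        using diff by (intro nn_integral_eq_integral) (auto simp: sqint_def)
      ultimately show "(\<integral>\<^sup>+x. ennreal ((cmod (f n x - f (r i) x))\<^sup>2) \<partial>M) \<le> ennreal \<epsilon>"
        by (simp add: ennreal_leI)
    qed
    finally show ?thesis by (simp add: Liminf_const)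
  qed
  have int: "integrable M (\<lambda>x. (cmod (f n x - g x))\<^sup>2) \<and> (\<integral>x. (cmod (f n x - g x))\<^sup>2 \<partial>M) \<le> \<epsilon>"
    if "\<forall>m\<ge>N. \<forall>n\<ge>N. (\<integral>x. (cmod (f m x - f n x))\<^sup>2 \<partial>M) < \<epsilon>" "n \<ge> N" "\<epsilon> > 0" for \<epsilon> N n
  proof -
    have I: "integrable M (\<lambda>x. (cmod (f n x - g x))\<^sup>2)"
      using Fatou[OF that(1,2)] by (intro integrableI_bounded) (auto intro: le_less_trans)
    then have "ennreal (\<integral>x. (cmod (f n x - g x))\<^sup>2 \<partial>M) \<le> ennreal \<epsilon>"
      using Fatou[OF that(1,2)] by (subst nn_integral_eq_integral[symmetric]) auto
    then show ?thesis using I that(3) by simp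
  qed
  obtain N1 where N1: "\<forall>m\<ge>N1. \<forall>n\<ge>N1. (\<integral>x. (cmod (f m x - f n x))\<^sup>2 \<partial>M) < 1" using Cauchy[of 1] by auto
  have "sqint M (\<lambda>x. f N1 x - g x)" using int[OF N1, of N1] by (simp add: sqint_def)
  then have "sqint M g"
    using h.closed_diff[of "f N1" "\<lambda>x. f N1 x - g x"] f by (simp add: fun_diff_def)
  moreover have "(\<lambda>n. \<integral>x. (cmod (f n x - g x))\<^sup>2 \<partial>M) \<longlonglongrightarrow> 0"
  proof (rule LIMSEQ_I)
    fix e :: real assume e: "e > 0"
    obtain N where N: "\<forall>m\<ge>N. \<forall>n\<ge>N. (\<integral>x. (cmod (f m x - f n x))\<^sup>2 \<partial>M) < e / 2" using Cauchy[of "e/2"] e by auto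
    have "norm ((\<integral>x. (cmod (f n x - g x))\<^sup>2 \<partial>M) - 0) < e" if "n \<ge> N" for n
      using int[OF N that] e by simp
    then show "\<exists>N. \<forall>n\<ge>N. norm ((\<integral>x. (cmod (f n x - g x))\<^sup>2 \<partial>M) - 0) < e" by blast
  qed
  ultimately show ?thesis by blast
qed

section \<open>Weak derivatives\<close>

lemma L2_interval_iff: "f \<in> L2_interval l \<longleftrightarrow> sqint (lebesgue_on {0..l}) f"
  by (simp add: L2_interval_def sqint_def)

lemma finite_measure_interval: "finite_measure (lebesgue_on {0..l::real})"
  by (simp add: finite_measure_lebesgue_on)

lemma measure_interval: 
  assumes "0 \<le> x" "x \<le> y" "y \<le> l"
  shows "{x<..y} \<in> sets (lebesgue_on {0..l::real})" "measure (lebesgue_on {0..l}) {x<..y} = y - x"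
    "{x..y} \<in> sets (lebesgue_on {0..l::real})" "measure (lebesgue_on {0..l}) {x..y} = y - x"
proof -
  have sub: "{x<..y} \<subseteq> {0..l}" "{x..y} \<subseteq> {0..l}" using assms by auto
  then show "{x<..y} \<in> sets (lebesgue_on {0..l::real})" "{x..y} \<in> sets (lebesgue_on {0..l::real})"
    by (auto simp: sets_restrict_space_iff)
  show "measure (lebesgue_on {0..l}) {x<..y} = y - x" "measure (lebesgue_on {0..l}) {x..y} = y - x"
    using assms sub by (simp_all add: measure_restrict_space measure_completion)
qed

lemma sqint_continuous:
  assumes "continuous_on {0..l::real} f" shows "sqint (lebesgue_on {0..l}) f"
proof -
  interpret finite_measure "lebesgue_on {0..l}" by (rule finite_measure_interval)
  have m: "f \<in> borel_measurable (lebesgue_on {0..l})"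
    using assms by (intro continuous_imp_measurable_on_sets_lebesgue) auto
  have "compact (f ` {0..l})" using assms by (intro compact_continuous_image) auto
  then obtain B where B: "\<And>x. x \<in> {0..l} \<Longrightarrow> cmod (f x) \<le> B" using compact_imp_bounded bounded_iff by (metis imageI)
  have "integrable (lebesgue_on {0..l}) (\<lambda>x. (cmod (f x))\<^sup>2)"
  proof (rule integrable_const_bound)
    show "AE x in lebesgue_on {0..l}. norm ((cmod (f x))\<^sup>2) \<le> B\<^sup>2"
      using B by (intro AE_I2) (auto intro: power_mono)
    show "(\<lambda>x. (cmod (f x))\<^sup>2) \<in> borel_measurable (lebesgue_on {0..l})" using m by measurable
  qed
  then show ?thesis using m by (simp add: sqint_def)
qed

definition test_pair :: "real \<Rightarrow> (real \<Rightarrow> real) \<Rightarrow> (real \<Rightarrow> real) \<Rightarrow> bool" where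
  "test_pair l \<psi> \<psi>' \<longleftrightarrow> (\<forall>x. (\<psi> has_real_derivative \<psi>' x) (at x)) \<and> continuous_on UNIV \<psi>' \<and>
     (\<exists>a b. 0 < a \<and> b < l \<and> (\<forall>x. x \<notin> {a..b} \<longrightarrow> \<psi> x = 0))"

text \<open>In terms of the inner product, the linearity and closedness of weak derivatives become linearity and
continuity of \<open>ip\<close> in its first argument.\<close>

lemma is_weak_deriv_iff:
  "is_weak_deriv l f g \<longleftrightarrow> (\<forall>\<psi> \<psi>'. test_pair l \<psi> \<psi>' \<longrightarrow>
     ip (lebesgue_on {0..l}) f (\<lambda>x. of_real (\<psi>' x)) = - ip (lebesgue_on {0..l}) g (\<lambda>x. of_real (\<psi> x)))"
  by (simp add: is_weak_deriv_def test_pair_def ip_def)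

lemma test_pair_sqint:
  assumes "test_pair l \<psi> \<psi>'"
  shows "sqint (lebesgue_on {0..l}) (\<lambda>x. of_real (\<psi> x))" "sqint (lebesgue_on {0..l}) (\<lambda>x. of_real (\<psi>' x))"
proof -
  have "continuous_on UNIV \<psi>" using assms DERIV_isCont
    by (auto simp: test_pair_def intro!: continuous_at_imp_continuous_on)
  then show "sqint (lebesgue_on {0..l}) (\<lambda>x. of_real (\<psi> x))"
    by (intro sqint_continuous continuous_on_of_real) (rule continuous_on_subset, auto)
  have "continuous_on UNIV \<psi>'" using assms by (auto simp: test_pair_def)
  then show "sqint (lebesgue_on {0..l}) (\<lambda>x. of_real (\<psi>' x))"
    by (intro sqint_continuous continuous_on_of_real) (rule continuous_on_subset, auto)
qed

lemma weak_deriv_add: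
  assumes "f \<in> L2_interval l" "g \<in> L2_interval l" "f' \<in> L2_interval l" "g' \<in> L2_interval l"
    and "is_weak_deriv l f f'" "is_weak_deriv l g g'"
  shows "is_weak_deriv l (f + g) (f' + g')"
proof -
  interpret h: hermitian_form "Collect (sqint (lebesgue_on {0..l}))" "ip (lebesgue_on {0..l})"
    by (rule hermitian_form_ip)
  show ?thesis using assms test_pair_sqint by (auto simp: is_weak_deriv_iff L2_interval_iff h.add_left)
qed

lemma weak_deriv_scale:
  assumes "f \<in> L2_interval l" "f' \<in> L2_interval l" "is_weak_deriv l f f'"
  shows "is_weak_deriv l (\<lambda>x. c * f x) (\<lambda>x. c * f' x)"
proof -
  interpret h: hermitian_form "Collect (sqint (lebesgue_on {0..l}))" "ip (lebesgue_on {0..l})"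
    by (rule hermitian_form_ip)
  show ?thesis using assms test_pair_sqint by (auto simp: is_weak_deriv_iff L2_interval_iff h.scale_left)
qed

lemma weak_deriv_limit:
  assumes "\<And>n. f n \<in> L2_interval l" "\<And>n. g n \<in> L2_interval l" "\<And>n. is_weak_deriv l (f n) (g n)"
    and "F \<in> L2_interval l" "G \<in> L2_interval l"
    and "(\<lambda>n. \<integral>x. (cmod (f n x - F x))\<^sup>2 \<partial>lebesgue_on {0..l}) \<longlonglongrightarrow> 0"
    and "(\<lambda>n. \<integral>x. (cmod (g n x - G x))\<^sup>2 \<partial>lebesgue_on {0..l}) \<longlonglongrightarrow> 0"
  shows "is_weak_deriv l F G"
proof -
  let ?M = "lebesgue_on {0..l}"
  interpret h: hermitian_form "Collect (sqint ?M)" "ip ?M" by (rule hermitian_form_ip)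
  show ?thesis unfolding is_weak_deriv_iff
  proof (intro allI impI)
    fix \<psi> \<psi>' assume t: "test_pair l \<psi> \<psi>'"
    have "(\<lambda>n. ip ?M (f n) (\<lambda>x. of_real (\<psi>' x))) \<longlonglongrightarrow> ip ?M F (\<lambda>x. of_real (\<psi>' x))"
      by (rule h.tendsto_nsq(2))
        (use assms test_pair_sqint[OF t] in \<open>auto simp: L2_interval_iff nsq_ip fun_diff_def\<close>)
    moreover have "(\<lambda>n. ip ?M (g n) (\<lambda>x. of_real (\<psi> x))) \<longlonglongrightarrow> ip ?M G (\<lambda>x. of_real (\<psi> x))"
      by (rule h.tendsto_nsq(2))
        (use assms test_pair_sqint[OF t] in \<open>auto simp: L2_interval_iff nsq_ip fun_diff_def\<close>)
    from tendsto_minus[OF this] have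
      "(\<lambda>n. ip ?M (f n) (\<lambda>x. of_real (\<psi>' x))) \<longlonglongrightarrow> - ip ?M G (\<lambda>x. of_real (\<psi> x))"
      using assms(3) t by (simp add: is_weak_deriv_iff)
    ultimately show "ip ?M F (\<lambda>x. of_real (\<psi>' x)) = - ip ?M G (\<lambda>x. of_real (\<psi> x))"
      by (rule LIMSEQ_unique)
  qed
qed

lemma integral_continuous_eq:
  fixes f :: "real \<Rightarrow> real"
  assumes "continuous_on {0..l} f" "(f has_integral I) {0..l}"
  shows "integral\<^sup>L (lebesgue_on {0..l}) f = I" "integrable (lebesgue_on {0..l}) f"
proof -
  have "sqint (lebesgue_on {0..l}) (\<lambda>x. of_real (f x))"
    using assms(1) by (intro sqint_continuous continuous_on_of_real)
  from sqint_integrable(1)[OF finite_measure_interval this] show *: "integrable (lebesgue_on {0..l}) f"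
    by (simp add: complex_of_real_integrable_eq)
  show "integral\<^sup>L (lebesgue_on {0..l}) f = I"
    using lebesgue_integral_eq_integral[OF *] assms(2) by (simp add: integral_unique)
qed

lemma weak_deriv_C1:
  fixes b b' :: "real \<Rightarrow> real"
  assumes l: "l \<ge> 0" and b: "\<And>x. (b has_real_derivative b' x) (at x)" "continuous_on UNIV b'"
  shows "is_weak_deriv l (\<lambda>x. of_real (b x)) (\<lambda>x. of_real (b' x))"
  unfolding is_weak_deriv_def
proof (intro allI impI, elim conjE exE)
  fix \<psi> \<psi>' :: "real \<Rightarrow> real" and a c
  assume \<psi>: "\<forall>x. (\<psi> has_real_derivative \<psi>' x) (at x)" "continuous_on UNIV \<psi>'"
    and supp: "0 < a" "c < l" "\<forall>x. x \<notin> {a..c} \<longrightarrow> \<psi> x = 0"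
  have cb: "continuous_on A b" "continuous_on A b'" "continuous_on A \<psi>" "continuous_on A \<psi>'" for A
    using b(2) \<psi>(2) DERIV_isCont[OF b(1)] DERIV_isCont[OF \<psi>(1)[rule_format]]
    by (auto intro: continuous_at_imp_continuous_on continuous_on_subset)
  have "((\<lambda>x. b x * \<psi>' x + b' x * \<psi> x) has_integral b l * \<psi> l - b 0 * \<psi> 0) {0..l}"
  proof (rule fundamental_theorem_of_calculus[OF l])
    fix x
    have "((\<lambda>x. b x * \<psi> x) has_real_derivative b x * \<psi>' x + b' x * \<psi> x) (at x)"
      using b(1) \<psi>(1) by (auto intro!: derivative_eq_intros)
    then show "((\<lambda>x. b x * \<psi> x) has_vector_derivative b x * \<psi>' x + b' x * \<psi> x) (at x within {0..l})"
      using has_field_derivative_at_within has_real_derivative_iff_has_vector_derivative by blast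
  qed
  then have sum: "((\<lambda>x. b x * \<psi>' x + b' x * \<psi> x) has_integral 0) {0..l}" using supp by simp
  have "continuous_on {0..l} (\<lambda>x. b x * \<psi>' x)" by (intro continuous_intros cb)
  then obtain I where I: "((\<lambda>x. b x * \<psi>' x) has_integral I) {0..l}"
    using integrable_continuous_interval unfolding integrable_on_def by blast
  have J: "((\<lambda>x. b' x * \<psi> x) has_integral - I) {0..l}"
    using has_integral_diff[OF sum I] by simp
  have "(\<integral>x. b x * \<psi>' x \<partial>lebesgue_on {0..l}) = I" "(\<integral>x. b' x * \<psi> x \<partial>lebesgue_on {0..l}) = - I"
    using integral_continuous_eq(1)[OF _ I] integral_continuous_eq(1)[OF _ J]
    by (auto intro!: continuous_on_mult cb)
  then show "(\<integral>x. complex_of_real (b x) * of_real (\<psi>' x) \<partial>lebesgue_on {0..l})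
     = - (\<integral>x. complex_of_real (b' x) * of_real (\<psi> x) \<partial>lebesgue_on {0..l})"
    unfolding of_real_mult[symmetric] integral_complex_of_real by simp
qed

text \<open>The square of the positive part is the building block of all test functions below: it vanishes on a
half line and is continuously differentiable.\<close>

lemma DERIV_max_sq: "((\<lambda>x. (max 0 x)\<^sup>2) has_real_derivative 2 * max 0 x) (at (x::real))"
proof -
  consider "x < 0" | "x > 0" | "x = 0" by linarith
  then show ?thesis
  proof cases
    case 1
    have "((\<lambda>x. 0) has_real_derivative 2 * max 0 x) (at x)" using 1 by simp
    then show ?thesis
      by (rule has_field_derivative_transform_within_open[of _ _ _ "{..<0}"]) (use 1 in auto)
  next
    case 2
    have "((\<lambda>x. x\<^sup>2) has_real_derivative 2 * max 0 x) (at x)" using 2 by (auto intro!: derivative_eq_intros)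
    then show ?thesis
      by (rule has_field_derivative_transform_within_open[of _ _ _ "{0<..}"]) (use 2 in auto)
  next
    case 3
    have "((\<lambda>h. max 0 h :: real) \<longlongrightarrow> 0) (at 0)"
      using tendsto_max[OF tendsto_const[of 0] tendsto_ident_at[of "0::real" UNIV]] by simp
    then have "((\<lambda>h. ((max 0 (0 + h))\<^sup>2 - (max 0 0)\<^sup>2) / h :: real) \<longlongrightarrow> 0) (at 0)"
      by (rule Lim_transform_eventually) (auto simp: eventually_at_filter max_def power2_eq_square)
    then show ?thesis by (simp add: DERIV_def 3)
  qed
qed

text \<open>A continuously differentiable step from \<open>0\<close> (for \<open>t \<le> 0\<close>) to \<open>1\<close> (for \<open>t \<ge> \<epsilon>\<close>). Writing it as one quotient
avoids gluing derivatives at the ends of \<open>[0, \<epsilon>]\<close>.\<close>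

definition ramp :: "real \<Rightarrow> real \<Rightarrow> real" where
  "ramp \<epsilon> t = (max 0 t)\<^sup>2 / ((max 0 t)\<^sup>2 + (max 0 (\<epsilon> - t))\<^sup>2)"

text \<open>The derivative of \<open>ramp\<close>, as obtained from the quotient rule.\<close>

definition ramp' :: "real \<Rightarrow> real \<Rightarrow> real" where
  "ramp' \<epsilon> t = (2 * max 0 t * (max 0 (\<epsilon> - t))\<^sup>2 + (max 0 t)\<^sup>2 * (2 * max 0 (\<epsilon> - t)))
      / ((max 0 t)\<^sup>2 + (max 0 (\<epsilon> - t))\<^sup>2)\<^sup>2"

context
  fixes \<epsilon> :: real assumes \<epsilon>: "\<epsilon> > 0"
begin

lemma ramp_denom: "(max 0 t)\<^sup>2 + (max 0 (\<epsilon> - t))\<^sup>2 \<noteq> 0"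
  using \<epsilon> by (auto simp: sum_power2_eq_zero_iff max_def split: if_splits)

lemma DERIV_ramp: "(ramp \<epsilon> has_real_derivative ramp' \<epsilon> t) (at t)"
proof -
  have 1: "((\<lambda>t. (max 0 (\<epsilon> - t))\<^sup>2) has_real_derivative 2 * max 0 (\<epsilon> - t) * (-1)) (at t)"
    by (rule DERIV_chain2[OF DERIV_max_sq]) (auto intro!: derivative_eq_intros)
  have 2: "((\<lambda>t. (max 0 t)\<^sup>2 + (max 0 (\<epsilon> - t))\<^sup>2) has_real_derivative 2 * max 0 t + 2 * max 0 (\<epsilon> - t) * (-1)) (at t)"
    by (rule DERIV_add[OF DERIV_max_sq 1])
  show ?thesis unfolding ramp_def
    by (rule DERIV_cong[OF DERIV_divide[OF DERIV_max_sq 2 ramp_denom]])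
      (simp add: ramp'_def power2_eq_square algebra_simps)
qed

lemma continuous_ramp': "continuous_on UNIV (ramp' \<epsilon>)"
  unfolding ramp'_def by (intro continuous_intros) (use ramp_denom in auto)

lemma ramp'_nonneg: "ramp' \<epsilon> t \<ge> 0"
  unfolding ramp'_def by (intro divide_nonneg_nonneg add_nonneg_nonneg mult_nonneg_nonneg) auto

lemma ramp'_support: "t \<notin> {0..\<epsilon>} \<Longrightarrow> ramp' \<epsilon> t = 0"
  by (auto simp: ramp'_def max_def)

lemma ramp_left: "t \<le> 0 \<Longrightarrow> ramp \<epsilon> t = 0"
  by (simp add: ramp_def)

lemma ramp_right: "t \<ge> \<epsilon> \<Longrightarrow> ramp \<epsilon> t = 1"
  using \<epsilon> by (simp add: ramp_def)

lemma ramp_bounds: "0 \<le> ramp \<epsilon> t" "ramp \<epsilon> t \<le> 1"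
  by (auto simp: ramp_def intro!: divide_le_eq_1[THEN iffD2])
    (use ramp_denom[of t] in \<open>auto simp: less_le\<close>)

lemma ramp_integral:
  assumes z: "0 \<le> z" "z + \<epsilon> \<le> l" 
  shows "((\<lambda>t. ramp' \<epsilon> (t - z)) has_integral 1) {0..l}"
proof -
  have "((\<lambda>t. ramp' \<epsilon> (t - z)) has_integral ramp \<epsilon> (l - z) - ramp \<epsilon> (0 - z)) {0..l}"
  proof (rule fundamental_theorem_of_calculus)
    fix t
    have "((\<lambda>t. ramp \<epsilon> (t - z)) has_real_derivative ramp' \<epsilon> (t - z) * 1) (at t)"
      by (rule DERIV_chain2[OF DERIV_ramp]) (auto intro!: derivative_eq_intros)
    then show "((\<lambda>t. ramp \<epsilon> (t - z)) has_vector_derivative ramp' \<epsilon> (t - z)) (at t within {0..l})"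
      using has_field_derivative_at_within has_real_derivative_iff_has_vector_derivative by fastforce
  qed (use z \<epsilon> in auto)
  then show ?thesis using z by (simp add: ramp_left ramp_right)
qed

end

lemma approximate_identity:
  assumes f: "continuous_on {0..l} f" and z: "0 \<le> z" "z < l"
    and e: "\<And>n. e n > 0" "e \<longlonglongrightarrow> 0" "\<And>n. z + e n \<le> l"
  shows "(\<lambda>n. \<integral>t. f t * complex_of_real (ramp' (e n) (t - z)) \<partial>lebesgue_on {0..l}) \<longlonglongrightarrow> f z"
proof (rule LIMSEQ_I)
  fix r :: real assume r: "r > 0"
  obtain d where d: "d > 0" "\<And>t. t \<in> {0..l} \<Longrightarrow> \<bar>t - z\<bar> < d \<Longrightarrow> cmod (f t - f z) < r / 2"
    using f r z unfolding continuous_on_iff dist_norm real_norm_def by (metis atLeastAtMost_iff half_gt_zero less_imp_le)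
  obtain N where N: "\<And>n. n \<ge> N \<Longrightarrow> e n < d" using order_tendstoD(2)[OF e(2) d(1)] by (auto simp: eventually_sequentially)
  have "norm ((\<integral>t. f t * complex_of_real (ramp' (e n) (t - z)) \<partial>lebesgue_on {0..l}) - f z) < r" if n: "n \<ge> N" for n
  proof -
    let ?M = "lebesgue_on {0..l}" and ?\<rho> = "\<lambda>t. ramp' (e n) (t - z)"
    have c: "continuous_on A ?\<rho>" for A
      by (rule continuous_on_compose2[OF continuous_ramp'[OF e(1)]]) (auto intro: continuous_intros)
    note I = integral_continuous_eq[OF c ramp_integral[OF e(1) z(1) e(3)]]
    have "sqint ?M (\<lambda>t. of_real (?\<rho> t))" by (intro sqint_continuous continuous_on_of_real c)
    from integrable_ip[OF sqint_continuous[OF f] this] have fi: "integrable ?M (\<lambda>t. f t * of_real (?\<rho> t))" by simp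
    have "(\<integral>t. f t * of_real (?\<rho> t) \<partial>?M) - f z = (\<integral>t. f t * of_real (?\<rho> t) \<partial>?M) - (\<integral>t. f z * of_real (?\<rho> t) \<partial>?M)"
      using I by simp
    also have "\<dots> = (\<integral>t. f t * of_real (?\<rho> t) - f z * of_real (?\<rho> t) \<partial>?M)"
      using fi I(2) by (intro Bochner_Integration.integral_diff[symmetric]) auto
    also have "norm \<dots> \<le> (\<integral>t. r / 2 * ?\<rho> t \<partial>?M)"
    proof (rule Bochner_Integration.integral_norm_bound_integral)
      show "integrable ?M (\<lambda>t. f t * of_real (?\<rho> t) - f z * of_real (?\<rho> t))" using fi I(2) by simp
      show "integrable ?M (\<lambda>t. r / 2 * ?\<rho> t)" using I(2) by simp
      fix t assume "t \<in> space ?M"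
      then have t: "t \<in> {0..l}" by simp
      show "norm (f t * of_real (?\<rho> t) - f z * of_real (?\<rho> t)) \<le> r / 2 * ?\<rho> t"
      proof (cases "t - z \<in> {0..e n}")
        case True
        then have le: "cmod (f t - f z) \<le> r / 2" using d(2)[OF t] N[OF n] by (auto intro: less_imp_le)
        then show ?thesis
          using mult_right_mono[OF le ramp'_nonneg[OF e(1), of n "t - z"]] ramp'_nonneg[OF e(1), of n "t - z"]
          by (simp flip: left_diff_distrib add: norm_mult)
      next
        case False
        then show ?thesis using ramp'_support[OF e(1)] by simp
      qed
    qed
    also have "\<dots> = r / 2" using I(1) by simp
    finally show ?thesis using r by simp
  qed
  then show "\<exists>N. \<forall>n\<ge>N. norm ((\<integral>t. f t * complex_of_real (ramp' (e n) (t - z)) \<partial>lebesgue_on {0..l}) - f z) < r"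
    by blast
qed

text \<open>The difference of two ramps is a test function that approximates the indicator function of \<open>{x<..y}\<close>,
while its derivative approximates a difference of point masses at \<open>x\<close> and \<open>y\<close>.\<close>

lemma weak_FTC:
  assumes f: "continuous_on {0..l} f" and g: "g \<in> L2_interval l" and w: "is_weak_deriv l f g"
    and xy: "0 < x" "x < y" "y < l"
  shows "f y - f x = (\<integral>t. indicator {x<..y} t *\<^sub>R g t \<partial>lebesgue_on {0..l})"
proof -
  let ?M = "lebesgue_on {0..l}"
  define e where "e n = min (y - x) (l - y) / (2 * real (Suc n))" for n
  have m: "min (y - x) (l - y) > 0" using xy by simp
  have e: "e n > 0" "e n \<le> (y - x) / 2" "e n \<le> (l - y) / 2" for n
  proof -
    show "e n > 0" using m by (simp add: e_def)
    have "e n \<le> min (y - x) (l - y) / 2" unfolding e_def using m by (intro divide_left_mono) auto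
    then show "e n \<le> (y - x) / 2" "e n \<le> (l - y) / 2" by auto
  qed
  have e0: "e \<longlonglongrightarrow> 0"
    using tendsto_mult_left[OF LIMSEQ_inverse_real_of_nat, of "min (y - x) (l - y) / 2"]
    by (simp add: e_def[abs_def] field_simps)
  define \<psi> where "\<psi> n t = ramp (e n) (t - x) - ramp (e n) (t - y)" for n t
  define \<psi>' where "\<psi>' n t = ramp' (e n) (t - x) - ramp' (e n) (t - y)" for n t
  have test: "test_pair l (\<psi> n) (\<psi>' n)" for n
    unfolding test_pair_def
  proof (intro conjI allI exI impI)
    show "(\<psi> n has_real_derivative \<psi>' n t) (at t)" for t
    proof -
      have "((\<lambda>t. ramp (e n) (t - z)) has_real_derivative ramp' (e n) (t - z) * 1) (at t)" for z
        by (rule DERIV_chain2[OF DERIV_ramp[OF e(1)]]) (auto intro!: derivative_eq_intros)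
      from DERIV_diff[OF this[of x] this[of y]] show ?thesis by (simp add: \<psi>_def[abs_def] \<psi>'_def)
    qed
    have "continuous_on UNIV (\<lambda>t. ramp' (e n) (t - z))" for z
      by (rule continuous_on_compose2[OF continuous_ramp'[OF e(1)]]) (auto intro: continuous_intros)
    then show "continuous_on UNIV (\<psi>' n)" unfolding \<psi>'_def[abs_def] by (intro continuous_on_diff)
    show "0 < x" by fact
    show "y + e n < l" using e(3)[of n] xy by simp
    fix t assume "t \<notin> {x..y + e n}"
    then consider "t < x" | "t > y + e n" by auto
    then show "\<psi> n t = 0"
      using xy e(1,2)[of n] by cases (auto simp: \<psi>_def ramp_left[OF e(1)] ramp_right[OF e(1)])
  qed
  have gi: "integrable ?M g" using sqint_integrable(1)[OF finite_measure_interval] g by (simp add: L2_interval_iff)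
  have fint: "integrable ?M (\<lambda>t. f t * of_real (ramp' (e n) (t - z)))" for n z
  proof -
    have "continuous_on {0..l} (\<lambda>t. ramp' (e n) (t - z))"
      by (rule continuous_on_compose2[OF continuous_ramp'[OF e(1)]]) (auto intro: continuous_intros)
    then have "sqint ?M (\<lambda>t. of_real (ramp' (e n) (t - z)))" by (intro sqint_continuous continuous_on_of_real)
    from integrable_ip[OF sqint_continuous[OF f] this] show ?thesis by simp
  qed
  have "(\<lambda>n. (\<integral>t. f t * of_real (ramp' (e n) (t - x)) \<partial>?M) - (\<integral>t. f t * of_real (ramp' (e n) (t - y)) \<partial>?M))
      \<longlonglongrightarrow> f x - f y"
  proof (intro tendsto_diff approximate_identity f e e0)
    show "x + e n \<le> l" "y + e n \<le> l" for n using e(3)[of n] xy by (auto simp: field_simps)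
  qed (use xy in auto)
  moreover have "(\<integral>t. f t * of_real (ramp' (e n) (t - x)) \<partial>?M) - (\<integral>t. f t * of_real (ramp' (e n) (t - y)) \<partial>?M)
      = - (\<integral>t. g t * of_real (\<psi> n t) \<partial>?M)" for n
  proof -
    have "(\<integral>t. f t * of_real (\<psi>' n t) \<partial>?M) = - (\<integral>t. g t * of_real (\<psi> n t) \<partial>?M)"
      using w test by (simp add: is_weak_deriv_iff ip_def)
    moreover have "(\<integral>t. f t * of_real (\<psi>' n t) \<partial>?M) = (\<integral>t. f t * of_real (ramp' (e n) (t - x)) - f t * of_real (ramp' (e n) (t - y)) \<partial>?M)"
      by (simp add: \<psi>'_def algebra_simps)
    ultimately show ?thesis using Bochner_Integration.integral_diff[OF fint fint] by simp
  qed
  moreover have "(\<lambda>n. \<integral>t. g t * of_real (\<psi> n t) \<partial>?M) \<longlonglongrightarrow> (\<integral>t. g t * of_real (indicator {x<..y} t) \<partial>?M)"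
  proof (rule integral_dominated_convergence[where w = "\<lambda>t. cmod (g t)"])
    have meas: "(\<lambda>t. complex_of_real (\<psi> n t)) \<in> borel_measurable ?M" for n
      using test_pair_sqint(1)[OF test] sqint_measurable by blast
    show "(\<lambda>t. g t * of_real (\<psi> n t)) \<in> borel_measurable ?M" for n
      using meas gi by (intro borel_measurable_times) auto
    have "{x<..y} \<in> sets ?M" using measure_interval(1)[of x y l] xy by simp
    then show "(\<lambda>t. g t * of_real (indicator {x<..y} t)) \<in> borel_measurable ?M" using gi by auto
    show "integrable ?M (\<lambda>t. cmod (g t))" using gi by simp
    show "AE t in ?M. norm (g t * of_real (\<psi> n t)) \<le> cmod (g t)" for n
    proof (rule AE_I2)
      fix t
      have "\<bar>\<psi> n t\<bar> \<le> 1" unfolding \<psi>_def using ramp_bounds[OF e(1)] by (smt (verit))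
      then show "norm (g t * of_real (\<psi> n t)) \<le> cmod (g t)" by (simp add: norm_mult mult_left_le)
    qed
    show "AE t in ?M. (\<lambda>n. g t * of_real (\<psi> n t)) \<longlonglongrightarrow> g t * of_real (indicator {x<..y} t)"
    proof (rule AE_I2, intro tendsto_mult tendsto_const tendsto_of_real)
      fix t
      have r: "(\<lambda>n. ramp (e n) (t - z)) \<longlonglongrightarrow> (if t > z then 1 else 0)" for z
      proof (cases "t > z")
        case True
        then have "\<forall>\<^sub>F n in sequentially. e n < t - z" using order_tendstoD(2)[OF e0, of "t - z"] by simp
        then have "\<forall>\<^sub>F n in sequentially. 1 = ramp (e n) (t - z)"
          by eventually_elim (simp add: ramp_right[OF e(1)])
        then show ?thesis using True by (simp add: tendsto_eventually eventually_mono)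
      qed (simp add: ramp_left[OF e(1)])
      have "indicator {x<..y} t = (if t > x then 1 else 0) - (if t > y then 1 else 0 :: real)"
        using xy by (auto simp: indicator_def)
      then show "(\<lambda>n. \<psi> n t) \<longlonglongrightarrow> indicator {x<..y} t"
        unfolding \<psi>_def using tendsto_diff[OF r[of x] r[of y]] by simp
    qed
  qed
  from tendsto_minus[OF this]
  have "(\<lambda>n. - (\<integral>t. g t * of_real (\<psi> n t) \<partial>?M)) \<longlonglongrightarrow> - (\<integral>t. g t * of_real (indicator {x<..y} t) \<partial>?M)" .
  ultimately have "f x - f y = - (\<integral>t. g t * of_real (indicator {x<..y} t) \<partial>?M)"
    by (simp only: LIMSEQ_unique)
  then have "- (f x - f y) = (\<integral>t. g t * of_real (indicator {x<..y} t) \<partial>?M)" by simp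
  then show ?thesis by (simp add: scaleR_conv_of_real mult.commute)
qed

text \<open>The Cauchy-Schwarz inequality applied to the fundamental theorem of calculus; the endpoints of the
interval are reached by continuity.\<close>

lemma weak_Hoelder:
  assumes f: "continuous_on {0..l} f" and g: "g \<in> L2_interval l" and w: "is_weak_deriv l f g"
    and xy: "x \<in> {0..l}" "y \<in> {0..l}"
  shows "(cmod (f y - f x))\<^sup>2 \<le> \<bar>y - x\<bar> * (\<integral>t. (cmod (g t))\<^sup>2 \<partial>lebesgue_on {0..l})"
proof -
  let ?I = "\<integral>t. (cmod (g t))\<^sup>2 \<partial>lebesgue_on {0..l}"
  have inner: "(cmod (f y - f x))\<^sup>2 \<le> (y - x) * ?I" if "0 < x" "x < y" "y < l" for x y
    using weak_FTC[OF f g w that] that g measure_interval(1,2)[of x y l]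
      sqint_integrable(2)[OF finite_measure_interval, of l g "{x<..y}"] by (simp add: L2_interval_iff)
  have *: "(cmod (f y - f x))\<^sup>2 \<le> (y - x) * ?I" if xy: "0 \<le> x" "x < y" "y \<le> l" for x y
  proof -
    \<comment> \<open>The offset \<open>3\<close> keeps \<open>x + h n\<close> to the left of \<open>y - h n\<close> for all \<open>n\<close>.\<close>
    define h where "h n = (y - x) / (real n + 3)" for n :: nat
    have h: "h n > 0" "h n \<le> (y - x) / 3" for n using xy unfolding h_def by (simp, intro divide_left_mono) auto
    have h0: "h \<longlonglongrightarrow> 0" unfolding h_def by real_asymp
    have X: "(\<lambda>n. x + h n) \<longlonglongrightarrow> x" and Y: "(\<lambda>n. y - h n) \<longlonglongrightarrow> y"
      using tendsto_add[OF tendsto_const[of x] h0] tendsto_diff[OF tendsto_const[of y] h0] by simp_all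
    have mem: "x + h n \<in> {0..l}" "y - h n \<in> {0..l}" for n using h(1)[of n] h(2)[of n] xy by (auto simp: field_simps)
    have "(\<lambda>n. (cmod (f (y - h n) - f (x + h n)))\<^sup>2) \<longlonglongrightarrow> (cmod (f y - f x))\<^sup>2"
      using continuous_on_tendsto_compose[OF f X] continuous_on_tendsto_compose[OF f Y] xy mem
      by (intro tendsto_intros) auto
    moreover have "(\<lambda>n. ((y - h n) - (x + h n)) * ?I) \<longlonglongrightarrow> (y - x) * ?I"
      by (intro tendsto_intros X Y)
    moreover have "(cmod (f (y - h n) - f (x + h n)))\<^sup>2 \<le> ((y - h n) - (x + h n)) * ?I" for n
      using h[of n] xy by (intro inner) (auto simp: field_simps)
    ultimately show ?thesis by (meson LIMSEQ_le)
  qed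
  consider "x < y" | "x = y" | "y < x" by linarith
  then show ?thesis
    using *[of x y] *[of y x] xy by cases (auto simp: norm_minus_commute)
qed

text \<open>The half-open intervals generate the Borel sets and are stable under intersection, so the integrals
over all measurable sets vanish.\<close>

lemma AE_zero_if_interval_integrals_zero:
  fixes h :: "real \<Rightarrow> complex"
  assumes h: "integrable (lebesgue_on {0..l}) h"
    and 0: "\<And>x y. 0 < x \<Longrightarrow> x < y \<Longrightarrow> y < l \<Longrightarrow> (\<integral>t. indicator {x<..y} t *\<^sub>R h t \<partial>lebesgue_on {0..l}) = 0"
  shows "AE t in lebesgue_on {0..l}. h t = 0"
proof -
  let ?M = "lebesgue_on {0..l}"
  define J where "J A = (\<integral>t. indicator A t *\<^sub>R h t \<partial>?M)" for A
  have borel_M: "A \<inter> {0..l} \<in> sets ?M" if "A \<in> sets borel" for A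
    using that by (auto simp: sets_restrict_space_iff)
  have borel_m: "(\<lambda>t. indicator A t :: real) \<in> borel_measurable ?M" if "A \<in> sets borel" for A
  proof -
    have "(\<lambda>t. indicator A t :: real) \<in> borel_measurable borel" using that by simp
    then have "(\<lambda>t. indicator A t :: real) \<in> borel_measurable lebesgue"
      by (intro measurable_completion) simp
    then show ?thesis by (rule measurable_restrict_space1)
  qed
  have int: "integrable ?M (\<lambda>t. indicator A t *\<^sub>R h t)" if "A \<in> sets borel" for A
    by (rule Bochner_Integration.integrable_bound[OF h])
      (use borel_m[OF that] h in \<open>auto simp: indicator_def\<close>)
  \<comment> \<open>Intervals that touch or exceed the boundary are limits of intervals inside.\<close>
  have Ioc: "J {a<..b} = 0" for a b
  proof (cases "l > 0")
    case False
    have "AE t in lebesgue. t \<noteq> (0::real)" by (rule AE_I'[of "{0}"]) auto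
    then have "AE t in ?M. False"
      using False by (auto simp: AE_restrict_space_iff elim!: eventually_mono)
    then have "AE t in ?M. indicat_real {a<..b} t *\<^sub>R h t = 0" by (rule AE_mp) simp
    then have "J {a<..b} = 0" unfolding J_def by (rule integral_eq_zero_AE)
    then show ?thesis by simp
  next
    case l: True
    define d where "d n = l / (real n + 3)" for n :: nat
    have d: "d n > 0" "d \<longlonglongrightarrow> 0" for n
    proof -
      show "d n > 0" using l by (simp add: d_def)
      show "d \<longlonglongrightarrow> 0" unfolding d_def by real_asymp
    qed
    have Jn: "J {max a (d n)<..min b (l - d n)} = 0" for n
    proof (cases "max a (d n) < min b (l - d n)")
      case True
      then show ?thesis unfolding J_def using d(1)[of n] by (intro 0) (auto simp: less_max_iff_disj min_less_iff_disj)
    next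
      case False
      then have "{max a (d n)<..min b (l - d n)} = {}" by (intro greaterThanAtMost_empty) (simp only: not_less)
      then show ?thesis by (simp only: J_def) simp
    qed
    have "(\<lambda>n. J {max a (d n)<..min b (l - d n)}) \<longlonglongrightarrow> J {a<..b}"
      unfolding J_def
    proof (rule integral_dominated_convergence[where w = "\<lambda>t. cmod (h t)"])
      have "AE t in ?M. t \<noteq> 0 \<and> t \<noteq> l"
        by (rule AE_I'[of "{0, l}"]) (use l in \<open>auto simp: null_sets_restrict_space sets_restrict_space_iff\<close>)
      then show "AE t in ?M. (\<lambda>n. indicat_real {max a (d n)<..min b (l - d n)} t *\<^sub>R h t) \<longlonglongrightarrow> indicat_real {a<..b} t *\<^sub>R h t"
      proof (rule AE_mp, intro AE_I2 impI)
        fix t assume "t \<in> space ?M" "t \<noteq> 0 \<and> t \<noteq> l"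
        then have "0 < t" "t < l" by auto
        then have "\<forall>\<^sub>F n in sequentially. d n < t" "\<forall>\<^sub>F n in sequentially. d n < l - t"
          using order_tendstoD(2)[OF d(2)] by auto
        then have "\<forall>\<^sub>F n in sequentially. indicat_real {a<..b} t *\<^sub>R h t = indicat_real {max a (d n)<..min b (l - d n)} t *\<^sub>R h t"
          by eventually_elim (auto simp: indicator_def)
        then show "(\<lambda>n. indicat_real {max a (d n)<..min b (l - d n)} t *\<^sub>R h t) \<longlonglongrightarrow> indicat_real {a<..b} t *\<^sub>R h t"
          by (rule Lim_transform_eventually[OF tendsto_const])
      qed
    next
      show "AE t in ?M. norm (indicat_real {max a (d n)<..min b (l - d n)} t *\<^sub>R h t) \<le> cmod (h t)" for n
        by (intro AE_I2) (simp add: indicator_def)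
    qed (use h in \<open>auto intro!: borel_measurable_integrable[OF int]\<close>)
    then show ?thesis by (simp add: Jn LIMSEQ_const_iff)
  qed
  have UNIV_eq: "J UNIV = 0"
  proof -
    have "AE t in lebesgue. t \<noteq> (0::real)" by (rule AE_I'[of "{0}"]) auto
    then have nz: "AE t in ?M. t \<noteq> 0" by (auto simp: AE_restrict_space_iff elim!: eventually_mono)
    have "J UNIV = J {0<..l}" unfolding J_def
    proof (intro integral_cong_AE borel_measurable_integrable[OF int])
      show "AE t in ?M. indicat_real UNIV t *\<^sub>R h t = indicat_real {0<..l} t *\<^sub>R h t"
        using nz by (rule AE_mp, intro AE_I2 impI) (auto simp: indicator_def)
    qed auto
    then show ?thesis by (simp add: Ioc)
  qed
  have borel0: "J A = 0" if "A \<in> sets borel" for A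
  proof -
    have eq: "sets borel = sigma_sets UNIV (range (\<lambda>(a, b). {a<..b::real}))"
      by (subst borel_sigma_sets_Ioc) (simp add: sets_measure_of)
    have "Int_stable (range (\<lambda>(a, b). {a<..b::real}))" by (auto simp: Int_stable_def)
    moreover have "range (\<lambda>(a, b). {a<..b::real}) \<subseteq> Pow UNIV" by auto
    moreover have "A \<in> sigma_sets UNIV (range (\<lambda>(a, b). {a<..b::real}))" using that eq by simp
    ultimately show ?thesis
    proof (induction rule: sigma_sets_induct_disjoint)
      case (basic A)
      then show ?case using Ioc by auto
    next
      case empty
      then show ?case by (simp add: J_def)
    next
      case (compl A)
      have A1: "A \<in> sets borel" unfolding eq by (rule compl(1))
      note A = A1 borel_comp[OF A1, unfolded Compl_eq_Diff_UNIV]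
      have "J UNIV = (\<integral>t. indicator A t *\<^sub>R h t + indicator (UNIV - A) t *\<^sub>R h t \<partial>?M)"
        unfolding J_def by (intro Bochner_Integration.integral_cong) (auto simp: indicator_def)
      also have "\<dots> = J A + J (UNIV - A)"
        unfolding J_def using int A by (intro Bochner_Integration.integral_add) auto
      finally show ?case using compl UNIV_eq by simp
    next
      case (union A)
      have A: "A i \<in> sets borel" for i unfolding eq using union(2) by blast
      have "(\<lambda>i. J (A i)) sums J (\<Union>i. A i)"
      proof -
        have "(\<lambda>n. J (\<Union>i<n. A i)) \<longlonglongrightarrow> J (\<Union>i. A i)"
          unfolding J_def
        proof (rule integral_dominated_convergence[where w = "\<lambda>t. cmod (h t)"])
          show "AE t in ?M. (\<lambda>n. indicat_real (\<Union>i<n. A i) t *\<^sub>R h t) \<longlonglongrightarrow> indicat_real (\<Union>i. A i) t *\<^sub>R h t"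
            by (intro AE_I2 tendsto_scaleR tendsto_const LIMSEQ_indicator_UN)
        next
          show "AE t in ?M. norm (indicat_real (\<Union>i<n. A i) t *\<^sub>R h t) \<le> cmod (h t)" for n
            by (intro AE_I2) (simp add: indicator_def)
        qed (use h A in \<open>auto intro!: borel_measurable_integrable[OF int]\<close>)
        moreover have "J (\<Union>i<n. A i) = (\<Sum>i<n. J (A i))" for n
        proof -
          have ind: "indicat_real (\<Union>i<n. A i) t = (\<Sum>i<n. indicat_real (A i) t)" for t
            using union(1) by (subst indicator_UN_disjoint) (auto simp: disjoint_family_on_def)
          show ?thesis unfolding J_def ind scaleR_sum_left
            by (rule Bochner_Integration.integral_sum) (rule int[OF A])
        qed
        ultimately show ?thesis by (simp add: sums_def)
      qed
      then show ?case using union by (simp add: sums_iff)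
    qed
  qed
  show ?thesis
  proof (rule sigma_finite_measure.density_zero[OF finite_measure.axioms(1)[OF finite_measure_interval] h])
    fix A assume "A \<in> sets ?M"
    then have "A \<in> sets lebesgue" by (simp add: sets_restrict_space_iff)
    then obtain B N where BN: "B \<in> sets borel" "negligible N" "B \<union> N = A" by (rule sets_lebesgue_almost_borel)
    have "AE t in lebesgue. t \<notin> N" using BN(2) by (intro AE_not_in) (simp add: negligible_iff_null_sets)
    then have AE: "AE t in ?M. t \<notin> N" by (auto simp: AE_restrict_space_iff elim!: eventually_mono)
    have "set_lebesgue_integral ?M A h = J B"
      unfolding set_lebesgue_integral_def J_def
    proof (rule integral_cong_AE)
      show "AE t in ?M. indicat_real A t *\<^sub>R h t = indicat_real B t *\<^sub>R h t"
        using AE by (rule AE_mp, intro AE_I2 impI) (use BN(3) in \<open>auto simp: indicator_def\<close>)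
      show "(\<lambda>t. indicat_real A t *\<^sub>R h t) \<in> borel_measurable ?M" using \<open>A \<in> sets ?M\<close> h by auto
    qed (use int[OF BN(1)] in auto)
    then show "set_lebesgue_integral ?M A h = 0" using borel0[OF BN(1)] by simp
  qed
qed

lemma weak_deriv_unique:
  assumes "f \<in> L2_interval l" "g \<in> L2_interval l" "h \<in> L2_interval l"
    and "is_weak_deriv l f g" "is_weak_deriv l f h"
  shows "AE t in lebesgue_on {0..l}. g t = h t"
proof -
  let ?M = "lebesgue_on {0..l}"
  interpret hf: hermitian_form "Collect (sqint ?M)" "ip ?M" by (rule hermitian_form_ip)
  have gh: "sqint ?M (\<lambda>t. g t - h t)"
    using hf.closed_diff[of g h] assms by (simp add: L2_interval_iff fun_diff_def)
  have "is_weak_deriv l (\<lambda>t. 0) (\<lambda>t. g t - h t)"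
    using weak_deriv_add[OF assms(1) _ assms(2) _ assms(4) weak_deriv_scale[OF assms(1,3,5), of "-1"]] assms
      hf.closed_scale[of f "-1"] hf.closed_scale[of h "-1"] by (simp add: L2_interval_iff plus_fun_def)
  from weak_FTC[OF _ _ this] gh
  have "(\<integral>t. indicator {x<..y} t *\<^sub>R (g t - h t) \<partial>?M) = 0" if "0 < x" "x < y" "y < l" for x y
    using that by (simp add: L2_interval_iff)
  from AE_zero_if_interval_integrals_zero[OF _ this] sqint_integrable(1)[OF finite_measure_interval gh]
  show ?thesis by simp
qed

lemma weak_deriv_props:
  assumes "f \<in> H1_interval l"
  shows "f \<in> L2_interval l" "weak_deriv l f \<in> L2_interval l" "is_weak_deriv l f (weak_deriv l f)"
proof -
  show "f \<in> L2_interval l" using assms by (simp add: H1_interval_def)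
  have "\<exists>g. g \<in> L2_interval l \<and> is_weak_deriv l f g" using assms by (auto simp: H1_interval_def)
  from someI_ex[OF this] show "weak_deriv l f \<in> L2_interval l" "is_weak_deriv l f (weak_deriv l f)"
    by (simp_all add: weak_deriv_def)
qed

lemma weak_deriv_AE:
  assumes "f \<in> L2_interval l" "g \<in> L2_interval l" "is_weak_deriv l f g"
  shows "AE t in lebesgue_on {0..l}. weak_deriv l f t = g t"
proof -
  have "f \<in> H1_interval l" using assms by (auto simp: H1_interval_def)
  from weak_deriv_props[OF this] assms show ?thesis by (intro weak_deriv_unique) auto
qed

lemma H1_interval_add: assumes "f \<in> H1_interval l" "g \<in> H1_interval l"
  shows "f + g \<in> H1_interval l" "AE t in lebesgue_on {0..l}. weak_deriv l (f + g) t = weak_deriv l f t + weak_deriv l g t"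
proof -
  interpret hf: hermitian_form "Collect (sqint (lebesgue_on {0..l}))" "ip (lebesgue_on {0..l})" by (rule hermitian_form_ip)
  note f = weak_deriv_props[OF assms(1)] and g = weak_deriv_props[OF assms(2)]
  have w: "is_weak_deriv l (f + g) (weak_deriv l f + weak_deriv l g)" using f g by (intro weak_deriv_add)
  have m: "f + g \<in> L2_interval l" "weak_deriv l f + weak_deriv l g \<in> L2_interval l"
    using f g hf.closed_add by (auto simp: L2_interval_iff)
  show "f + g \<in> H1_interval l" using w m by (auto simp: H1_interval_def)
  show "AE t in lebesgue_on {0..l}. weak_deriv l (f + g) t = weak_deriv l f t + weak_deriv l g t"
    using weak_deriv_AE[OF m w] by simp
qed

lemma H1_interval_scale: assumes "f \<in> H1_interval l"
  shows "(\<lambda>x. c * f x) \<in> H1_interval l" "AE t in lebesgue_on {0..l}. weak_deriv l (\<lambda>x. c * f x) t = c * weak_deriv l f t"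
proof -
  interpret hf: hermitian_form "Collect (sqint (lebesgue_on {0..l}))" "ip (lebesgue_on {0..l})" by (rule hermitian_form_ip)
  note f = weak_deriv_props[OF assms]
  have w: "is_weak_deriv l (\<lambda>x. c * f x) (\<lambda>x. c * weak_deriv l f x)" using f by (intro weak_deriv_scale)
  have m: "(\<lambda>x. c * f x) \<in> L2_interval l" "(\<lambda>x. c * weak_deriv l f x) \<in> L2_interval l"
    using f hf.closed_scale by (auto simp: L2_interval_iff)
  show "(\<lambda>x. c * f x) \<in> H1_interval l" using w m by (auto simp: H1_interval_def)
  show "AE t in lebesgue_on {0..l}. weak_deriv l (\<lambda>x. c * f x) t = c * weak_deriv l f t"
    using weak_deriv_AE[OF m w] .
qed

section \<open>Function spaces on a metric graph\<close>

definition edge_sq :: "('v, 'e) metric_graph \<Rightarrow> ('e \<times> real \<Rightarrow> complex) \<Rightarrow> 'e \<Rightarrow> real" where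
  "edge_sq G f e = (\<integral>x. (cmod (restr f e x))\<^sup>2 \<partial>lebesgue_on {0..elen G e})"

lemma edge_sq_nonneg: "0 \<le> edge_sq G f e"
  by (simp add: edge_sq_def)

lemma restr_add: "restr (f + g) e = restr f e + restr g e"
  by (simp add: restr_def fun_eq_iff)

lemma restr_diff: "restr (f - g) e = restr f e - restr g e"
  by (simp add: restr_def fun_eq_iff)

lemma restr_scale: "restr (\<lambda>p. c * f p) e = (\<lambda>x. c * restr f e x)"
  by (simp add: restr_def)

lemma L2_iff: "f \<in> L2 G \<longleftrightarrow> (\<forall>e\<in>edges G. restr f e \<in> L2_interval (elen G e)) \<and> edge_sq G f summable_on edges G"
  by (simp add: L2_def edge_sq_def[abs_def])

lemma L2_sqint: "f \<in> L2 G \<Longrightarrow> e \<in> edges G \<Longrightarrow> sqint (lebesgue_on {0..elen G e}) (restr f e)"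
  by (simp add: L2_iff L2_interval_iff)

lemma edge_sq_add_le:
  assumes "restr f e \<in> L2_interval (elen G e)" "restr g e \<in> L2_interval (elen G e)"
  shows "edge_sq G (f + g) e \<le> 2 * edge_sq G f e + 2 * edge_sq G g e"
proof -
  interpret h: hermitian_form "Collect (sqint (lebesgue_on {0..elen G e}))" "ip (lebesgue_on {0..elen G e})"
    by (rule hermitian_form_ip)
  show ?thesis
    using h.nsq_add_le[of "restr f e" "restr g e"] assms
    by (simp add: nsq_ip edge_sq_def restr_add L2_interval_iff)
qed

lemma edge_sq_scale: "edge_sq G (\<lambda>p. c * f p) e = (cmod c)\<^sup>2 * edge_sq G f e"
  by (simp add: edge_sq_def restr_scale norm_mult power_mult_distrib)

lemma L2_add: assumes "f \<in> L2 G" "g \<in> L2 G" shows "f + g \<in> L2 G"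
  unfolding L2_iff
proof
  show "\<forall>e\<in>edges G. restr (f + g) e \<in> L2_interval (elen G e)"
    using assms by (auto simp: restr_add L2_interval_iff L2_iff intro: sqint_add)
  have "(\<lambda>e. 2 * edge_sq G f e + 2 * edge_sq G g e) summable_on edges G"
    using assms by (intro summable_on_add summable_on_cmult_right) (auto simp: L2_iff)
  then show "edge_sq G (f + g) summable_on edges G"
    by (rule summable_on_comparison_test) (use assms in \<open>auto simp: L2_iff edge_sq_nonneg intro!: edge_sq_add_le\<close>)
qed

lemma L2_scale: assumes "f \<in> L2 G" shows "(\<lambda>p. c * f p) \<in> L2 G"
  using assms unfolding L2_iff
  by (auto simp: restr_scale L2_interval_iff edge_sq_scale[abs_def] intro: sqint_scale summable_on_cmult_right)

lemma L2_inner_eq: "L2_inner G f h = (\<Sum>\<^sub>\<infinity>e\<in>edges G. ip (lebesgue_on {0..elen G e}) (restr f e) (restr h e))"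
  by (simp add: L2_inner_def ip_def)

lemma ip_summable:
  assumes "f \<in> L2 G" "g \<in> L2 G"
  shows "(\<lambda>e. ip (lebesgue_on {0..elen G e}) (restr f e) (restr g e)) summable_on edges G"
proof (rule abs_summable_summable, rule summable_on_comparison_test)
  show "(\<lambda>e. edge_sq G f e + edge_sq G g e) summable_on edges G"
    using assms by (intro summable_on_add) (auto simp: L2_iff)
  fix e assume e: "e \<in> edges G"
  let ?M = "lebesgue_on {0..elen G e}"
  interpret h: hermitian_form "Collect (sqint ?M)" "ip ?M" by (rule hermitian_form_ip)
  have a: "0 \<le> edge_sq G f e" "0 \<le> edge_sq G g e" by (rule edge_sq_nonneg)+
  have "(norm (ip ?M (restr f e) (restr g e)))\<^sup>2 \<le> edge_sq G f e * edge_sq G g e"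
    using h.Cauchy_Schwarz[of "restr f e" "restr g e"] L2_sqint[OF _ e] assms by (simp add: nsq_ip edge_sq_def)
  also have "\<dots> \<le> (edge_sq G f e + edge_sq G g e)\<^sup>2"
    using a by (simp add: power2_sum)
  finally show "norm (ip ?M (restr f e) (restr g e)) \<le> edge_sq G f e + edge_sq G g e"
    by (rule power2_le_imp_le) (use a in simp)
qed simp

lemma infsum_of_real_complex: "(\<Sum>\<^sub>\<infinity>x\<in>A. complex_of_real (g x)) = of_real (\<Sum>\<^sub>\<infinity>x\<in>A. g x)"
proof (cases "g summable_on A")
  case True
  then show ?thesis by (intro infsumI has_sum_of_real has_sum_infsum)
next
  case False
  then have "\<not> (\<lambda>x. complex_of_real (g x)) summable_on A" using summable_on_Re by fastforce
  then show ?thesis using False by (simp add: infsum_not_exists)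
qed

lemma L2_inner_self: "L2_inner G f f = of_real (\<Sum>\<^sub>\<infinity>e\<in>edges G. edge_sq G f e)"
  unfolding L2_inner_eq ip_self edge_sq_def[symmetric] by (rule infsum_of_real_complex)

lemma hermitian_form_L2:
  fixes G :: "('v, 'e) metric_graph"
  shows "hermitian_form (L2 G) (L2_inner G)"
proof
  show "cfun.subspace (L2 G)"
    by (intro cfun.subspaceI L2_add L2_scale)
      (auto simp: L2_iff L2_interval_iff sqint_def restr_def zero_fun_def edge_sq_def[abs_def])
  fix f g h :: "'e \<times> real \<Rightarrow> complex" and c
  assume f: "f \<in> L2 G" and h: "h \<in> L2 G"
  show "L2_inner G (\<lambda>p. c * f p) h = c * L2_inner G f h"
    unfolding L2_inner_eq restr_scale infsum_cmult_right'[symmetric]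
    by (intro infsum_cong hermitian_form.scale_left[OF hermitian_form_ip]) (use L2_sqint f h in auto)
  show "L2_inner G h f = cnj (L2_inner G f h)"
    unfolding L2_inner_eq infsum_cnj[symmetric]
    by (intro infsum_cong hermitian_form.sym[OF hermitian_form_ip]) (use L2_sqint f h in auto)
  show "0 \<le> Re (L2_inner G f f)"
    unfolding L2_inner_self by (simp add: infsum_nonneg edge_sq_nonneg)
  assume g: "g \<in> L2 G"
  show "L2_inner G (f + g) h = L2_inner G f h + L2_inner G g h"
    unfolding L2_inner_eq restr_add
    by (subst infsum_add[symmetric], intro ip_summable f h, intro ip_summable g h,
        intro infsum_cong hermitian_form.add_left[OF hermitian_form_ip]) (use L2_sqint f g h in auto)
qed

lemma nsq_L2: "hermitian_form.nsq (L2_inner G) f = (\<Sum>\<^sub>\<infinity>e\<in>edges G. edge_sq G f e)"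
  unfolding hermitian_form.nsq_def[OF hermitian_form_L2] L2_inner_self by simp

lemma L2_inner_cong:
  assumes "f \<in> L2 G" "f' \<in> L2 G" "h \<in> L2 G"
    and "\<And>e. e \<in> edges G \<Longrightarrow> AE x in lebesgue_on {0..elen G e}. restr f e x = restr f' e x"
  shows "L2_inner G f h = L2_inner G f' h"
  unfolding L2_inner_eq ip_def
proof (intro infsum_cong integral_cong_AE)
  fix e assume e: "e \<in> edges G"
  then have [measurable]: "restr f e \<in> borel_measurable (lebesgue_on {0..elen G e})"
    "restr f' e \<in> borel_measurable (lebesgue_on {0..elen G e})"
    "restr h e \<in> borel_measurable (lebesgue_on {0..elen G e})"
    using assms(1-3) by (auto simp: L2_iff L2_interval_def)
  show "(\<lambda>x. restr f e x * cnj (restr h e x)) \<in> borel_measurable (lebesgue_on {0..elen G e})"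
    "(\<lambda>x. restr f' e x * cnj (restr h e x)) \<in> borel_measurable (lebesgue_on {0..elen G e})"
    by measurable
  show "AE x in lebesgue_on {0..elen G e}. restr f e x * cnj (restr h e x) = restr f' e x * cnj (restr h e x)"
    using assms(4)[OF e] by eventually_elim simp
qed

lemma edge_sq_cong:
  assumes "restr f e \<in> L2_interval (elen G e)" "restr f' e \<in> L2_interval (elen G e)"
    and "AE x in lebesgue_on {0..elen G e}. restr f e x = restr f' e x"
  shows "edge_sq G f e = edge_sq G f' e"
  unfolding edge_sq_def
proof (intro integral_cong_AE)
  have [measurable]: "restr f e \<in> borel_measurable (lebesgue_on {0..elen G e})"
    "restr f' e \<in> borel_measurable (lebesgue_on {0..elen G e})"
    using assms(1,2) by (auto simp: L2_interval_def)
  show "(\<lambda>x. (cmod (restr f e x))\<^sup>2) \<in> borel_measurable (lebesgue_on {0..elen G e})"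
    "(\<lambda>x. (cmod (restr f' e x))\<^sup>2) \<in> borel_measurable (lebesgue_on {0..elen G e})" by measurable
  show "AE x in lebesgue_on {0..elen G e}. (cmod (restr f e x))\<^sup>2 = (cmod (restr f' e x))\<^sup>2"
    using assms(3) by eventually_elim simp
qed

lemma edge_sq_le_nsq:
  assumes "f \<in> L2 G" "finite S" "S \<subseteq> edges G"
  shows "(\<Sum>e\<in>S. edge_sq G f e) \<le> hermitian_form.nsq (L2_inner G) f"
  unfolding nsq_L2 using assms edge_sq_nonneg by (intro finite_sum_le_infsum) (auto simp: L2_iff)

lemma edge_sq_le_nsq1: "f \<in> L2 G \<Longrightarrow> e \<in> edges G \<Longrightarrow> edge_sq G f e \<le> hermitian_form.nsq (L2_inner G) f"
  using edge_sq_le_nsq[of f G "{e}"] by simp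

text \<open>On finitely many edges the distance to the limit is controlled by the Cauchy property, with a bound
that does not depend on the choice of these edges.\<close>

lemma L2_edgewise_limit:
  assumes f: "\<And>k. f k \<in> L2 G" and F: "\<And>e. e \<in> edges G \<Longrightarrow> restr F e \<in> L2_interval (elen G e)"
    and Cauchy: "\<And>\<epsilon>. \<epsilon> > 0 \<Longrightarrow> \<exists>N. \<forall>m\<ge>N. \<forall>n\<ge>N. hermitian_form.nsq (L2_inner G) (f m - f n) < \<epsilon>"
    and lim: "\<And>e. e \<in> edges G \<Longrightarrow> (\<lambda>k. edge_sq G (f k - F) e) \<longlonglongrightarrow> 0"
  shows "F \<in> L2 G" "(\<lambda>k. hermitian_form.nsq (L2_inner G) (f k - F)) \<longlonglongrightarrow> 0"
proof -
  interpret L: hermitian_form "L2 G" "L2_inner G" by (rule hermitian_form_L2)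
  have bound: "(\<Sum>e\<in>S. edge_sq G (f n - F) e) \<le> \<epsilon>"
    if N: "\<forall>m\<ge>N. \<forall>n\<ge>N. L.nsq (f m - f n) < \<epsilon>" and n: "n \<ge> N" and S: "finite S" "S \<subseteq> edges G" for N n \<epsilon> S
  proof (rule LIMSEQ_le_const2)
    show "(\<lambda>m. \<Sum>e\<in>S. edge_sq G (f n - f m) e) \<longlonglongrightarrow> (\<Sum>e\<in>S. edge_sq G (f n - F) e)"
    proof (intro tendsto_sum)
      fix e assume "e \<in> S"
      then have e: "e \<in> edges G" using S by auto
      let ?M = "lebesgue_on {0..elen G e}"
      interpret h: hermitian_form "Collect (sqint ?M)" "ip ?M" by (rule hermitian_form_ip)
      have s: "sqint ?M (restr (f m) e)" "sqint ?M (restr F e)" for m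
        using L2_sqint[OF f e] F[OF e] by (auto simp: L2_interval_iff)
      have eq: "h.nsq ((restr (f n) e - restr (f m) e) - (restr (f n) e - restr F e)) = edge_sq G (f m - F) e" for m
        by (simp add: nsq_ip edge_sq_def restr_diff norm_minus_commute)
      have "(\<lambda>m. h.nsq (restr (f n) e - restr (f m) e)) \<longlonglongrightarrow> h.nsq (restr (f n) e - restr F e)"
      proof (rule h.tendsto_nsq(1))
        show "(\<lambda>m. h.nsq ((restr (f n) e - restr (f m) e) - (restr (f n) e - restr F e))) \<longlonglongrightarrow> 0"
          unfolding eq by (rule lim[OF e])
      qed (use s h.closed_diff in auto)
      then show "(\<lambda>m. edge_sq G (f n - f m) e) \<longlonglongrightarrow> edge_sq G (f n - F) e"
        by (simp add: nsq_ip edge_sq_def restr_diff)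
    qed
    have "(\<Sum>e\<in>S. edge_sq G (f n - f m) e) \<le> \<epsilon>" if "m \<ge> N" for m
      using edge_sq_le_nsq[OF L.closed_diff[OF f f] S, of n m] N n that by force
    then show "\<exists>N. \<forall>m\<ge>N. (\<Sum>e\<in>S. edge_sq G (f n - f m) e) \<le> \<epsilon>" by blast
  qed
  have sq: "restr (f n - F) e \<in> L2_interval (elen G e)" if "e \<in> edges G" for n e
    using hermitian_form.closed_diff[OF hermitian_form_ip, of "restr (f n) e" _ "restr F e"] L2_sqint[OF f that] F[OF that]
    by (simp add: restr_diff L2_interval_iff)
  have *: "f n - F \<in> L2 G \<and> L.nsq (f n - F) \<le> \<epsilon>"
    if N: "\<forall>m\<ge>N. \<forall>n\<ge>N. L.nsq (f m - f n) < \<epsilon>" "n \<ge> N" for N n \<epsilon>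
  proof -
    have s: "edge_sq G (f n - F) summable_on edges G"
      using bound[OF N] edge_sq_nonneg by (intro nonneg_bdd_above_summable_on bdd_aboveI2[of _ _ \<epsilon>]) auto
    show ?thesis using s sq bound[OF N] by (auto simp: L2_iff nsq_L2 intro: infsum_le_finite_sums)
  qed
  obtain N1 where N1: "\<forall>m\<ge>N1. \<forall>n\<ge>N1. L.nsq (f m - f n) < 1" using Cauchy[of 1] by auto
  have "f N1 - F \<in> L2 G" using *[OF N1, of N1] by simp
  from L.closed_diff[OF f this] have "f N1 - (f N1 - F) \<in> L2 G" .
  then show F_L2: "F \<in> L2 G" by simp
  show "(\<lambda>k. L.nsq (f k - F)) \<longlonglongrightarrow> 0"
  proof (rule LIMSEQ_I)
    fix r :: real assume r: "r > 0"
    then obtain N where N: "\<forall>m\<ge>N. \<forall>n\<ge>N. L.nsq (f m - f n) < r / 2" using Cauchy[of "r/2"] by auto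
    have "norm (L.nsq (f n - F) - 0) < r" if "n \<ge> N" for n
      using *[OF N that] L.nsq_nonneg[OF L.closed_diff[OF f F_L2], of n] r by simp
    then show "\<exists>N. \<forall>n\<ge>N. norm (L.nsq (f n - F) - 0) < r" by blast
  qed
qed

lemma path_dist_le: "walk G p q L \<Longrightarrow> path_dist G p q \<le> ereal L"
  unfolding path_dist_def by (intro INF_lower) simp

lemma graph_continuous_restr:
  assumes "graph_continuous G \<phi>" "e \<in> edges G"
  shows "continuous_on {0..elen G e} (restr \<phi> e)"
  unfolding continuous_on_iff
proof (intro ballI allI impI)
  fix x \<epsilon> :: real assume x: "x \<in> {0..elen G e}" and \<epsilon>: "\<epsilon> > 0"
  have p: "(e, x) \<in> points G" using x assms(2) by (simp add: points_def)
  then obtain \<delta> where \<delta>: "\<delta> > 0" "\<And>q. q \<in> points G \<Longrightarrow> path_dist G (e, x) q < ereal \<delta> \<Longrightarrow> cmod (\<phi> q - \<phi> (e, x)) < \<epsilon>"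
    using assms(1) \<epsilon> unfolding graph_continuous_def by metis
  have "dist (restr \<phi> e y) (restr \<phi> e x) < \<epsilon>" if y: "y \<in> {0..elen G e}" "dist y x < \<delta>" for y
  proof -
    have "walk G (e, x) (e, y) (0 + \<bar>x - y\<bar>)" by (rule walk.edge[OF walk.refl[OF p] y(1)])
    from path_dist_le[OF this] have "path_dist G (e, x) (e, y) \<le> ereal \<bar>x - y\<bar>" by simp
    also have "\<dots> < ereal \<delta>" using y(2) by (simp add: dist_real_def abs_minus_commute)
    finally show ?thesis using \<delta>(2)[of "(e, y)"] y(1) assms(2) by (simp add: points_def restr_def dist_norm)
  qed
  then show "\<exists>d>0. \<forall>x'\<in>{0..elen G e}. dist x' x < d \<longrightarrow> dist (restr \<phi> e x') (restr \<phi> e x) < \<epsilon>"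
    using \<delta>(1) by blast
qed

lemma graph_continuous_vertex:
  assumes "metric_graph G" "graph_continuous G \<phi>" "at_vertex G p v" "at_vertex G q v"
  shows "\<phi> p = \<phi> q"
proof (rule ccontr)
  assume ne: "\<phi> p \<noteq> \<phi> q"
  have pts: "p \<in> points G" "q \<in> points G"
    using assms(1,3,4) by (auto simp: points_def metric_graph_def elim!: at_vertex.cases intro: less_imp_le)
  have "walk G p q 0" by (rule walk.vertex[OF walk.refl[OF pts(1)] assms(3,4)])
  from path_dist_le[OF this] have d: "path_dist G p q \<le> 0" by (simp add: zero_ereal_def)
  have "cmod (\<phi> q - \<phi> p) > 0" using ne by simp
  then obtain \<delta> where "\<delta> > 0" "path_dist G p q < ereal \<delta> \<longrightarrow> cmod (\<phi> q - \<phi> p) < cmod (\<phi> q - \<phi> p)"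
    using assms(2) pts unfolding graph_continuous_def by blast
  moreover have "path_dist G p q < ereal \<delta>" using d by (rule le_less_trans) (use \<open>\<delta> > 0\<close> in \<open>simp add: zero_ereal_def\<close>)
  ultimately show False by simp
qed

text \<open>The usual three-epsilon argument; a single good approximant for each \<open>\<epsilon>\<close> is enough.\<close>

lemma graph_continuous_uniform_limit:
  assumes "\<And>n::nat. graph_continuous G (f n)"
    and "\<And>\<epsilon>. \<epsilon> > 0 \<Longrightarrow> \<exists>n. \<forall>p\<in>points G. cmod (f n p - F p) < \<epsilon>"
  shows "graph_continuous G F"
  unfolding graph_continuous_def
proof (intro ballI allI impI)
  fix p and \<epsilon> :: real assume p: "p \<in> points G" and \<epsilon>: "\<epsilon> > 0"
  obtain n where n: "\<forall>p\<in>points G. cmod (f n p - F p) < \<epsilon> / 3" using assms(2)[of "\<epsilon>/3"] \<epsilon> by auto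
  have "\<epsilon> / 3 > 0" using \<epsilon> by simp
  then obtain \<delta> where \<delta>: "\<delta> > 0" "\<forall>q\<in>points G. path_dist G p q < ereal \<delta> \<longrightarrow> cmod (f n q - f n p) < \<epsilon> / 3"
    using assms(1)[of n] p unfolding graph_continuous_def by blast
  have "cmod (F q - F p) < \<epsilon>" if q: "q \<in> points G" "path_dist G p q < ereal \<delta>" for q
  proof -
    have "cmod (F q - F p) \<le> cmod (f n q - F q) + cmod (f n q - f n p) + cmod (f n p - F p)"
      using norm_triangle_ineq4[of "f n q - f n p" "f n q - F q"] norm_triangle_ineq[of "(f n q - f n p) - (f n q - F q)" "f n p - F p"]
      by (simp add: algebra_simps)
    moreover have "cmod (f n q - F q) < \<epsilon> / 3" "cmod (f n p - F p) < \<epsilon> / 3" "cmod (f n q - f n p) < \<epsilon> / 3"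
      using n \<delta>(2) p q by auto
    ultimately show ?thesis by linarith
  qed
  then show "\<exists>\<delta>>0. \<forall>q\<in>points G. path_dist G p q < ereal \<delta> \<longrightarrow> cmod (F q - F p) < \<epsilon>" using \<delta>(1) by blast
qed

text \<open>Along a walk of length \<open>L\<close> the function changes by at most \<open>C L\<close>, since passing through a vertex
costs nothing.\<close>

lemma graph_continuous_Lipschitz:
  assumes G: "metric_graph G"
    and Lip: "\<And>e x y. e \<in> edges G \<Longrightarrow> x \<in> {0..elen G e} \<Longrightarrow> y \<in> {0..elen G e} \<Longrightarrow> cmod (\<phi> (e, x) - \<phi> (e, y)) \<le> C * \<bar>x - y\<bar>"
    and vertex: "\<And>p q v. at_vertex G p v \<Longrightarrow> at_vertex G q v \<Longrightarrow> \<phi> p = \<phi> q"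
  shows "graph_continuous G \<phi>"
proof -
  have walk: "q \<in> points G \<and> cmod (\<phi> q - \<phi> p) \<le> C * L" if "walk G p q L" for p q L
    using that
  proof (induction rule: walk.induct)
    case (refl p)
    then show ?case by simp
  next
    case (edge p e x L y)
    then have e: "e \<in> edges G" "x \<in> {0..elen G e}" by (auto simp: points_def)
    have "cmod (\<phi> (e, y) - \<phi> p) \<le> cmod (\<phi> (e, x) - \<phi> (e, y)) + cmod (\<phi> (e, x) - \<phi> p)"
      using norm_triangle_ineq4[of "\<phi> (e, x) - \<phi> p" "\<phi> (e, x) - \<phi> (e, y)"] by simp
    also have "\<dots> \<le> C * \<bar>x - y\<bar> + C * L" using Lip[OF e edge(2)] edge by simp
    finally show ?case using edge e by (simp add: points_def algebra_simps)
  next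
    case (vertex p q L v r)
    then show ?case using assms(3)[OF vertex(2,3)] G
      by (auto simp: points_def metric_graph_def elim!: at_vertex.cases intro: less_imp_le)
  qed
  show ?thesis unfolding graph_continuous_def
  proof (intro ballI allI impI exI conjI)
    fix p q and \<epsilon> :: real assume \<epsilon>: "\<epsilon> > 0"
    show "\<epsilon> / (\<bar>C\<bar> + 1) > 0" using \<epsilon> by simp
    assume "path_dist G p q < ereal (\<epsilon> / (\<bar>C\<bar> + 1))"
    then obtain L where L: "walk G p q L" "L < \<epsilon> / (\<bar>C\<bar> + 1)"
      unfolding path_dist_def INF_less_iff by auto
    have "0 \<le> L" using L(1) by induction auto
    have "cmod (\<phi> q - \<phi> p) \<le> C * L" using walk[OF L(1)] by simp
    also have "\<dots> \<le> (\<bar>C\<bar> + 1) * L" using \<open>0 \<le> L\<close> by (intro mult_right_mono) auto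
    also have "\<dots> < \<epsilon>" using L(2) by (simp add: field_simps add_pos_nonneg)
    finally show "cmod (\<phi> q - \<phi> p) < \<epsilon>" .
  qed
qed

lemma graph_continuous_add:
  assumes "graph_continuous G f" "graph_continuous G g" shows "graph_continuous G (f + g)"
  unfolding graph_continuous_def
proof (intro ballI allI impI)
  fix p and \<epsilon> :: real assume p: "p \<in> points G" and \<epsilon>: "\<epsilon> > 0"
  have \<epsilon>2: "\<epsilon> / 2 > 0" using \<epsilon> by simp
  obtain a where a: "a > 0" "\<forall>q\<in>points G. path_dist G p q < ereal a \<longrightarrow> cmod (f q - f p) < \<epsilon> / 2"
    using assms(1) p \<epsilon>2 unfolding graph_continuous_def by blast
  obtain b where b: "b > 0" "\<forall>q\<in>points G. path_dist G p q < ereal b \<longrightarrow> cmod (g q - g p) < \<epsilon> / 2"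
    using assms(2) p \<epsilon>2 unfolding graph_continuous_def by blast
  have "cmod ((f + g) q - (f + g) p) < \<epsilon>" if q: "q \<in> points G" "path_dist G p q < ereal (min a b)" for q
  proof -
    have "path_dist G p q < ereal a" "path_dist G p q < ereal b"
      using q(2) by (auto elim!: less_le_trans)
    then have "cmod (f q - f p) < \<epsilon> / 2" "cmod (g q - g p) < \<epsilon> / 2" using a(2) b(2) q(1) by auto
    then show ?thesis using norm_triangle_ineq[of "f q - f p" "g q - g p"] by (simp add: algebra_simps)
  qed
  then show "\<exists>\<delta>>0. \<forall>q\<in>points G. path_dist G p q < ereal \<delta> \<longrightarrow> cmod ((f + g) q - (f + g) p) < \<epsilon>"
    using a(1) b(1) by (intro exI[of _ "min a b"]) auto
qed

lemma graph_continuous_scale: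
  assumes "graph_continuous G f" shows "graph_continuous G (\<lambda>p. c * f p)"
  unfolding graph_continuous_def
proof (intro ballI allI impI)
  fix p and \<epsilon> :: real assume p: "p \<in> points G" and \<epsilon>: "\<epsilon> > 0"
  have "\<epsilon> / (cmod c + 1) > 0" using \<epsilon> by (simp add: add_nonneg_pos)
  then obtain a where a: "a > 0" "\<forall>q\<in>points G. path_dist G p q < ereal a \<longrightarrow> cmod (f q - f p) < \<epsilon> / (cmod c + 1)"
    using assms(1) p unfolding graph_continuous_def by blast
  have "cmod (c * f q - c * f p) < \<epsilon>" if q: "q \<in> points G" "path_dist G p q < ereal a" for q
  proof -
    have "cmod (c * f q - c * f p) \<le> (cmod c + 1) * cmod (f q - f p)"
      by (simp add: norm_mult distrib_right flip: right_diff_distrib)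
    also have "\<dots> < (cmod c + 1) * (\<epsilon> / (cmod c + 1))"
      using a(2) q by (intro mult_strict_left_mono) (auto simp: add_nonneg_pos)
    also have "\<dots> = \<epsilon>" by (simp add: add_nonneg_eq_0_iff)
    finally show ?thesis .
  qed
  then show "\<exists>\<delta>>0. \<forall>q\<in>points G. path_dist G p q < ereal \<delta> \<longrightarrow> cmod (c * f q - c * f p) < \<epsilon>"
    using a(1) by blast
qed

definition graph_deriv :: "('v, 'e) metric_graph \<Rightarrow> ('e \<times> real \<Rightarrow> complex) \<Rightarrow> 'e \<times> real \<Rightarrow> complex" where
  "graph_deriv G \<phi> = (\<lambda>(e, x). weak_deriv (elen G e) (restr \<phi> e) x)"

lemma restr_graph_deriv: "restr (graph_deriv G \<phi>) e = weak_deriv (elen G e) (restr \<phi> e)"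
  by (simp add: graph_deriv_def restr_def)

lemma energy_form_eq: "energy_form G \<phi> \<psi> = L2_inner G (graph_deriv G \<phi>) (graph_deriv G \<psi>)"
  by (simp add: energy_form_def L2_inner_def restr_graph_deriv)

lemma H1_norm_sq_eq: "H1_norm_sq (elen G e) (restr \<phi> e) = edge_sq G \<phi> e + edge_sq G (graph_deriv G \<phi>) e"
  by (simp add: H1_norm_sq_def edge_sq_def restr_graph_deriv)

text \<open>Summability of the squared \<open>H1\<close> norms splits into summability of both of its nonnegative parts.\<close>

lemma H1_iff: "\<phi> \<in> H1 G \<longleftrightarrow> graph_continuous G \<phi> \<and> (\<forall>p. p \<notin> points G \<longrightarrow> \<phi> p = 0) \<and>
   (\<forall>e\<in>edges G. restr \<phi> e \<in> H1_interval (elen G e)) \<and> \<phi> \<in> L2 G \<and> graph_deriv G \<phi> \<in> L2 G"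
proof -
  have "(\<lambda>e. H1_norm_sq (elen G e) (restr \<phi> e)) summable_on edges G \<longleftrightarrow> \<phi> \<in> L2 G \<and> graph_deriv G \<phi> \<in> L2 G"
    if H: "\<forall>e\<in>edges G. restr \<phi> e \<in> H1_interval (elen G e)"
  proof -
    have iff: "\<phi> \<in> L2 G \<longleftrightarrow> edge_sq G \<phi> summable_on edges G"
      "graph_deriv G \<phi> \<in> L2 G \<longleftrightarrow> edge_sq G (graph_deriv G \<phi>) summable_on edges G"
      using H weak_deriv_props by (auto simp: L2_iff restr_graph_deriv)
    show ?thesis unfolding iff H1_norm_sq_eq
    proof (intro iffI conjI)
      assume *: "(\<lambda>e. edge_sq G \<phi> e + edge_sq G (graph_deriv G \<phi>) e) summable_on edges G"
      show "edge_sq G \<phi> summable_on edges G" "edge_sq G (graph_deriv G \<phi>) summable_on edges G"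
        by (rule summable_on_comparison_test[OF *]; simp add: edge_sq_nonneg)+
    qed (auto intro: summable_on_add)
  qed
  then show ?thesis by (auto simp: H1_def)
qed

lemma H1_D:
  assumes "\<phi> \<in> H1 G"
  shows "graph_continuous G \<phi>" "\<phi> \<in> L2 G" "graph_deriv G \<phi> \<in> L2 G"
    "e \<in> edges G \<Longrightarrow> restr \<phi> e \<in> H1_interval (elen G e)" "p \<notin> points G \<Longrightarrow> \<phi> p = 0"
  using assms unfolding H1_iff by blast+

text \<open>Weak derivatives are chosen representatives, so linearity of \<open>graph_deriv\<close> holds only almost
everywhere and membership in \<open>L2\<close> has to be transferred.\<close>

lemma L2_cong_AE:
  assumes "f \<in> L2 G" "\<And>e. e \<in> edges G \<Longrightarrow> restr f' e \<in> L2_interval (elen G e)"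
    "\<And>e. e \<in> edges G \<Longrightarrow> AE x in lebesgue_on {0..elen G e}. restr f' e x = restr f e x"
  shows "f' \<in> L2 G"
proof -
  have "edge_sq G f' e = edge_sq G f e" if "e \<in> edges G" for e
    using assms that by (intro edge_sq_cong) (auto simp: L2_iff)
  then have "edge_sq G f' summable_on edges G \<longleftrightarrow> edge_sq G f summable_on edges G"
    by (intro summable_on_cong) auto
  then show ?thesis using assms by (auto simp: L2_iff)
qed

lemma graph_deriv_add:
  assumes "f \<in> H1 G" "g \<in> H1 G" "e \<in> edges G"
  shows "AE x in lebesgue_on {0..elen G e}. restr (graph_deriv G (f + g)) e x = restr (graph_deriv G f + graph_deriv G g) e x"
  using H1_interval_add(2)[OF H1_D(4) H1_D(4), of f G e g] assms by (simp add: restr_graph_deriv restr_add)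

lemma graph_deriv_scale:
  assumes "f \<in> H1 G" "e \<in> edges G"
  shows "AE x in lebesgue_on {0..elen G e}. restr (graph_deriv G (\<lambda>p. c * f p)) e x = restr (\<lambda>p. c * graph_deriv G f p) e x"
  using H1_interval_scale(2)[OF H1_D(4)[OF assms]] by (simp add: restr_graph_deriv restr_scale)

lemma H1_add: assumes f: "f \<in> H1 G" and g: "g \<in> H1 G" shows "f + g \<in> H1 G"
proof -
  have r: "\<forall>e\<in>edges G. restr (f + g) e \<in> H1_interval (elen G e)"
    using f g by (auto simp: restr_add intro!: H1_interval_add(1) H1_D(4))
  have "graph_deriv G f + graph_deriv G g \<in> L2 G" using f g by (intro L2_add H1_D)
  then have "graph_deriv G (f + g) \<in> L2 G"
    by (rule L2_cong_AE) (use r weak_deriv_props(2) graph_deriv_add[OF f g] in \<open>auto simp: restr_graph_deriv\<close>)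
  then show ?thesis using r f g by (auto simp: H1_iff intro: graph_continuous_add L2_add)
qed

lemma H1_scale: assumes f: "f \<in> H1 G" shows "(\<lambda>p. c * f p) \<in> H1 G"
proof -
  have r: "\<forall>e\<in>edges G. restr (\<lambda>p. c * f p) e \<in> H1_interval (elen G e)"
    using f by (auto simp: restr_scale intro!: H1_interval_scale(1) H1_D(4))
  have "(\<lambda>p. c * graph_deriv G f p) \<in> L2 G" using f by (intro L2_scale H1_D)
  then have "graph_deriv G (\<lambda>p. c * f p) \<in> L2 G"
    by (rule L2_cong_AE) (use r weak_deriv_props(2) graph_deriv_scale[OF f] in \<open>auto simp: restr_graph_deriv\<close>)
  then show ?thesis using r f by (auto simp: H1_iff intro: graph_continuous_scale L2_scale)
qed

lemma H1_zero: "0 \<in> H1 G"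
proof -
  have "(\<lambda>x. 0) \<in> L2_interval l" for l by (simp add: L2_interval_iff sqint_def)
  moreover have "is_weak_deriv l (\<lambda>x. 0) (\<lambda>x. 0)" for l by (simp add: is_weak_deriv_def)
  ultimately have *: "(\<lambda>x. 0) \<in> H1_interval l" "AE t in lebesgue_on {0..l}. weak_deriv l (\<lambda>x. 0) t = 0" for l
    by (auto simp: H1_interval_def weak_deriv_AE)
  have r: "restr 0 e = (\<lambda>x. 0)" for e :: 'c by (simp add: restr_def fun_eq_iff)
  have L0: "0 \<in> L2 G" by (rule cfun.subspace_0[OF hermitian_form.subspace[OF hermitian_form_L2]])
  have "graph_deriv G 0 \<in> L2 G"
    by (rule L2_cong_AE[OF L0]) (use weak_deriv_props(2)[OF *(1)] *(2) in \<open>auto simp: restr_graph_deriv r\<close>)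
  then show ?thesis using L0 * by (auto simp: H1_iff r graph_continuous_def)
qed

lemma subspace_H1: "cfun.subspace (H1 G)"
  by (intro cfun.subspaceI H1_zero H1_add H1_scale)

lemma graph_deriv_restr_L2: "\<phi> \<in> H1 G \<Longrightarrow> e \<in> edges G \<Longrightarrow> restr (graph_deriv G \<phi>) e \<in> L2_interval (elen G e)"
  using H1_D(3) by (auto simp: L2_iff)

lemma hermitian_form_H1: "hermitian_form (H1 G) (L2_inner G)"
proof -
  interpret L: hermitian_form "L2 G" "L2_inner G" by (rule hermitian_form_L2)
  show ?thesis
    by unfold_locales (auto simp: subspace_H1 H1_D(2) L.add_left L.scale_left L.nonneg intro: L.sym)
qed

lemma hermitian_form_energy:
  fixes G :: "('v, 'e) metric_graph"
  shows "hermitian_form (H1 G) (energy_form G)"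
proof
  interpret L: hermitian_form "L2 G" "L2_inner G" by (rule hermitian_form_L2)
  show "cfun.subspace (H1 G)" by (rule subspace_H1)
  fix f g h :: "'e \<times> real \<Rightarrow> complex" and c
  assume f: "f \<in> H1 G" and h: "h \<in> H1 G"
  show "energy_form G h f = cnj (energy_form G f h)"
    unfolding energy_form_eq by (intro L.sym H1_D f h)
  show "0 \<le> Re (energy_form G f f)" unfolding energy_form_eq by (intro L.nonneg H1_D f)
  have "energy_form G (\<lambda>p. c * f p) h = L2_inner G (\<lambda>p. c * graph_deriv G f p) (graph_deriv G h)"
    unfolding energy_form_eq
    by (intro L2_inner_cong graph_deriv_scale L2_scale H1_D(3) H1_scale f h)
  then show "energy_form G (\<lambda>p. c * f p) h = c * energy_form G f h"
    by (simp add: L.scale_left H1_D f h energy_form_eq)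
  assume g: "g \<in> H1 G"
  have "energy_form G (f + g) h = L2_inner G (graph_deriv G f + graph_deriv G g) (graph_deriv G h)"
    unfolding energy_form_eq
    by (intro L2_inner_cong graph_deriv_add L2_add H1_D(3) H1_add f g h)
  then show "energy_form G (f + g) h = energy_form G f h + energy_form G g h"
    by (simp add: L.add_left H1_D f g h energy_form_eq)
qed

abbreviation energy :: "('v, 'e) metric_graph \<Rightarrow> ('e \<times> real \<Rightarrow> complex) \<Rightarrow> real" where
  "energy G \<equiv> hermitian_form.nsq (energy_form G)"

abbreviation mass :: "('v, 'e) metric_graph \<Rightarrow> ('e \<times> real \<Rightarrow> complex) \<Rightarrow> real" where
  "mass G \<equiv> hermitian_form.nsq (L2_inner G)"

lemma energy_eq: "energy G \<phi> = mass G (graph_deriv G \<phi>)"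
  unfolding hermitian_form.nsq_def[OF hermitian_form_energy] hermitian_form.nsq_def[OF hermitian_form_L2]
  by (simp add: energy_form_eq)

lemma graph_deriv_diff:
  assumes "f \<in> H1 G" "g \<in> H1 G" "e \<in> edges G"
  shows "AE x in lebesgue_on {0..elen G e}. restr (graph_deriv G (f - g)) e x = restr (graph_deriv G f - graph_deriv G g) e x"
proof -
  have eq: "f - g = f + (\<lambda>p. -1 * g p)" by (simp add: fun_eq_iff)
  have "AE x in lebesgue_on {0..elen G e}. restr (graph_deriv G (f - g)) e x = restr (graph_deriv G f + graph_deriv G (\<lambda>p. -1 * g p)) e x"
    unfolding eq by (rule graph_deriv_add[OF assms(1) H1_scale[OF assms(2)] assms(3)])
  with graph_deriv_scale[OF assms(2,3), of "-1"] show ?thesis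
    by eventually_elim (simp add: restr_add restr_diff restr_def)
qed

lemma energy_diff_eq:
  assumes "f \<in> H1 G" "g \<in> H1 G"
  shows "energy G (f - g) = mass G (graph_deriv G f - graph_deriv G g)"
  unfolding energy_eq nsq_L2
proof (intro infsum_cong edge_sq_cong graph_deriv_diff assms)
  fix e assume e: "e \<in> edges G"
  show "restr (graph_deriv G (f - g)) e \<in> L2_interval (elen G e)"
    using hermitian_form.closed_diff[OF hermitian_form_H1 assms] e by (rule graph_deriv_restr_L2)
  have "graph_deriv G f - graph_deriv G g \<in> L2 G"
    using assms by (intro hermitian_form.closed_diff[OF hermitian_form_L2] H1_D)
  then show "restr (graph_deriv G f - graph_deriv G g) e \<in> L2_interval (elen G e)" using e by (simp add: L2_iff)
qed

lemma H1_Hoelder: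
  assumes "\<phi> \<in> H1 G" "e \<in> edges G" "x \<in> {0..elen G e}" "y \<in> {0..elen G e}"
  shows "(cmod (\<phi> (e, y) - \<phi> (e, x)))\<^sup>2 \<le> \<bar>y - x\<bar> * edge_sq G (graph_deriv G \<phi>) e"
proof -
  note w = weak_deriv_props[OF H1_D(4)[OF assms(1,2)]]
  from weak_Hoelder[OF graph_continuous_restr[OF H1_D(1)[OF assms(1)] assms(2)] w(2,3) assms(3,4)]
  show ?thesis unfolding edge_sq_def restr_graph_deriv by (simp add: restr_def)
qed

lemma edge_energy_le: "\<phi> \<in> H1 G \<Longrightarrow> e \<in> edges G \<Longrightarrow> edge_sq G (graph_deriv G \<phi>) e \<le> energy G \<phi>"
  unfolding energy_eq by (intro edge_sq_le_nsq1 H1_D)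

lemma H1_from_derivative:
  assumes "graph_continuous G \<phi>" "\<And>p. p \<notin> points G \<Longrightarrow> \<phi> p = 0" "\<phi> \<in> L2 G" "d \<in> L2 G"
    and w: "\<And>e. e \<in> edges G \<Longrightarrow> is_weak_deriv (elen G e) (restr \<phi> e) (restr d e)"
  shows "\<phi> \<in> H1 G" "\<And>e. e \<in> edges G \<Longrightarrow> AE x in lebesgue_on {0..elen G e}. restr (graph_deriv G \<phi>) e x = restr d e x"
proof -
  have r: "restr \<phi> e \<in> H1_interval (elen G e)" if "e \<in> edges G" for e
    unfolding H1_interval_def using assms(3,4) w[OF that] that
    by (auto simp: L2_iff intro!: bexI[of _ "restr d e"])
  show AE: "AE x in lebesgue_on {0..elen G e}. restr (graph_deriv G \<phi>) e x = restr d e x" if "e \<in> edges G" for e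
    unfolding restr_graph_deriv by (rule weak_deriv_AE) (use assms that in \<open>auto simp: L2_iff\<close>)
  have "graph_deriv G \<phi> \<in> L2 G"
    by (rule L2_cong_AE[OF assms(4)]) (use weak_deriv_props(2)[OF r] AE in \<open>auto simp: restr_graph_deriv\<close>)
  then show "\<phi> \<in> H1 G" using assms r by (auto simp: H1_iff)
qed

lemma energy_from_derivative:
  assumes \<phi>: "\<phi> \<in> H1 G" "\<And>e. e \<in> edges G \<Longrightarrow> AE x in lebesgue_on {0..elen G e}. restr (graph_deriv G \<phi>) e x = restr d e x"
    and \<psi>: "\<psi> \<in> H1 G" "\<And>e. e \<in> edges G \<Longrightarrow> AE x in lebesgue_on {0..elen G e}. restr (graph_deriv G \<psi>) e x = restr d' e x"
    and d: "d \<in> L2 G" "d' \<in> L2 G"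
  shows "energy_form G \<phi> \<psi> = L2_inner G d d'"
proof -
  interpret L: hermitian_form "L2 G" "L2_inner G" by (rule hermitian_form_L2)
  note m = H1_D(3)[OF \<phi>(1)] H1_D(3)[OF \<psi>(1)]
  have "energy_form G \<phi> \<psi> = L2_inner G d (graph_deriv G \<psi>)"
    unfolding energy_form_eq by (intro L2_inner_cong m d \<phi>(2))
  also have "\<dots> = cnj (L2_inner G (graph_deriv G \<psi>) d)" by (rule L.sym[OF m(2) d(1)])
  also have "L2_inner G (graph_deriv G \<psi>) d = L2_inner G d' d" by (intro L2_inner_cong m d \<psi>(2))
  also have "cnj (L2_inner G d' d) = L2_inner G d d'" by (rule L.sym[OF d(2,1), symmetric])
  finally show ?thesis .
qed

text \<open>Elements of \<open>H1\<close> are genuine functions and not classes; definiteness rests on continuity on each edge.\<close>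

lemma mass_eq_0_imp:
  assumes G: "metric_graph G" and \<phi>: "\<phi> \<in> H1 G" and 0: "mass G \<phi> = 0"
  shows "\<phi> = 0"
proof
  fix p
  show "\<phi> p = 0 p"
  proof (cases "p \<in> points G")
    case False
    then show ?thesis using H1_D(5)[OF \<phi>] by simp
  next
    case True
    then obtain e x where p: "p = (e, x)" "e \<in> edges G" "x \<in> {0..elen G e}" by (auto simp: points_def)
    have c: "continuous_on {0..elen G e} (restr \<phi> e)" using graph_continuous_restr[OF H1_D(1)[OF \<phi>] p(2)] .
    have c2: "continuous_on {0..elen G e} (\<lambda>x. (cmod (restr \<phi> e x))\<^sup>2)" by (intro continuous_intros c)
    have "edge_sq G \<phi> e = 0"
      using edge_sq_le_nsq1[OF H1_D(2)[OF \<phi>] p(2)] 0 edge_sq_nonneg[of G \<phi> e] by simp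
    moreover have "((\<lambda>x. (cmod (restr \<phi> e x))\<^sup>2) has_integral integral {0..elen G e} (\<lambda>x. (cmod (restr \<phi> e x))\<^sup>2)) {0..elen G e}"
      using c2 by (intro integrable_integral integrable_continuous_interval)
    ultimately have "((\<lambda>x. (cmod (restr \<phi> e x))\<^sup>2) has_integral 0) (cbox 0 (elen G e))"
      using integral_continuous_eq(1)[OF c2] by (simp add: edge_sq_def)
    from has_integral_0_cbox_imp_0[OF _ _ this, of x] show ?thesis
      using c2 p G by (auto simp: restr_def metric_graph_def)
  qed
qed

lemma edge_sq_le_sup:
  assumes "restr f e \<in> L2_interval (elen G e)" "elen G e \<ge> 0"
    and "\<And>x. x \<in> {0..elen G e} \<Longrightarrow> (cmod (f (e, x)))\<^sup>2 \<le> B"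
  shows "edge_sq G f e \<le> elen G e * B"
proof -
  let ?M = "lebesgue_on {0..elen G e}"
  interpret finite_measure ?M by (rule finite_measure_interval)
  have "edge_sq G f e \<le> (\<integral>x. B \<partial>?M)"
    unfolding edge_sq_def
    by (rule integral_mono) (use assms in \<open>auto simp: L2_interval_def restr_def\<close>)
  also have "\<dots> = elen G e * B" using assms(2) by (simp add: measure_restrict_space)
  finally show ?thesis .
qed

section \<open>Completeness and compactness of the energy space\<close>

text \<open>The properties of the comb on which completeness and compactness rest: the energy alone controls the
supremum and the mass, and up to an arbitrarily small multiple of the energy the mass is carried by
finitely many edges.\<close>

locale dominated_graph =
  fixes G :: "('v, 'e) metric_graph" and B C :: real
  assumes G: "metric_graph G"
    and sup_le: "\<phi> \<in> H1 G \<Longrightarrow> p \<in> points G \<Longrightarrow> (cmod (\<phi> p))\<^sup>2 \<le> B * energy G \<phi>"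
    and mass_le: "\<phi> \<in> H1 G \<Longrightarrow> mass G \<phi> \<le> C * energy G \<phi>"
    and B: "B > 0" and C: "C > 0"
    and tail: "\<epsilon> > 0 \<Longrightarrow> \<exists>S. finite S \<and> S \<subseteq> edges G \<and>
      (\<forall>\<phi>\<in>H1 G. mass G \<phi> \<le> (\<Sum>e\<in>S. edge_sq G \<phi> e) + \<epsilon> * energy G \<phi>)"
begin

sublocale L: hermitian_form "H1 G" "L2_inner G" by (rule hermitian_form_H1)
sublocale E: hermitian_form "H1 G" "energy_form G" by (rule hermitian_form_energy)

lemma elen_pos: "e \<in> edges G \<Longrightarrow> elen G e > 0"
  using G by (simp add: metric_graph_def)

text \<open>An energy Cauchy sequence converges uniformly, because the energy dominates the supremum, and its weak
derivatives converge in \<open>L2\<close> on every edge. The uniform limit is continuous on the graph and has the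
limits of the derivatives as weak derivatives.\<close>

lemma energy_complete:
  fixes f :: "nat \<Rightarrow> 'e \<times> real \<Rightarrow> complex"
  assumes f: "\<And>k. f k \<in> H1 G"
    and Cauchy: "\<And>\<epsilon>. \<epsilon> > 0 \<Longrightarrow> \<exists>N. \<forall>m\<ge>N. \<forall>n\<ge>N. energy G (f m - f n) < \<epsilon>"
  shows "\<exists>F\<in>H1 G. (\<lambda>n. energy G (f n - F)) \<longlonglongrightarrow> 0"
proof -
  have diff: "f m - f n \<in> H1 G" for m n by (intro L.closed_diff f)
  have unif: "\<exists>N. \<forall>m\<ge>N. \<forall>n\<ge>N. \<forall>p\<in>points G. cmod (f m p - f n p) < \<epsilon>" if \<epsilon>: "\<epsilon> > 0" for \<epsilon>
  proof -
    have "\<epsilon>\<^sup>2 / B > 0" using \<epsilon> B by simp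
    from Cauchy[OF this] obtain N where N: "\<forall>m\<ge>N. \<forall>n\<ge>N. energy G (f m - f n) < \<epsilon>\<^sup>2 / B" by blast
    have "cmod (f m p - f n p) < \<epsilon>" if "m \<ge> N" "n \<ge> N" "p \<in> points G" for m n p
    proof -
      have "(cmod (f m p - f n p))\<^sup>2 \<le> B * energy G (f m - f n)" using sup_le[OF diff that(3), of m n] by simp
      also have "\<dots> < B * (\<epsilon>\<^sup>2 / B)" using N that B by (intro mult_strict_left_mono) auto
      finally have "(cmod (f m p - f n p))\<^sup>2 < \<epsilon>\<^sup>2" using B by simp
      then show ?thesis by (rule power2_less_imp_less) (use \<epsilon> in simp)
    qed
    then show ?thesis by blast
  qed
  \<comment> \<open>The value \<open>0\<close> off the graph is the convention for elements of \<open>H1\<close>.\<close>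
  define F where "F p = (if p \<in> points G then lim (\<lambda>n. f n p) else 0)" for p
  have lim: "(\<lambda>n. f n p) \<longlonglongrightarrow> F p" if p: "p \<in> points G" for p
  proof -
    have "Cauchy (\<lambda>n. f n p)"
    proof (rule CauchyI)
      fix \<epsilon> :: real assume "\<epsilon> > 0"
      from unif[OF this] show "\<exists>M. \<forall>m\<ge>M. \<forall>n\<ge>M. norm (f m p - f n p) < \<epsilon>" using p by blast
    qed
    then show ?thesis using p by (simp add: F_def Cauchy_convergent_iff convergent_LIMSEQ_iff)
  qed
  have unif_lim: "\<exists>N. \<forall>n\<ge>N. \<forall>p\<in>points G. cmod (f n p - F p) \<le> \<epsilon>" if \<epsilon>: "\<epsilon> > 0" for \<epsilon>
  proof -
    obtain N where N: "\<forall>m\<ge>N. \<forall>n\<ge>N. \<forall>p\<in>points G. cmod (f m p - f n p) < \<epsilon>" using unif[OF \<epsilon>] by blast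
    have "cmod (f n p - F p) \<le> \<epsilon>" if "n \<ge> N" "p \<in> points G" for n p
    proof (rule LIMSEQ_le_const2)
      show "(\<lambda>m. cmod (f n p - f m p)) \<longlonglongrightarrow> cmod (f n p - F p)" by (intro tendsto_intros lim that)
      show "\<exists>N. \<forall>m\<ge>N. cmod (f n p - f m p) \<le> \<epsilon>" using N that by (intro exI[of _ N]) (auto intro: less_imp_le)
    qed
    then show ?thesis by blast
  qed
  have cont: "graph_continuous G F"
  proof (rule graph_continuous_uniform_limit[of G f])
    show "graph_continuous G (f n)" for n by (rule H1_D(1)[OF f])
    fix \<epsilon> :: real assume \<epsilon>: "\<epsilon> > 0"
    then obtain N where "\<forall>n\<ge>N. \<forall>p\<in>points G. cmod (f n p - F p) \<le> \<epsilon> / 2" using unif_lim[of "\<epsilon>/2"] by auto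
    then show "\<exists>n. \<forall>p\<in>points G. cmod (f n p - F p) < \<epsilon>"
      using \<epsilon> by (intro exI[of _ N]) force
  qed
  have F_L2: "restr F e \<in> L2_interval (elen G e)" if "e \<in> edges G" for e
    unfolding L2_interval_iff by (rule sqint_continuous[OF graph_continuous_restr[OF cont that]])
  have f_L2: "restr (f n) e \<in> L2_interval (elen G e)" if "e \<in> edges G" for e n
    using H1_D(2)[OF f] that by (auto simp: L2_iff)
  have edge_lim: "(\<lambda>n. edge_sq G (f n - F) e) \<longlonglongrightarrow> 0" if e: "e \<in> edges G" for e
  proof (rule LIMSEQ_I)
    fix r :: real assume r: "r > 0"
    define d where "d = sqrt (r / (2 * elen G e))"
    have d: "d > 0" "elen G e * d\<^sup>2 = r / 2" using r elen_pos[OF e] by (auto simp: d_def)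
    obtain N where N: "\<forall>n\<ge>N. \<forall>p\<in>points G. cmod (f n p - F p) \<le> d" using unif_lim[OF d(1)] by blast
    have "norm (edge_sq G (f n - F) e - 0) < r" if "n \<ge> N" for n
    proof -
      have "edge_sq G (f n - F) e \<le> elen G e * d\<^sup>2"
      proof (rule edge_sq_le_sup)
        show "restr (f n - F) e \<in> L2_interval (elen G e)"
          using hermitian_form.closed_diff[OF hermitian_form_ip] f_L2[OF e] F_L2[OF e]
          by (auto simp: restr_diff L2_interval_iff)
        fix x assume "x \<in> {0..elen G e}"
        then have "(e, x) \<in> points G" using e by (simp add: points_def)
        then show "(cmod ((f n - F) (e, x)))\<^sup>2 \<le> d\<^sup>2" using N that by (auto intro: power_mono)
      qed (use elen_pos[OF e] in simp)
      then show ?thesis using d r edge_sq_nonneg[of G "f n - F" e] by simp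
    qed
    then show "\<exists>N. \<forall>n\<ge>N. norm (edge_sq G (f n - F) e - 0) < r" by blast
  qed
  define g where "g n e = restr (graph_deriv G (f n)) e" for n e
  have g_L2: "g n e \<in> L2_interval (elen G e)" if "e \<in> edges G" for n e
    unfolding g_def by (rule graph_deriv_restr_L2[OF f that])
  have dCauchy: "\<exists>N. \<forall>m\<ge>N. \<forall>n\<ge>N. mass G (graph_deriv G (f m) - graph_deriv G (f n)) < \<epsilon>" if "\<epsilon> > 0" for \<epsilon>
    using Cauchy[OF that] energy_diff_eq[OF f f] by simp
  have "\<exists>h. h \<in> L2_interval (elen G e) \<and> (\<lambda>n. \<integral>x. (cmod (g n e x - h x))\<^sup>2 \<partial>lebesgue_on {0..elen G e}) \<longlonglongrightarrow> 0"
    if e: "e \<in> edges G" for e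
    unfolding L2_interval_iff
  proof (rule Riesz_Fischer[OF finite_measure_interval])
    show "sqint (lebesgue_on {0..elen G e}) (g k e)" for k using g_L2[OF e] by (simp add: L2_interval_iff)
    fix \<epsilon> :: real assume "\<epsilon> > 0"
    then obtain N where N: "\<forall>m\<ge>N. \<forall>n\<ge>N. mass G (graph_deriv G (f m) - graph_deriv G (f n)) < \<epsilon>"
      using dCauchy by blast
    have "(\<integral>x. (cmod (g m e x - g n e x))\<^sup>2 \<partial>lebesgue_on {0..elen G e}) < \<epsilon>"
      if mn: "m \<ge> N" "n \<ge> N" for m n
    proof -
      have "(\<integral>x. (cmod (g m e x - g n e x))\<^sup>2 \<partial>lebesgue_on {0..elen G e})
        = edge_sq G (graph_deriv G (f m) - graph_deriv G (f n)) e"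
        by (simp add: edge_sq_def g_def restr_diff)
      also have "\<dots> \<le> mass G (graph_deriv G (f m) - graph_deriv G (f n))"
        by (intro edge_sq_le_nsq1 hermitian_form.closed_diff[OF hermitian_form_L2] H1_D(3)[OF f] e)
      also have "\<dots> < \<epsilon>" using N mn by blast
      finally show ?thesis .
    qed
    then show "\<exists>N. \<forall>m\<ge>N. \<forall>n\<ge>N. (\<integral>x. (cmod (g m e x - g n e x))\<^sup>2 \<partial>lebesgue_on {0..elen G e}) < \<epsilon>" by blast
  qed
  then have "\<forall>e\<in>edges G. \<exists>h. h \<in> L2_interval (elen G e) \<and>
      (\<lambda>n. \<integral>x. (cmod (g n e x - h x))\<^sup>2 \<partial>lebesgue_on {0..elen G e}) \<longlonglongrightarrow> 0" by blast
  from bchoice[OF this] obtain h where h: "\<And>e. e \<in> edges G \<Longrightarrow> h e \<in> L2_interval (elen G e)"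
    "\<And>e. e \<in> edges G \<Longrightarrow> (\<lambda>n. \<integral>x. (cmod (g n e x - h e x))\<^sup>2 \<partial>lebesgue_on {0..elen G e}) \<longlonglongrightarrow> 0"
    by blast
  have weak: "is_weak_deriv (elen G e) (restr F e) (h e)" if e: "e \<in> edges G" for e
  proof (rule weak_deriv_limit)
    show "is_weak_deriv (elen G e) (restr (f n) e) (g n e)" for n
      unfolding g_def restr_graph_deriv by (rule weak_deriv_props(3)[OF H1_D(4)[OF f e]])
    show "(\<lambda>n. \<integral>x. (cmod (restr (f n) e x - restr F e x))\<^sup>2 \<partial>lebesgue_on {0..elen G e}) \<longlonglongrightarrow> 0"
      using edge_lim[OF e] by (simp add: edge_sq_def restr_diff)
  qed (use f_L2 g_L2 F_L2 h e in auto)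
  have F_H1: "restr F e \<in> H1_interval (elen G e)" if "e \<in> edges G" for e
    using F_L2[OF that] h(1)[OF that] weak[OF that] by (auto simp: H1_interval_def)
  have dF: "restr (graph_deriv G F) e \<in> L2_interval (elen G e)" if "e \<in> edges G" for e
    unfolding restr_graph_deriv by (rule weak_deriv_props(2)[OF F_H1[OF that]])
  have d_lim: "(\<lambda>n. edge_sq G (graph_deriv G (f n) - graph_deriv G F) e) \<longlonglongrightarrow> 0" if e: "e \<in> edges G" for e
  proof -
    let ?M = "lebesgue_on {0..elen G e}"
    have "edge_sq G (graph_deriv G (f n) - graph_deriv G F) e = (\<integral>x. (cmod (g n e x - h e x))\<^sup>2 \<partial>?M)" for n
      unfolding edge_sq_def
    proof (rule integral_cong_AE)
      have [measurable]: "g n e \<in> borel_measurable ?M" "h e \<in> borel_measurable ?M"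
        "restr (graph_deriv G F) e \<in> borel_measurable ?M"
        using g_L2[OF e] h(1)[OF e] dF[OF e] by (auto simp: L2_interval_def)
      show "(\<lambda>x. (cmod (g n e x - h e x))\<^sup>2) \<in> borel_measurable ?M" by measurable
      have "(\<lambda>x. (cmod (g n e x - restr (graph_deriv G F) e x))\<^sup>2) \<in> borel_measurable ?M" by measurable
      then show "(\<lambda>x. (cmod (restr (graph_deriv G (f n) - graph_deriv G F) e x))\<^sup>2) \<in> borel_measurable ?M"
        by (simp add: restr_diff g_def)
      show "AE x in ?M. (cmod (restr (graph_deriv G (f n) - graph_deriv G F) e x))\<^sup>2 = (cmod (g n e x - h e x))\<^sup>2"
        using weak_deriv_AE[OF F_L2[OF e] h(1)[OF e] weak[OF e]]
        by eventually_elim (simp add: restr_diff g_def restr_graph_deriv)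
    qed
    then show ?thesis using h(2)[OF e] by simp
  qed
  have mass_Cauchy: "\<exists>N. \<forall>m\<ge>N. \<forall>n\<ge>N. mass G (f m - f n) < \<epsilon>" if "\<epsilon> > 0" for \<epsilon>
  proof -
    have "\<epsilon> / C > 0" using that C by simp
    from Cauchy[OF this] obtain N where N: "\<forall>m\<ge>N. \<forall>n\<ge>N. energy G (f m - f n) < \<epsilon> / C" by blast
    have "mass G (f m - f n) < \<epsilon>" if "m \<ge> N" "n \<ge> N" for m n
    proof -
      have "mass G (f m - f n) \<le> C * energy G (f m - f n)" by (rule mass_le[OF diff])
      also have "\<dots> < C * (\<epsilon> / C)" using N that C by (intro mult_strict_left_mono) auto
      finally show ?thesis using C by simp
    qed
    then show ?thesis by blast
  qed
  have "F \<in> L2 G" by (rule L2_edgewise_limit(1)[OF H1_D(2)[OF f] F_L2 mass_Cauchy edge_lim])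
  moreover note d = L2_edgewise_limit[OF H1_D(3)[OF f] dF dCauchy d_lim]
  ultimately have F: "F \<in> H1 G" using cont F_H1 by (auto simp: H1_iff F_def)
  show ?thesis using F d(2) energy_diff_eq[OF f F] by (intro bexI[of _ F]) simp_all
qed

text \<open>Between neighbouring points of a uniform mesh of \<open>k + 1\<close> points the function is controlled by
Hoelder continuity, so finitely many values determine it on the edge up to an error of order \<open>1/k\<close>.\<close>

lemma edge_sq_le_mesh:
  assumes \<phi>: "\<phi> \<in> H1 G" and e: "e \<in> edges G" and k: "k > 0"
  shows "edge_sq G \<phi> e \<le> elen G e * (2 * (\<Sum>i\<le>k. (cmod (\<phi> (e, elen G e * (real i / real k))))\<^sup>2)
     + 2 * (elen G e / real k) * energy G \<phi>)"
proof (rule edge_sq_le_sup)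
  let ?l = "elen G e"
  have l: "?l > 0" by (rule elen_pos[OF e])
  show "restr \<phi> e \<in> L2_interval ?l" using H1_D(2)[OF \<phi>] e by (simp add: L2_iff)
  show "?l \<ge> 0" using l by simp
  fix x assume x: "x \<in> {0..?l}"
  define i where "i = nat \<lfloor>x * real k / ?l\<rfloor>"
  have i: "real i \<le> x * real k / ?l" "x * real k / ?l < real i + 1"
    using x l by (auto simp: i_def)
  let ?y = "?l * (real i / real k)"
  have "?y \<le> x" using i(1) l k by (simp add: field_simps)
  moreover have "x - ?y \<le> ?l / real k"
  proof -
    have "x * real k \<le> ?l * (real i + 1)" using i(2) l by (simp add: field_simps)
    then have "x \<le> ?l * (real i + 1) / real k" using k by (simp add: pos_le_divide_eq)
    then show ?thesis by (simp add: add_divide_distrib distrib_left)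
  qed
  moreover have "real i \<le> real k"
  proof -
    have "x * real k / ?l \<le> real k" using x l mult_right_mono[of x ?l "real k"] by (simp add: pos_divide_le_eq mult.commute)
    then show ?thesis using i(1) by linarith
  qed
  ultimately have y: "?y \<in> {0..?l}" "\<bar>x - ?y\<bar> \<le> ?l / real k" "i \<le> k" using x l by auto
  have "(cmod (\<phi> (e, x)))\<^sup>2 \<le> 2 * (cmod (\<phi> (e, ?y)))\<^sup>2 + 2 * (cmod (\<phi> (e, x) - \<phi> (e, ?y)))\<^sup>2"
    using cmod_add_sq_le[of "\<phi> (e, ?y)" "\<phi> (e, x) - \<phi> (e, ?y)"] by simp
  moreover have "(cmod (\<phi> (e, x) - \<phi> (e, ?y)))\<^sup>2 \<le> (?l / real k) * energy G \<phi>"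
  proof -
    have "(cmod (\<phi> (e, x) - \<phi> (e, ?y)))\<^sup>2 \<le> \<bar>x - ?y\<bar> * edge_sq G (graph_deriv G \<phi>) e"
      by (rule H1_Hoelder[OF \<phi> e y(1) x])
    also have "\<dots> \<le> (?l / real k) * energy G \<phi>"
      by (intro mult_mono y edge_energy_le \<phi> e edge_sq_nonneg) (use l in auto)
    finally show ?thesis .
  qed
  moreover have "(cmod (\<phi> (e, ?y)))\<^sup>2 \<le> (\<Sum>i\<le>k. (cmod (\<phi> (e, ?l * (real i / real k))))\<^sup>2)"
    by (rule member_le_sum) (use y(3) in auto)
  ultimately show "(cmod (\<phi> (e, x)))\<^sup>2 \<le> 2 * (\<Sum>i\<le>k. (cmod (\<phi> (e, ?l * (real i / real k))))\<^sup>2)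
     + 2 * (?l / real k) * energy G \<phi>" by simp
qed

text \<open>A diagonal subsequence converges at a countable dense set of points. It is then Cauchy in \<open>L2\<close> on every
edge by the mesh estimate, and the edges outside a finite set contribute little.\<close>

lemma energy_compact:
  fixes f :: "nat \<Rightarrow> 'e \<times> real \<Rightarrow> complex"
  assumes f: "\<And>k. f k \<in> H1 G" and b: "\<And>k. energy G (f k) \<le> b"
  shows "\<exists>r. strict_mono (r :: nat \<Rightarrow> nat) \<and>
    (\<forall>\<epsilon>>0. \<exists>N. \<forall>m\<ge>N. \<forall>n\<ge>N. mass G (f (r m) - f (r n)) < \<epsilon>)"
proof -
  define D where "D = (\<lambda>(e, q). (e, elen G e * real_of_rat q)) ` (edges G \<times> {0..1})"
  have D: "countable D" unfolding D_def using G by (auto simp: metric_graph_def)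
  have b0: "0 \<le> b" using b[of 0] E.nsq_nonneg[OF f, of 0] by simp
  have D_pts: "p \<in> points G" if "p \<in> D" for p
    using that elen_pos by (fastforce simp: D_def points_def mult_le_cancel_left1 intro: mult_nonneg_nonneg)
  have bound: "norm (f n p) \<le> sqrt (B * b)" if "p \<in> D" for n p
    using sup_le[OF f D_pts[OF that], of n] mult_left_mono[OF b[of n], of B] B
    by (intro real_le_rsqrt) linarith
  obtain r :: "nat \<Rightarrow> nat"
    where r: "strict_mono r" "\<And>p. p \<in> D \<Longrightarrow> \<exists>l. (\<lambda>n. f (r n) p) \<longlonglongrightarrow> l"
    using function_convergent_subsequence[of D f "sqrt (B * b)"] D bound by blast
  have diff: "f (r m) - f (r n) \<in> H1 G" for m n by (intro L.closed_diff f)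
  have E4: "energy G (f (r m) - f (r n)) \<le> 4 * b" for m n
    using E.parallelogram[OF f f, of "r m" "r n"] b[of "r m"] b[of "r n"] E.nsq_nonneg[OF E.closed_add[OF f f], of "r m" "r n"]
    by simp
  have D_Cauchy: "\<exists>N. \<forall>m\<ge>N. \<forall>n\<ge>N. (cmod ((f (r m) - f (r n)) p))\<^sup>2 < \<epsilon>" if p: "p \<in> D" and \<epsilon>: "\<epsilon> > 0" for p \<epsilon>
  proof -
    have "Cauchy (\<lambda>n. f (r n) p)" using r(2)[OF p] LIMSEQ_imp_Cauchy by blast
    then obtain N where N: "\<forall>m\<ge>N. \<forall>n\<ge>N. norm (f (r m) p - f (r n) p) < sqrt \<epsilon>"
      using \<epsilon> CauchyD[of "\<lambda>n. f (r n) p" "sqrt \<epsilon>"] by auto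
    have "(cmod ((f (r m) - f (r n)) p))\<^sup>2 < \<epsilon>" if "m \<ge> N" "n \<ge> N" for m n
    proof -
      have "(cmod ((f (r m) - f (r n)) p))\<^sup>2 < (sqrt \<epsilon>)\<^sup>2"
        using N that by (intro power_strict_mono) auto
      then show ?thesis using \<open>\<epsilon> > 0\<close> by simp
    qed
    then show ?thesis by blast
  qed
  have edge: "\<exists>N. \<forall>m\<ge>N. \<forall>n\<ge>N. edge_sq G (f (r m) - f (r n)) e < \<epsilon>" if e: "e \<in> edges G" and \<epsilon>: "\<epsilon> > 0" for e \<epsilon>
  proof -
    let ?l = "elen G e"
    have l: "?l > 0" by (rule elen_pos[OF e])
    obtain k0 :: nat where k0: "16 * ?l\<^sup>2 * b / \<epsilon> < real k0" using reals_Archimedean2 by blast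
    define k where "k = Suc k0"
    have k: "k > 0" "16 * ?l\<^sup>2 * b / real k \<le> \<epsilon>"
      using k0 \<epsilon> by (auto simp: k_def field_simps)
    define \<delta> where "\<delta> = \<epsilon> / (8 * ?l * real (Suc k))"
    have \<delta>: "\<delta> > 0" using \<epsilon> l by (simp add: \<delta>_def)
    have "\<forall>i\<in>{..k}. \<exists>N. \<forall>m\<ge>N. \<forall>n\<ge>N. (cmod ((f (r m) - f (r n)) (e, ?l * (real i / real k))))\<^sup>2 < \<delta>"
    proof
      fix i assume "i \<in> {..k}"
      then have "(e, ?l * (real i / real k)) \<in> D"
        unfolding D_def using e k(1)
        by (intro image_eqI[of _ _ "(e, of_nat i / of_nat k)"]) (auto simp: of_rat_divide field_simps)
      from D_Cauchy[OF this \<delta>]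
      show "\<exists>N. \<forall>m\<ge>N. \<forall>n\<ge>N. (cmod ((f (r m) - f (r n)) (e, ?l * (real i / real k))))\<^sup>2 < \<delta>" .
    qed
    then obtain N where N: "\<And>i m n. i \<le> k \<Longrightarrow> m \<ge> N i \<Longrightarrow> n \<ge> N i \<Longrightarrow>
        (cmod ((f (r m) - f (r n)) (e, ?l * (real i / real k))))\<^sup>2 < \<delta>"
      unfolding Ball_def atMost_iff by metis
    have "edge_sq G (f (r m) - f (r n)) e < \<epsilon>" if mn: "m \<ge> Max (N ` {..k})" "n \<ge> Max (N ` {..k})" for m n
    proof -
      have "N i \<le> Max (N ` {..k})" if "i \<le> k" for i using that by (intro Max_ge) auto
      then have "(\<Sum>i\<le>k. (cmod ((f (r m) - f (r n)) (e, ?l * (real i / real k))))\<^sup>2) \<le> (\<Sum>i\<le>k. \<delta>)"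
        using mn by (intro sum_mono less_imp_le[OF N]) (auto intro: order_trans)
      also have "\<dots> = real (Suc k) * \<delta>" by simp
      finally have 1: "(\<Sum>i\<le>k. (cmod ((f (r m) - f (r n)) (e, ?l * (real i / real k))))\<^sup>2) \<le> real (Suc k) * \<delta>" .
      have 2: "2 * (?l / real k) * energy G (f (r m) - f (r n)) \<le> 2 * (?l / real k) * (4 * b)"
        using E4 l by (intro mult_left_mono) auto
      have "edge_sq G (f (r m) - f (r n)) e \<le> ?l * (2 * (real (Suc k) * \<delta>) + 2 * (?l / real k) * (4 * b))"
        by (rule order_trans[OF edge_sq_le_mesh[OF diff e k(1)] mult_left_mono[OF add_mono[OF mult_left_mono[OF 1] 2]]])
          (use l in auto)
      also have "\<dots> = \<epsilon> / 4 + (16 * ?l\<^sup>2 * b / real k) / 2"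
      proof -
        have "8 * ?l * real (Suc k) * \<delta> = \<epsilon>" unfolding \<delta>_def using l by (simp del: of_nat_Suc)
        then have "?l * (2 * (real (Suc k) * \<delta>)) = \<epsilon> / 4" by (simp del: of_nat_Suc add: mult_ac)
        moreover have "?l * (2 * (?l / real k) * (4 * b)) = (16 * ?l\<^sup>2 * b / real k) / 2"
          by (simp add: power2_eq_square)
        ultimately show ?thesis by (simp only: distrib_left)
      qed
      also have "\<dots> < \<epsilon>"
      proof -
        have "a / 4 + t / 2 < a" if "t \<le> a" "0 < a" for a t :: real using that by simp
        from this[OF k(2) \<epsilon>] show ?thesis .
      qed
      finally show ?thesis .
    qed
    then show ?thesis by blast
  qed
  have "\<exists>N. \<forall>m\<ge>N. \<forall>n\<ge>N. mass G (f (r m) - f (r n)) < \<epsilon>" if \<epsilon>: "\<epsilon> > 0" for \<epsilon>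
  proof -
    have "\<epsilon> / (16 * (b + 1)) > 0" using \<epsilon> b0 by simp
    from tail[OF this] obtain S where S: "finite S" "S \<subseteq> edges G"
      and tl: "\<And>\<phi>. \<phi> \<in> H1 G \<Longrightarrow> mass G \<phi> \<le> (\<Sum>e\<in>S. edge_sq G \<phi> e) + \<epsilon> / (16 * (b + 1)) * energy G \<phi>" by blast
    define \<delta> where "\<delta> = \<epsilon> / (2 * (real (card S) + 1))"
    have \<delta>: "\<delta> > 0" using \<epsilon> by (simp add: \<delta>_def)
    have "\<forall>e\<in>S. \<exists>N. \<forall>m\<ge>N. \<forall>n\<ge>N. edge_sq G (f (r m) - f (r n)) e < \<delta>" using edge \<delta> S(2) by blast
    then obtain N where N: "\<And>e m n. e \<in> S \<Longrightarrow> m \<ge> N e \<Longrightarrow> n \<ge> N e \<Longrightarrow> edge_sq G (f (r m) - f (r n)) e < \<delta>" by metis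
    have "mass G (f (r m) - f (r n)) < \<epsilon>" if mn: "m \<ge> Max (insert 0 (N ` S))" "n \<ge> Max (insert 0 (N ` S))" for m n
    proof -
      have "N e \<le> Max (insert 0 (N ` S))" if "e \<in> S" for e using that S(1) by (intro Max_ge) auto
      then have "(\<Sum>e\<in>S. edge_sq G (f (r m) - f (r n)) e) \<le> (\<Sum>e\<in>S. \<delta>)"
        using mn by (intro sum_mono less_imp_le[OF N]) (auto intro: order_trans)
      also have "\<dots> \<le> \<epsilon> / 2" using \<epsilon> by (simp add: \<delta>_def field_simps)
      finally have 1: "(\<Sum>e\<in>S. edge_sq G (f (r m) - f (r n)) e) \<le> \<epsilon> / 2" .
      have "\<epsilon> / (16 * (b + 1)) * energy G (f (r m) - f (r n)) \<le> \<epsilon> / (16 * (b + 1)) * (4 * b)"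
        using E4 \<epsilon> b0 by (intro mult_left_mono) auto
      also have "\<dots> \<le> \<epsilon> / 4" using \<epsilon> b0 by (simp add: field_simps)
      finally show ?thesis using 1 tl[OF diff, of m n] \<epsilon> by linarith
    qed
    then show ?thesis by blast
  qed
  then show ?thesis using r(1) by blast
qed

end

section \<open>Decay of functions on the comb\<close>

abbreviation comb :: "(comb_vertex, comb_edge) metric_graph" where
  "comb \<equiv> diagonal_comb 1"

lemma comb_graph: "metric_graph comb"
  by (rule metric_graph_diagonal_comb) simp

lemma comb_edges [simp]: "Tooth n \<in> edges comb \<longleftrightarrow> n \<ge> 1" "Backbone n \<in> edges comb \<longleftrightarrow> n \<ge> 1"
  by (auto simp: diagonal_comb_def)

lemma comb_edges_eq: "edges comb = Tooth ` {1..} \<union> Backbone ` {1..}"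
  by (simp add: diagonal_comb_def)

lemma comb_elen [simp]:
  "elen comb (Tooth n) = 1 / real n" "elen comb (Backbone n) = 1 / real n - 1 / real (n + 1)"
  by (simp_all add: diagonal_comb_def powr_minus_divide)

lemma comb_vertices:
  assumes "n \<ge> 1"
  shows "at_vertex comb (Tooth n, 0) (Foot n)" "at_vertex comb (Backbone n, 0) (Foot (n + 1))"
    "at_vertex comb (Backbone n, elen comb (Backbone n)) (Foot n)"
  using at_vertex.src[of "Tooth n" comb] at_vertex.src[of "Backbone n" comb] at_vertex.tgt[of "Backbone n" comb] assms
  by (simp_all add: diagonal_comb_def)

text \<open>Every finite set of edges is contained in the set of teeth and backbone edges up to some index \<open>N\<close>.\<close>

lemma comb_sum_bound:
  fixes a :: "comb_edge \<Rightarrow> real"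
  assumes s: "a summable_on edges comb" and nn: "\<And>e. 0 \<le> a e"
    and b: "\<And>N. (\<Sum>n=1..N. a (Tooth n) + a (Backbone n)) \<le> b"
  shows "infsum a (edges comb) \<le> b"
proof (rule infsum_le_finite_sums[OF s])
  fix F assume F: "finite F" "F \<subseteq> edges comb"
  define idx where "idx e = (case e of Tooth n \<Rightarrow> n | Backbone n \<Rightarrow> n)" for e
  define N where "N = Max (insert 0 (idx ` F))"
  have "idx e \<le> N" if "e \<in> F" for e unfolding N_def using F that by (intro Max_ge) auto
  then have sub: "F \<subseteq> Tooth ` {1..N} \<union> Backbone ` {1..N}"
    using F(2) by (force simp: comb_edges_eq idx_def)
  have "sum a F \<le> sum a (Tooth ` {1..N} \<union> Backbone ` {1..N})"
    using sub nn by (intro sum_mono2) auto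
  also have "\<dots> = sum a (Tooth ` {1..N}) + sum a (Backbone ` {1..N})"
    by (intro sum.union_disjoint) auto
  also have "\<dots> = (\<Sum>n=1..N. a (Tooth n) + a (Backbone n))"
    by (simp add: sum.reindex inj_on_def sum.distrib)
  finally show "sum a F \<le> b" using b[of N] by simp
qed

lemma sum_inverse_squares:
  assumes "M \<ge> 1"
  shows "(\<Sum>n=M+1..N. 1 / (real n)\<^sup>2) \<le> 1 / real M"
proof (cases "N \<ge> M")
  case True
  have "(\<Sum>n=M+1..N. 1 / (real n)\<^sup>2) \<le> 1 / real M - 1 / real N" using True
  proof (induction N rule: dec_induct)
    case (step N)
    have N: "real N \<ge> 1" using step assms by simp
    have "1 / (real (Suc N))\<^sup>2 \<le> 1 / (real N * real (Suc N))"
      using N by (intro divide_left_mono) (auto simp: power2_eq_square)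
    also have "\<dots> = 1 / real N - 1 / real (Suc N)" using N by (simp add: field_simps)
    finally show ?case using step by simp
  qed simp
  also have "\<dots> \<le> 1 / real M" by simp
  finally show ?thesis .
qed simp

lemma harm_le: "K \<ge> 1 \<Longrightarrow> harm K \<le> 1 + ln (real K)"
  using decseqD[OF decseq_harm_diff_ln, of 0 "K - 1"] by (simp add: harm_expand)

context
  fixes \<phi> :: "comb_edge \<times> real \<Rightarrow> complex" assumes \<phi>: "\<phi> \<in> H1 comb"
begin

lemma foot_eq:
  assumes "n \<ge> 1"
  shows "\<phi> (Backbone n, 0) = \<phi> (Tooth (n + 1), 0)" "\<phi> (Backbone n, elen comb (Backbone n)) = \<phi> (Tooth n, 0)"
  by (rule graph_continuous_vertex[OF comb_graph H1_D(1)[OF \<phi>]], rule comb_vertices, rule assms,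
      rule comb_vertices, use assms in simp)+

lemma backbone_len: "n \<ge> 1 \<Longrightarrow> 0 \<le> elen comb (Backbone n)" "n \<ge> 1 \<Longrightarrow> elen comb (Backbone n) \<le> 1 / real n"
  by (auto simp: frac_le)

lemma energy_nonneg: "0 \<le> energy comb \<phi>"
  using hermitian_form.nsq_nonneg[OF hermitian_form_energy \<phi>] .

lemma Hoelder_le:
  assumes "e \<in> edges comb" "x \<in> {0..elen comb e}" "y \<in> {0..elen comb e}" "\<bar>y - x\<bar> \<le> d"
  shows "(cmod (\<phi> (e, y) - \<phi> (e, x)))\<^sup>2 \<le> d * energy comb \<phi>"
proof -
  have "(cmod (\<phi> (e, y) - \<phi> (e, x)))\<^sup>2 \<le> \<bar>y - x\<bar> * edge_sq comb (graph_deriv comb \<phi>) e"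
    by (rule H1_Hoelder[OF \<phi> assms(1-3)])
  also have "\<dots> \<le> d * energy comb \<phi>"
    using assms(4) by (intro mult_mono edge_energy_le \<phi> assms(1) edge_sq_nonneg) auto
  finally show ?thesis .
qed

text \<open>The Cauchy-Schwarz inequality over the backbone edges between two foot points, whose lengths
telescope to less than \<open>1/n\<close>.\<close>

lemma backbone_Hoelder:
  assumes n: "n \<ge> 1"
  shows "(cmod (\<phi> (Tooth n, 0) - \<phi> (Tooth (n + k), 0)))\<^sup>2 \<le> 1 / real n * energy comb \<phi>"
proof -
  define l where "l j = elen comb (Backbone (n + j))" for j
  define D where "D j = edge_sq comb (graph_deriv comb \<phi>) (Backbone (n + j))" for j
  have l0: "l j \<ge> 0" for j unfolding l_def by (rule backbone_len) (use n in simp)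
  have D0: "D j \<ge> 0" for j unfolding D_def by (rule edge_sq_nonneg)
  have step: "cmod (\<phi> (Tooth (n + j), 0) - \<phi> (Tooth (n + Suc j), 0)) \<le> sqrt (l j) * sqrt (D j)" for j
  proof -
    have "(cmod (\<phi> (Backbone (n + j), l j) - \<phi> (Backbone (n + j), 0)))\<^sup>2 \<le> \<bar>l j - 0\<bar> * D j"
      unfolding D_def by (rule H1_Hoelder[OF \<phi>]) (use n l0[of j] in \<open>auto simp: l_def\<close>)
    then have "(cmod (\<phi> (Tooth (n + j), 0) - \<phi> (Tooth (n + Suc j), 0)))\<^sup>2 \<le> l j * D j"
      using foot_eq[of "n + j"] n l0[of j] by (simp add: l_def)
    then show ?thesis unfolding real_sqrt_mult[symmetric] by (rule real_le_rsqrt)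
  qed
  have "cmod (\<phi> (Tooth n, 0) - \<phi> (Tooth (n + k), 0)) \<le> (\<Sum>j<k. sqrt (l j) * sqrt (D j))"
  proof (induction k)
    case (Suc k)
    have "cmod (\<phi> (Tooth n, 0) - \<phi> (Tooth (n + Suc k), 0))
       \<le> cmod (\<phi> (Tooth n, 0) - \<phi> (Tooth (n + k), 0)) + cmod (\<phi> (Tooth (n + k), 0) - \<phi> (Tooth (n + Suc k), 0))"
      using norm_triangle_ineq[of "\<phi> (Tooth n, 0) - \<phi> (Tooth (n + k), 0)" "\<phi> (Tooth (n + k), 0) - \<phi> (Tooth (n + Suc k), 0)"]
      by simp
    then show ?case using Suc step[of k] by simp
  qed simp
  then have "(cmod (\<phi> (Tooth n, 0) - \<phi> (Tooth (n + k), 0)))\<^sup>2 \<le> (\<Sum>j<k. sqrt (l j) * sqrt (D j))\<^sup>2"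
    by (rule power_mono) simp
  also have "\<dots> \<le> (\<Sum>j<k. (sqrt (l j))\<^sup>2) * (\<Sum>j<k. (sqrt (D j))\<^sup>2)" by (rule Cauchy_Schwarz_ineq_sum)
  also have "\<dots> = (\<Sum>j<k. l j) * (\<Sum>j<k. D j)" using l0 D0 by simp
  also have "\<dots> \<le> 1 / real n * energy comb \<phi>"
  proof (intro mult_mono)
    have "(\<Sum>j<k. l j) = 1 / real n - 1 / real (n + k)"
      by (induction k) (auto simp: l_def)
    then show "(\<Sum>j<k. l j) \<le> 1 / real n" by simp
    have "(\<Sum>j<k. D j) = (\<Sum>e\<in>(\<lambda>j. Backbone (n + j)) ` {..<k}. edge_sq comb (graph_deriv comb \<phi>) e)"
      by (simp add: sum.reindex inj_on_def D_def)
    also have "\<dots> \<le> energy comb \<phi>"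
      unfolding energy_eq using n by (intro edge_sq_le_nsq H1_D(3)[OF \<phi>]) auto
    finally show "(\<Sum>j<k. D j) \<le> energy comb \<phi>" .
  qed (auto intro: sum_nonneg D0)
  finally show ?thesis .
qed

text \<open>Otherwise \<open>|\<phi>|\<^sup>2\<close> would be at least \<open>\<delta>\<^sup>2/4\<close> on every tooth close enough to \<open>0\<close>, since the squared variation
along tooth \<open>m\<close> is at most \<open>E/m\<close>. As the lengths of the teeth have infinite sum, \<open>\<phi>\<close> would not be square integrable.\<close>

lemma foot_small:
  assumes \<delta>: "\<delta> > 0"
  shows "\<exists>m\<ge>N. cmod (\<phi> (Tooth m, 0)) < \<delta>"
proof (rule ccontr)
  assume "\<not> ?thesis"
  then have big: "\<delta> \<le> cmod (\<phi> (Tooth m, 0))" if "m \<ge> N" for m using that by force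
  let ?E = "energy comb \<phi>"
  obtain N0 :: nat where N0: "4 * ?E / \<delta>\<^sup>2 < real N0" using reals_Archimedean2 by blast
  define M where "M = max N N0 + 1"
  have tooth: "\<delta>\<^sup>2 / 4 * (1 / real m) \<le> edge_sq comb \<phi> (Tooth m)" if m: "m \<ge> M" for m
  proof -
    have m1: "m \<ge> 1" "m \<ge> N" "real m > 4 * ?E / \<delta>\<^sup>2" using m N0 by (auto simp: M_def)
    have Em: "1 / real m * ?E \<le> \<delta>\<^sup>2 / 4"
      using m1(1,3) \<delta> by (simp add: field_simps)
    let ?M = "lebesgue_on {0..elen comb (Tooth m)}"
    interpret finite_measure ?M by (rule finite_measure_interval)
    have "(\<integral>x. \<delta>\<^sup>2 / 4 \<partial>?M) \<le> edge_sq comb \<phi> (Tooth m)"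
      unfolding edge_sq_def
    proof (rule integral_mono)
      show "integrable ?M (\<lambda>x. (cmod (restr \<phi> (Tooth m) x))\<^sup>2)"
        using L2_sqint[OF H1_D(2)[OF \<phi>], of "Tooth m"] m1 by (simp add: sqint_def)
      fix x assume "x \<in> space ?M"
      then have x: "x \<in> {0..elen comb (Tooth m)}" by simp
      have "\<delta>\<^sup>2 \<le> (cmod (\<phi> (Tooth m, 0)))\<^sup>2" using big[OF m1(2)] \<delta> by (intro power_mono) auto
      also have "\<dots> \<le> 2 * (cmod (\<phi> (Tooth m, x)))\<^sup>2 + 2 * (cmod (\<phi> (Tooth m, 0) - \<phi> (Tooth m, x)))\<^sup>2"
        using cmod_add_sq_le[of "\<phi> (Tooth m, x)" "\<phi> (Tooth m, 0) - \<phi> (Tooth m, x)"] by simp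
      also have "(cmod (\<phi> (Tooth m, 0) - \<phi> (Tooth m, x)))\<^sup>2 \<le> 1 / real m * ?E"
        by (rule Hoelder_le) (use x m1 in auto)
      finally show "\<delta>\<^sup>2 / 4 \<le> (cmod (restr \<phi> (Tooth m) x))\<^sup>2" unfolding restr_def using Em by linarith
    qed simp
    then show ?thesis by (simp add: measure_restrict_space)
  qed
  have sb: "(\<Sum>m=M..<M+k. \<delta>\<^sup>2 / 4 * (1 / real m)) \<le> mass comb \<phi>" for k
  proof -
    have "(\<Sum>m=M..<M+k. \<delta>\<^sup>2 / 4 * (1 / real m)) \<le> (\<Sum>m=M..<M+k. edge_sq comb \<phi> (Tooth m))"
      by (intro sum_mono tooth) simp
    also have "\<dots> = (\<Sum>e\<in>Tooth ` {M..<M+k}. edge_sq comb \<phi> e)" by (simp add: sum.reindex inj_on_def)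
    also have "\<dots> \<le> mass comb \<phi>" by (intro edge_sq_le_nsq H1_D(2)[OF \<phi>]) (auto simp: M_def)
    finally show ?thesis .
  qed
  have eq: "(\<Sum>m=M..<M+k. \<delta>\<^sup>2 / 4 * (1 / real m)) = \<delta>\<^sup>2 / 4 * (harm (M + k - 1) - harm (M - 1))" for k
  proof -
    have "(\<Sum>m=M..<M+k. 1 / real m) = harm (M + k - 1) - harm (M - 1)"
      by (induction k) (auto simp: M_def harm_Suc inverse_eq_divide)
    then show ?thesis by (simp only: sum_distrib_left[symmetric])
  qed
  have bd: "\<delta>\<^sup>2 / 4 * (harm (M + k - 1) - harm (M - 1)) \<le> mass comb \<phi>" for k
    using sb[of k] unfolding eq .
  have "\<forall>\<^sub>F k in sequentially. harm k > 4 * mass comb \<phi> / \<delta>\<^sup>2 + harm (M - 1)"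
    using harm_at_top by (simp add: filterlim_at_top_dense)
  then obtain k where "k \<ge> M" and k: "harm k > 4 * mass comb \<phi> / \<delta>\<^sup>2 + harm (M - 1)"
    unfolding eventually_sequentially by (meson nat_le_linear order_refl)
  then have "harm (M + k - 1) \<ge> (harm k :: real)" by (intro harm_mono) (auto simp: M_def)
  then have "harm (M + k - 1) - harm (M - 1) > 4 * mass comb \<phi> / \<delta>\<^sup>2" using k by simp
  then show False using bd[of k] \<delta> by (simp add: field_simps)
qed

text \<open>Walk along the backbone to a foot point where \<open>\<phi>\<close> is small: the missing point \<open>0\<close> acts like a Dirichlet
condition.\<close>

lemma foot_le:
  assumes n: "n \<ge> 1"
  shows "(cmod (\<phi> (Tooth n, 0)))\<^sup>2 \<le> 1 / real n * energy comb \<phi>"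
proof -
  have "cmod (\<phi> (Tooth n, 0)) \<le> sqrt (1 / real n * energy comb \<phi>) + \<delta>" if \<delta>: "\<delta> > 0" for \<delta>
  proof -
    obtain m where m: "m \<ge> n" "cmod (\<phi> (Tooth m, 0)) < \<delta>" using foot_small[OF \<delta>] by blast
    have "cmod (\<phi> (Tooth n, 0) - \<phi> (Tooth m, 0)) \<le> sqrt (1 / real n * energy comb \<phi>)"
      using backbone_Hoelder[OF n, of "m - n"] m(1) by (intro real_le_rsqrt) simp
    then show ?thesis using norm_triangle_ineq[of "\<phi> (Tooth n, 0) - \<phi> (Tooth m, 0)" "\<phi> (Tooth m, 0)"] m(2) by simp
  qed
  then have "cmod (\<phi> (Tooth n, 0)) \<le> sqrt (1 / real n * energy comb \<phi>)" by (rule field_le_epsilon)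
  then have "(cmod (\<phi> (Tooth n, 0)))\<^sup>2 \<le> (sqrt (1 / real n * energy comb \<phi>))\<^sup>2" by (rule power_mono) simp
  then show ?thesis using energy_nonneg by simp
qed

lemma comb_pointwise:
  assumes n: "n \<ge> 1" and e: "e = Tooth n \<or> e = Backbone n" and x: "x \<in> {0..elen comb e}"
  shows "(cmod (\<phi> (e, x)))\<^sup>2 \<le> 4 / real n * energy comb \<phi>"
proof -
  define y where "y = (if e = Tooth n then 0 else elen comb e)"
  have ee: "e \<in> edges comb" "elen comb e \<le> 1 / real n" "elen comb e \<ge> 0" using e n backbone_len[OF n] by auto
  have y: "\<phi> (e, y) = \<phi> (Tooth n, 0)" "y \<in> {0..elen comb e}" "\<bar>x - y\<bar> \<le> 1 / real n"
    using e foot_eq(2)[OF n] ee x by (auto simp: y_def)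
  have "(cmod (\<phi> (e, x)))\<^sup>2 \<le> 2 * (cmod (\<phi> (e, y)))\<^sup>2 + 2 * (cmod (\<phi> (e, x) - \<phi> (e, y)))\<^sup>2"
    using cmod_add_sq_le[of "\<phi> (e, y)" "\<phi> (e, x) - \<phi> (e, y)"] by simp
  moreover have "(cmod (\<phi> (e, x) - \<phi> (e, y)))\<^sup>2 \<le> 1 / real n * energy comb \<phi>"
    by (rule Hoelder_le[OF ee(1) y(2) x y(3)])
  ultimately show ?thesis using foot_le[OF n] y(1) by simp
qed

lemma comb_edge_sq:
  assumes n: "n \<ge> 1" and e: "e = Tooth n \<or> e = Backbone n"
  shows "edge_sq comb \<phi> e \<le> 4 / (real n)\<^sup>2 * energy comb \<phi>"
proof -
  have ee: "e \<in> edges comb" "elen comb e \<le> 1 / real n" "elen comb e \<ge> 0" using e n backbone_len[OF n] by auto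
  have "edge_sq comb \<phi> e \<le> elen comb e * (4 / real n * energy comb \<phi>)"
    using H1_D(2)[OF \<phi>] ee comb_pointwise[OF n e] by (intro edge_sq_le_sup) (auto simp: L2_iff)
  also have "\<dots> \<le> 1 / real n * (4 / real n * energy comb \<phi>)"
    using ee energy_nonneg by (intro mult_right_mono) auto
  finally show ?thesis by (simp add: power2_eq_square)
qed

lemma comb_tail:
  assumes M: "M \<ge> 1"
  shows "mass comb \<phi> \<le> (\<Sum>n=1..M. edge_sq comb \<phi> (Tooth n) + edge_sq comb \<phi> (Backbone n)) + 8 / real M * energy comb \<phi>"
  unfolding nsq_L2
proof (rule comb_sum_bound)
  show "edge_sq comb \<phi> summable_on edges comb" using H1_D(2)[OF \<phi>] by (simp add: L2_iff)
  show "0 \<le> edge_sq comb \<phi> e" for e by (rule edge_sq_nonneg)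
  fix N
  let ?a = "\<lambda>n. edge_sq comb \<phi> (Tooth n) + edge_sq comb \<phi> (Backbone n)"
  have "(\<Sum>n=1..N. ?a n) \<le> (\<Sum>n\<in>{1..M} \<union> {M+1..N}. ?a n)"
    by (intro sum_mono2) (auto intro: add_nonneg_nonneg edge_sq_nonneg)
  also have "\<dots> = (\<Sum>n=1..M. ?a n) + (\<Sum>n=M+1..N. ?a n)" by (intro sum.union_disjoint) auto
  also have "(\<Sum>n=M+1..N. ?a n) \<le> (\<Sum>n=M+1..N. 8 * energy comb \<phi> * (1 / (real n)\<^sup>2))"
  proof (intro sum_mono)
    fix n assume "n \<in> {M+1..N}"
    then show "?a n \<le> 8 * energy comb \<phi> * (1 / (real n)\<^sup>2)"
      using comb_edge_sq[of n "Tooth n"] comb_edge_sq[of n "Backbone n"] by simp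
  qed
  also have "\<dots> = 8 * energy comb \<phi> * (\<Sum>n=M+1..N. 1 / (real n)\<^sup>2)" by (rule sum_distrib_left[symmetric])
  also have "\<dots> \<le> 8 * energy comb \<phi> * (1 / real M)"
    using energy_nonneg by (intro mult_left_mono sum_inverse_squares M) auto
  finally show "(\<Sum>n=1..N. ?a n) \<le> (\<Sum>n=1..M. ?a n) + 8 / real M * energy comb \<phi>" by simp
qed

lemma comb_mass_le: "mass comb \<phi> \<le> 16 * energy comb \<phi>"
  using comb_tail[of 1] comb_edge_sq[of 1 "Tooth 1"] comb_edge_sq[of 1 "Backbone 1"] by simp

end

interpretation comb: dominated_graph comb 4 16
proof
  show "metric_graph comb" by (rule comb_graph)
  fix \<phi> p assume \<phi>: "\<phi> \<in> H1 comb"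
  then show "mass comb \<phi> \<le> 16 * energy comb \<phi>" by (rule comb_mass_le)
  assume "p \<in> points comb"
  then obtain e x n where p: "p = (e, x)" "x \<in> {0..elen comb e}" "n \<ge> 1" "e = Tooth n \<or> e = Backbone n"
    by (auto simp: points_def comb_edges_eq)
  have "(cmod (\<phi> p))\<^sup>2 \<le> 4 / real n * energy comb \<phi>" using comb_pointwise[OF \<phi> p(3,4,2)] p(1) by simp
  also have "\<dots> \<le> 4 * energy comb \<phi>"
    using p(3) energy_nonneg[OF \<phi>] by (intro mult_right_mono) (auto simp: divide_le_eq)
  finally show "(cmod (\<phi> p))\<^sup>2 \<le> 4 * energy comb \<phi>" .
next
  fix \<epsilon> :: real assume \<epsilon>: "\<epsilon> > 0"
  obtain M0 :: nat where M0: "8 / \<epsilon> < real M0" using reals_Archimedean2 by blast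
  define M where "M = M0 + 1"
  have M: "M \<ge> 1" "8 / real M \<le> \<epsilon>" using M0 \<epsilon> by (auto simp: M_def field_simps)
  let ?S = "Tooth ` {1..M} \<union> Backbone ` {1..M}"
  have "mass comb \<phi> \<le> (\<Sum>e\<in>?S. edge_sq comb \<phi> e) + \<epsilon> * energy comb \<phi>" if \<phi>: "\<phi> \<in> H1 comb" for \<phi>
  proof -
    have "(\<Sum>e\<in>?S. edge_sq comb \<phi> e) = (\<Sum>n=1..M. edge_sq comb \<phi> (Tooth n) + edge_sq comb \<phi> (Backbone n))"
      by (subst sum.union_disjoint) (auto simp: sum.reindex inj_on_def sum.distrib)
    moreover have "8 / real M * energy comb \<phi> \<le> \<epsilon> * energy comb \<phi>"
      using M energy_nonneg[OF \<phi>] by (intro mult_right_mono)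
    ultimately show ?thesis using comb_tail[OF \<phi> M(1)] by simp
  qed
  then show "\<exists>S. finite S \<and> S \<subseteq> edges comb \<and>
      (\<forall>\<phi>\<in>H1 comb. mass comb \<phi> \<le> (\<Sum>e\<in>S. edge_sq comb \<phi> e) + \<epsilon> * energy comb \<phi>)"
    by (intro exI[of _ ?S]) (auto simp: comb_edges_eq)
qed simp_all

section \<open>The trace of the evaluation functionals\<close>

text \<open>Integrate \<open>|\<phi>(x)|\<^sup>2 \<le> 2 |\<phi>(y)|\<^sup>2 + 2 |\<phi>(x) - \<phi>(y)|\<^sup>2\<close> over the points \<open>y\<close> of a segment of length \<open>h\<close>
that contains \<open>x\<close>.\<close>

lemma segment_average:
  assumes \<phi>: "\<phi> \<in> H1 comb" and e: "e \<in> edges comb" and h: "0 < h" "h \<le> elen comb e" and x: "x \<in> {0..elen comb e}"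
  shows "(cmod (\<phi> (e, x)))\<^sup>2 \<le> 2 / h * mass comb \<phi> + 2 * h * energy comb \<phi>"
proof -
  let ?l = "elen comb e" and ?M = "lebesgue_on {0..elen comb e}"
  interpret finite_measure ?M by (rule finite_measure_interval)
  \<comment> \<open>Near the end of the edge the segment is shifted to the left so that it stays inside.\<close>
  define a where "a = min x (?l - h)"
  have a: "0 \<le> a" "a + h \<le> ?l" "x \<in> {a..a+h}" using h x by (auto simp: a_def min_def)
  note m = measure_interval(3,4)[OF a(1) _ a(2)]
  have A: "{a..a+h} \<in> sets ?M" "measure ?M {a..a+h} = h" using m h by auto
  let ?c = "(cmod (\<phi> (e, x)))\<^sup>2" and ?E = "energy comb \<phi>"
  have E0: "?E \<ge> 0" by (rule energy_nonneg[OF \<phi>])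
  have "{a..a+h} \<inter> space ?M = {a..a+h}" using a by auto
  then have ind: "(\<integral>y. indicator {a..a+h} y \<partial>?M) = h" using A(2) by (simp only: Bochner_Integration.integral_indicator)
  then have "?c * h = (\<integral>y. ?c * indicator {a..a+h} y \<partial>?M)" by (simp only: integral_mult_right_zero)
  also have "\<dots> \<le> (\<integral>y. 2 * (cmod (restr \<phi> e y))\<^sup>2 + 2 * (h * ?E) * indicator {a..a+h} y \<partial>?M)"
  proof (rule integral_mono)
    have i: "integrable ?M (\<lambda>y. indicator {a..a+h} y :: real)" using A(1) by (simp add: emeasure_eq_measure)
    then show "integrable ?M (\<lambda>y. ?c * indicator {a..a+h} y)" by simp
    show "integrable ?M (\<lambda>y. 2 * (cmod (restr \<phi> e y))\<^sup>2 + 2 * (h * ?E) * indicator {a..a+h} y)"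
      using i L2_sqint[OF H1_D(2)[OF \<phi>] e] by (simp add: sqint_def)
    fix y assume "y \<in> space ?M"
    then have y: "y \<in> {0..?l}" by simp
    show "?c * indicator {a..a+h} y \<le> 2 * (cmod (restr \<phi> e y))\<^sup>2 + 2 * (h * ?E) * indicator {a..a+h} y"
    proof (cases "y \<in> {a..a+h}")
      case True
      have "?c \<le> 2 * (cmod (\<phi> (e, y)))\<^sup>2 + 2 * (cmod (\<phi> (e, x) - \<phi> (e, y)))\<^sup>2"
        using cmod_add_sq_le[of "\<phi> (e, y)" "\<phi> (e, x) - \<phi> (e, y)"] by simp
      moreover have "(cmod (\<phi> (e, x) - \<phi> (e, y)))\<^sup>2 \<le> h * ?E"
        by (rule Hoelder_le[OF \<phi> e y x]) (use True a(3) in auto)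
      ultimately show ?thesis using True by (simp add: restr_def)
    qed simp
  qed
  also have "\<dots> = 2 * edge_sq comb \<phi> e + 2 * (h * ?E) * h"
  proof -
    have *: "(\<integral>y. 2 * f y + c * g y \<partial>?M) = 2 * (\<integral>y. f y \<partial>?M) + c * (\<integral>y. g y \<partial>?M)"
      if "integrable ?M f" "integrable ?M g" for f g :: "real \<Rightarrow> real" and c using that by simp
    have "integrable ?M (\<lambda>y. indicator {a..a+h} y :: real)" using A(1) by (simp add: emeasure_eq_measure)
    from *[OF _ this, of "\<lambda>y. (cmod (restr \<phi> e y))\<^sup>2" "2 * (h * ?E)"] show ?thesis
      using L2_sqint[OF H1_D(2)[OF \<phi>] e] unfolding edge_sq_def sqint_def ind by blast
  qed
  also have "\<dots> \<le> 2 * mass comb \<phi> + 2 * (h * ?E) * h"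
    using edge_sq_le_nsq1[OF H1_D(2)[OF \<phi>] e] by simp
  finally show ?thesis using h(1) by (simp add: field_simps)
qed

text \<open>An edge of length at least \<open>1/K\<close> contains a segment over which to average. A shorter edge of index
\<open>n \<le> K\<close> is a backbone edge, and it is attached to tooth \<open>n\<close>, which is long enough.\<close>

lemma comb_local_bound:
  assumes \<phi>: "\<phi> \<in> H1 comb" and n: "n \<ge> 1" "n \<le> K" and e: "e = Tooth n \<or> e = Backbone n" and x: "x \<in> {0..elen comb e}"
  shows "(cmod (\<phi> (e, x)))\<^sup>2 \<le> 4 * real K * mass comb \<phi> + 6 / real K * energy comb \<phi>"
proof -
  have K: "real K > 0" using n by simp
  have E0: "energy comb \<phi> \<ge> 0" by (rule energy_nonneg[OF \<phi>])
  have M0: "mass comb \<phi> \<ge> 0" by (rule comb.L.nsq_nonneg[OF \<phi>])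
  have ee: "e \<in> edges comb" using e n by auto
  have seg: "(cmod (\<phi> (e, x)))\<^sup>2 \<le> 2 * real K * mass comb \<phi> + 2 / real K * energy comb \<phi>"
    if "e \<in> edges comb" "1 / real K \<le> elen comb e" "x \<in> {0..elen comb e}" for e x
    using segment_average[OF \<phi> that(1) _ that(2,3)] K by simp
  show ?thesis
  proof (cases "1 / real K \<le> elen comb e")
    case True
    from seg[OF ee True x] show ?thesis
      using mult_nonneg_nonneg[OF less_imp_le[OF K] M0] divide_nonneg_pos[OF E0 K] by simp
  next
    case False
    have tooth: "1 / real K \<le> elen comb (Tooth n)" using n by (simp add: frac_le)
    then have e': "e = Backbone n" using False e by auto
    let ?y = "elen comb e"
    have y: "?y \<in> {0..?y}" "\<bar>x - ?y\<bar> \<le> 1 / real K" using x False by auto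
    have "(cmod (\<phi> (e, x)))\<^sup>2 \<le> 2 * (cmod (\<phi> (e, ?y)))\<^sup>2 + 2 * (cmod (\<phi> (e, x) - \<phi> (e, ?y)))\<^sup>2"
      using cmod_add_sq_le[of "\<phi> (e, ?y)" "\<phi> (e, x) - \<phi> (e, ?y)"] by simp
    moreover have "\<phi> (e, ?y) = \<phi> (Tooth n, 0)" unfolding e' by (rule foot_eq(2)[OF \<phi> n(1)])
    moreover have "(cmod (\<phi> (e, x) - \<phi> (e, ?y)))\<^sup>2 \<le> 1 / real K * energy comb \<phi>"
      by (rule Hoelder_le[OF \<phi> ee y(1) x y(2)])
    moreover have "(cmod (\<phi> (Tooth n, 0)))\<^sup>2 \<le> 2 * real K * mass comb \<phi> + 2 / real K * energy comb \<phi>"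
      using n by (intro seg tooth) auto
    ultimately show ?thesis by simp
  qed
qed

lemma sum_of_functions_apply: "(\<Sum>i\<in>I. f i) x = (\<Sum>i\<in>I. f i x)" for f :: "'i \<Rightarrow> 'a \<Rightarrow> complex"
  by (induction I rule: infinite_finite_induct) auto

text \<open>The combination with coefficients \<open>cnj (u i p)\<close> maximizes the value at \<open>p\<close> among vectors of given
mass: its value at \<open>p\<close> and its mass are both equal to the sum \<open>S\<close> to be estimated, so the pointwise
bound reads \<open>S\<^sup>2 \<le> (\<alpha> + \<beta> \<mu>) S\<close>.\<close>

lemma evaluation_trace_bound:
  fixes u :: "'i \<Rightarrow> comb_edge \<times> real \<Rightarrow> complex"
  assumes I: "finite I" and u: "\<And>i. i \<in> I \<Longrightarrow> u i \<in> H1 comb" "\<And>i. i \<in> I \<Longrightarrow> mass comb (u i) = 1"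
    "\<And>i. i \<in> I \<Longrightarrow> energy comb (u i) \<le> \<mu>"
    and orth: "\<And>i j. i \<in> I \<Longrightarrow> j \<in> I \<Longrightarrow> i \<noteq> j \<Longrightarrow> L2_inner comb (u i) (u j) = 0"
      "\<And>i j. i \<in> I \<Longrightarrow> j \<in> I \<Longrightarrow> i \<noteq> j \<Longrightarrow> energy_form comb (u i) (u j) = 0"
    and bound: "\<And>\<phi>. \<phi> \<in> H1 comb \<Longrightarrow> (cmod (\<phi> p))\<^sup>2 \<le> \<alpha> * mass comb \<phi> + \<beta> * energy comb \<phi>"
    and \<beta>: "\<beta> \<ge> 0"
    and ab: "0 \<le> \<alpha> + \<beta> * \<mu>"
  shows "(\<Sum>i\<in>I. (cmod (u i p))\<^sup>2) \<le> \<alpha> + \<beta> * \<mu>"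
proof -
  define c where "c i = cnj (u i p)" for i
  define S where "S = (\<Sum>i\<in>I. (cmod (u i p))\<^sup>2)"
  let ?v = "\<Sum>i\<in>I. (\<lambda>p. c i * u i p)"
  have v: "?v \<in> H1 comb" by (intro comb.L.closed_sum comb.L.closed_scale u)
  have "?v p = of_real S"
    by (simp add: sum_of_functions_apply c_def S_def complex_norm_square mult.commute del: of_real_power)
  moreover have "mass comb ?v = S"
    by (subst comb.L.orthogonal_combination[OF I u(1) orth(1)]) (auto simp: u(2) S_def c_def)
  moreover have "energy comb ?v \<le> \<mu> * S"
  proof -
    have "energy comb ?v = (\<Sum>i\<in>I. (cmod (c i))\<^sup>2 * energy comb (u i))"
      by (rule comb.E.orthogonal_combination[OF I u(1) orth(2)])
    also have "\<dots> \<le> (\<Sum>i\<in>I. (cmod (c i))\<^sup>2 * \<mu>)" by (intro sum_mono mult_left_mono u) auto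
    also have "\<dots> = \<mu> * S" by (simp add: S_def c_def sum_distrib_left mult.commute)
    finally show ?thesis .
  qed
  ultimately have "S\<^sup>2 \<le> \<alpha> * S + \<beta> * (\<mu> * S)"
    using bound[OF v] mult_left_mono[OF \<open>energy comb ?v \<le> \<mu> * S\<close> \<beta>] by simp
  then have le: "S * S \<le> (\<alpha> + \<beta> * \<mu>) * S" by (simp add: power2_eq_square algebra_simps)
  have "S \<ge> 0" unfolding S_def by (intro sum_nonneg) simp
  then show ?thesis
    using le ab unfolding S_def[symmetric] by (cases "S = 0") auto
qed

text \<open>The number of functions is the integral over the graph of the sum of their squares. For \<open>n \<le> K\<close>
the \<open>n\<close>-th tooth and backbone edge together contribute at most \<open>20 K/n\<close>, which is the source of the
logarithm; all later edges together contribute at most \<open>8 K\<close>.\<close>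

lemma counting_bound:
  fixes u :: "'i \<Rightarrow> comb_edge \<times> real \<Rightarrow> complex"
  assumes K: "K \<ge> 1" and I: "finite I" and u: "\<And>i. i \<in> I \<Longrightarrow> u i \<in> H1 comb" "\<And>i. i \<in> I \<Longrightarrow> mass comb (u i) = 1"
    "\<And>i. i \<in> I \<Longrightarrow> energy comb (u i) \<le> (real K)\<^sup>2"
    and orth: "\<And>i j. i \<in> I \<Longrightarrow> j \<in> I \<Longrightarrow> i \<noteq> j \<Longrightarrow> L2_inner comb (u i) (u j) = 0"
      "\<And>i j. i \<in> I \<Longrightarrow> j \<in> I \<Longrightarrow> i \<noteq> j \<Longrightarrow> energy_form comb (u i) (u j) = 0"
  shows "real (card I) \<le> 28 * real K * (1 + ln (real K))"
proof -
  define a where "a e = (\<Sum>i\<in>I. edge_sq comb (u i) e)" for e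
  have uL2: "u i \<in> L2 comb" if "i \<in> I" for i using H1_D(2)[OF u(1)[OF that]] .
  have Kp: "real K > 0" using K by simp
  have edge: "a e \<le> elen comb e * B"
    if e: "e \<in> edges comb" and B: "\<And>x. x \<in> {0..elen comb e} \<Longrightarrow> (\<Sum>i\<in>I. (cmod (u i (e, x)))\<^sup>2) \<le> B" for e B
  proof -
    let ?M = "lebesgue_on {0..elen comb e}"
    interpret finite_measure ?M by (rule finite_measure_interval)
    have int: "integrable ?M (\<lambda>x. (cmod (restr (u i) e x))\<^sup>2)" if "i \<in> I" for i
      using L2_sqint[OF uL2[OF that] e] by (simp add: sqint_def)
    have "a e = (\<integral>x. (\<Sum>i\<in>I. (cmod (restr (u i) e x))\<^sup>2) \<partial>?M)"
      unfolding a_def edge_sq_def by (rule Bochner_Integration.integral_sum[symmetric]) (rule int)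
    also have "\<dots> \<le> (\<integral>x. B \<partial>?M)"
      by (rule integral_mono) (use int B in \<open>auto simp: restr_def intro!: Bochner_Integration.integrable_sum\<close>)
    also have "\<dots> = elen comb e * B" using comb.elen_pos[OF e] by (simp add: measure_restrict_space)
    finally show ?thesis .
  qed
  have len: "elen comb (Tooth n) \<le> 1 / real n" "elen comb (Backbone n) \<le> 1 / real n" for n by auto
  have pair: "a (Tooth n) + a (Backbone n) \<le> 2 / real n * B"
    if n: "n \<ge> 1" and B: "\<And>e x. e = Tooth n \<or> e = Backbone n \<Longrightarrow> x \<in> {0..elen comb e} \<Longrightarrow> (\<Sum>i\<in>I. (cmod (u i (e, x)))\<^sup>2) \<le> B"
      and "B \<ge> 0" for n B
  proof -
    have "a (Tooth n) \<le> elen comb (Tooth n) * B" "a (Backbone n) \<le> elen comb (Backbone n) * B"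
      by (rule edge; use n B in auto)+
    moreover have "elen comb (Tooth n) * B \<le> 1 / real n * B" "elen comb (Backbone n) * B \<le> 1 / real n * B"
      by (intro mult_right_mono len \<open>B \<ge> 0\<close>)+
    ultimately show ?thesis by simp
  qed
  have head: "a (Tooth n) + a (Backbone n) \<le> 20 * real K * (1 / real n)" if n: "n \<ge> 1" "n \<le> K" for n
  proof -
    have "(\<Sum>i\<in>I. (cmod (u i (e, x)))\<^sup>2) \<le> 4 * real K + 6 / real K * (real K)\<^sup>2"
      if "e = Tooth n \<or> e = Backbone n" "x \<in> {0..elen comb e}" for e x
      by (rule evaluation_trace_bound[OF I u orth comb_local_bound[OF _ n that]]) (use K in auto)
    then have "(\<Sum>i\<in>I. (cmod (u i (e, x)))\<^sup>2) \<le> 10 * real K"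
      if "e = Tooth n \<or> e = Backbone n" "x \<in> {0..elen comb e}" for e x
      using that Kp by (fastforce simp: power2_eq_square)
    from pair[OF n(1) this] show ?thesis by simp
  qed
  have tail: "a (Tooth n) + a (Backbone n) \<le> 8 * (real K)\<^sup>2 * (1 / (real n)\<^sup>2)" if n: "n \<ge> 1" for n
  proof -
    have b: "(cmod (\<phi> (e, x)))\<^sup>2 \<le> 0 * mass comb \<phi> + 4 / real n * energy comb \<phi>"
      if "e = Tooth n \<or> e = Backbone n" "x \<in> {0..elen comb e}" "\<phi> \<in> H1 comb" for e x \<phi>
      using comb_pointwise[OF that(3) n that(1,2)] by simp
    have "(\<Sum>i\<in>I. (cmod (u i (e, x)))\<^sup>2) \<le> 0 + 4 / real n * (real K)\<^sup>2"
      if "e = Tooth n \<or> e = Backbone n" "x \<in> {0..elen comb e}" for e x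
      by (rule evaluation_trace_bound[OF I u orth b[OF that]]) auto
    from pair[OF n this] show ?thesis by (simp add: power2_eq_square)
  qed
  have a0: "a e \<ge> 0" for e unfolding a_def by (intro sum_nonneg edge_sq_nonneg)
  have s: "a summable_on edges comb" "infsum a (edges comb) = real (card I)"
  proof -
    have one: "(edge_sq comb (u i) has_sum 1) (edges comb)" if "i \<in> I" for i
    proof -
      have "edge_sq comb (u i) summable_on edges comb" using uL2[OF that] by (simp add: L2_iff)
      from has_sum_infsum[OF this] show ?thesis using u(2)[OF that] by (simp add: nsq_L2)
    qed
    have "((\<lambda>e. \<Sum>i\<in>J. edge_sq comb (u i) e) has_sum (\<Sum>i\<in>J. 1)) (edges comb)" if "finite J" "J \<subseteq> I" for J
      using that by (induction J) (auto intro!: has_sum_add one)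
    from this[OF I] have "(a has_sum (\<Sum>i\<in>I. 1)) (edges comb)" by (simp add: a_def[abs_def])
    then show "a summable_on edges comb" "infsum a (edges comb) = real (card I)"
      by (auto simp: summable_on_def infsumI)
  qed
  have "infsum a (edges comb) \<le> 20 * real K * harm K + 8 * real K"
  proof (rule comb_sum_bound[OF s(1) a0])
    fix N
    let ?a = "\<lambda>n. a (Tooth n) + a (Backbone n)"
    have "(\<Sum>n=1..N. ?a n) \<le> (\<Sum>n\<in>{1..K} \<union> {K+1..N}. ?a n)"
      by (intro sum_mono2) (auto intro: add_nonneg_nonneg a0)
    also have "\<dots> = (\<Sum>n=1..K. ?a n) + (\<Sum>n=K+1..N. ?a n)" by (intro sum.union_disjoint) auto
    also have "(\<Sum>n=1..K. ?a n) \<le> (\<Sum>n=1..K. 20 * real K * (1 / real n))" by (intro sum_mono head) auto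
    also have "\<dots> = 20 * real K * harm K" by (simp add: harm_def inverse_eq_divide sum_distrib_left)
    also have "(\<Sum>n=K+1..N. ?a n) \<le> (\<Sum>n=K+1..N. 8 * (real K)\<^sup>2 * (1 / (real n)\<^sup>2))" by (intro sum_mono tail) auto
    also have "\<dots> = 8 * (real K)\<^sup>2 * (\<Sum>n=K+1..N. 1 / (real n)\<^sup>2)" by (rule sum_distrib_left[symmetric])
    also have "\<dots> \<le> 8 * (real K)\<^sup>2 * (1 / real K)" by (intro mult_left_mono sum_inverse_squares K) auto
    also have "\<dots> = 8 * real K" using Kp by (simp add: power2_eq_square)
    finally show "(\<Sum>n=1..N. ?a n) \<le> 20 * real K * harm K + 8 * real K" by simp
  qed
  also have "\<dots> \<le> 20 * real K * (1 + ln (real K)) + 8 * real K * (1 + ln (real K))"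
    using K by (intro add_mono mult_left_mono harm_le) (auto simp: mult_le_cancel_left1)
  finally show ?thesis using s(2) by simp
qed

section \<open>Test functions on the teeth\<close>

text \<open>The positive part of a parabola on \<open>[0, h]\<close>, squared to make it continuously differentiable.\<close>

definition bump :: "real \<Rightarrow> real \<Rightarrow> real" where
  "bump h y = (max 0 (y * (h - y)))\<^sup>2"

definition bump' :: "real \<Rightarrow> real \<Rightarrow> real" where
  "bump' h y = 2 * max 0 (y * (h - y)) * (h - 2 * y)"

lemma DERIV_bump: "(bump h has_real_derivative bump' h y) (at y)"
proof -
  have "((\<lambda>y. y * (h - y)) has_real_derivative h - 2 * y) (at y)"
    by (auto intro!: derivative_eq_intros)
  from DERIV_chain2[OF DERIV_max_sq this] show ?thesis unfolding bump_def[abs_def] bump'_def .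
qed

lemma continuous_bump: "continuous_on A (bump h)" "continuous_on A (bump' h)"
  unfolding bump_def[abs_def] bump'_def[abs_def] by (intro continuous_intros)+

lemma bump_outside: "h > 0 \<Longrightarrow> y \<notin> {0<..<h} \<Longrightarrow> bump h y = 0" "h > 0 \<Longrightarrow> y \<notin> {0<..<h} \<Longrightarrow> bump' h y = 0"
proof -
  have "y * (h - y) \<le> 0" if "h > 0" "y \<notin> {0<..<h}" using that by (auto simp: mult_le_0_iff)
  then show "h > 0 \<Longrightarrow> y \<notin> {0<..<h} \<Longrightarrow> bump h y = 0" "h > 0 \<Longrightarrow> y \<notin> {0<..<h} \<Longrightarrow> bump' h y = 0"
    by (auto simp: bump_def bump'_def max_def)
qed

lemma bump'_bound: "h > 0 \<Longrightarrow> \<bar>bump' h y\<bar> \<le> h ^ 3 / 2"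
proof (cases "y \<in> {0<..<h}")
  case True
  assume h: "h > 0"
  have "y * (h - y) \<le> h\<^sup>2 / 4"
    using zero_le_power2[of "h - 2 * y"] by (simp add: power2_eq_square algebra_simps)
  then have "\<bar>max 0 (y * (h - y))\<bar> \<le> h\<^sup>2 / 4" by (auto simp: max_def)
  moreover have "\<bar>h - 2 * y\<bar> \<le> h" using True by auto
  ultimately have "\<bar>max 0 (y * (h - y))\<bar> * \<bar>h - 2 * y\<bar> \<le> h\<^sup>2 / 4 * h" using h by (intro mult_mono) auto
  then show ?thesis by (simp add: bump'_def abs_mult power2_eq_square power3_eq_cube)
qed (simp add: bump_outside(2))

lemma bump_middle: "h > 0 \<Longrightarrow> y \<in> {h/4..3*h/4} \<Longrightarrow> (3 * h\<^sup>2 / 16)\<^sup>2 \<le> bump h y"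
proof -
  assume h: "h > 0" and y: "y \<in> {h/4..3*h/4}"
  have "0 \<le> (y - h/4) * (3*h/4 - y)" using y by (intro mult_nonneg_nonneg) auto
  also have "\<dots> = y * (h - y) - 3 * h\<^sup>2 / 16" by (simp add: power2_eq_square field_simps)
  finally have "3 * h\<^sup>2 / 16 \<le> y * (h - y)" by simp
  then show ?thesis unfolding bump_def using h by (intro power_mono) auto
qed

definition bump_fn :: "nat \<Rightarrow> nat \<Rightarrow> nat \<Rightarrow> comb_edge \<times> real \<Rightarrow> complex" where
  "bump_fn K n j = (\<lambda>(e, x). if e = Tooth n then of_real (bump (1 / real K) (x - real j / real K)) else 0)"

definition bump_fn' :: "nat \<Rightarrow> nat \<Rightarrow> nat \<Rightarrow> comb_edge \<times> real \<Rightarrow> complex" where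
  "bump_fn' K n j = (\<lambda>(e, x). if e = Tooth n then of_real (bump' (1 / real K) (x - real j / real K)) else 0)"

lemma restr_bump_fn:
  "restr (bump_fn K n j) e = (if e = Tooth n then (\<lambda>x. of_real (bump (1 / real K) (x - real j / real K))) else (\<lambda>x. 0))"
  "restr (bump_fn' K n j) e = (if e = Tooth n then (\<lambda>x. of_real (bump' (1 / real K) (x - real j / real K))) else (\<lambda>x. 0))"
  by (auto simp: restr_def bump_fn_def bump_fn'_def)

context
  fixes K n j :: nat assumes n: "n \<ge> 1" and j: "j < K div n"
begin

lemma bump_K: "K \<ge> 1"
  using j by (cases "K = 0") auto

lemma bump_pos: "1 / real K > 0"
  using bump_K by simp

lemma bump_end: "real j / real K + 1 / real K \<le> 1 / real n"
proof -
  have "Suc j * n \<le> K" using j n by (metis Suc_leI div_times_less_eq_dividend le_trans mult_le_mono1)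
  then have "real (Suc j) * real n \<le> real K" by (metis of_nat_le_iff of_nat_mult)
  then show ?thesis using n bump_K by (simp add: field_simps)
qed

lemma bump_fn_L2: "bump_fn K n j \<in> L2 comb" "bump_fn' K n j \<in> L2 comb"
  "mass comb (bump_fn K n j) = edge_sq comb (bump_fn K n j) (Tooth n)"
  "mass comb (bump_fn' K n j) = edge_sq comb (bump_fn' K n j) (Tooth n)"
proof -
  have c: "continuous_on A (\<lambda>x. complex_of_real (bump (1 / real K) (x - real j / real K)))"
    "continuous_on A (\<lambda>x. complex_of_real (bump' (1 / real K) (x - real j / real K)))" for A
    by (intro continuous_on_of_real continuous_on_compose2[OF continuous_bump(1)]
        continuous_on_compose2[OF continuous_bump(2)] continuous_intros; auto)+
  have z: "edge_sq comb (bump_fn K n j) e = 0" "edge_sq comb (bump_fn' K n j) e = 0" if "e \<noteq> Tooth n" for e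
    using that by (simp_all add: edge_sq_def restr_bump_fn)
  have L: "restr (bump_fn K n j) e \<in> L2_interval (elen comb e)" "restr (bump_fn' K n j) e \<in> L2_interval (elen comb e)" for e
    unfolding L2_interval_iff restr_bump_fn by (auto intro!: sqint_continuous c)
  have "edge_sq comb (bump_fn K n j) summable_on edges comb" "edge_sq comb (bump_fn' K n j) summable_on edges comb"
    by (rule finite_nonzero_values_imp_summable_on, rule finite_subset[of _ "{Tooth n}"], use z in auto)+
  then show "bump_fn K n j \<in> L2 comb" "bump_fn' K n j \<in> L2 comb" using L by (auto simp: L2_iff)
  have "infsum f (edges comb) = infsum f {Tooth n}" if "\<And>e. e \<noteq> Tooth n \<Longrightarrow> f e = 0" for f :: "comb_edge \<Rightarrow> real"
    using that n by (intro infsum_cong_neutral) auto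
  from this[OF z(1)] this[OF z(2)]
  show "mass comb (bump_fn K n j) = edge_sq comb (bump_fn K n j) (Tooth n)"
    "mass comb (bump_fn' K n j) = edge_sq comb (bump_fn' K n j) (Tooth n)"
    by (simp_all add: nsq_L2)
qed

lemma bump_fn_H1: "bump_fn K n j \<in> H1 comb"
  "\<And>e. e \<in> edges comb \<Longrightarrow> AE x in lebesgue_on {0..elen comb e}. restr (graph_deriv comb (bump_fn K n j)) e x = restr (bump_fn' K n j) e x"
proof -
  let ?h = "1 / real K"
  have end0: "bump ?h (0 - real j / real K) = 0" by (rule bump_outside(1)[OF bump_pos]) (simp add: not_less)
  have endl: "bump ?h (1 / real n - real j / real K) = 0"
    by (rule bump_outside(1)[OF bump_pos]) (use bump_end in auto)
  have cont: "graph_continuous comb (bump_fn K n j)"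
  proof (rule graph_continuous_Lipschitz[OF comb_graph])
    fix e and x y :: real
    have "norm (bump ?h (x - real j / real K) - bump ?h (y - real j / real K)) \<le> ?h ^ 3 / 2 * norm ((x - real j / real K) - (y - real j / real K))"
      by (rule field_differentiable_bound[of UNIV]) (use DERIV_bump bump'_bound[OF bump_pos] in auto)
    then show "cmod (bump_fn K n j (e, x) - bump_fn K n j (e, y)) \<le> ?h ^ 3 / 2 * \<bar>x - y\<bar>"
      by (auto simp: bump_fn_def simp flip: of_real_diff)
  next
    have "bump_fn K n j p = 0" if "at_vertex comb p v" for p v
      using that
    proof cases
      case (src e)
      then show ?thesis using end0 by (auto simp: bump_fn_def)
    next
      case (tgt e)
      then show ?thesis using endl by (auto simp: bump_fn_def)
    qed
    then show "bump_fn K n j p = bump_fn K n j q" if "at_vertex comb p v" "at_vertex comb q v" for p q v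
      using that by metis
  qed
  have zero: "bump_fn K n j p = 0" if "p \<notin> points comb" for p
  proof -
    obtain e x where p: "p = (e, x)" by (cases p)
    have "x - real j / real K \<notin> {0<..<?h}" if "e = Tooth n"
    proof -
      have "x \<notin> {0..1 / real n}" using \<open>p \<notin> points comb\<close> p that n by (auto simp: points_def)
      moreover have "x \<in> {0..1 / real n}" if "x - real j / real K \<in> {0<..<?h}"
      proof -
        have "0 \<le> real j / real K" by simp
        moreover have "0 < x - real j / real K" "x - real j / real K < ?h" using that by (simp_all only: greaterThanLessThan_iff)
        ultimately have "0 \<le> x" "x \<le> 1 / real n" using bump_end by linarith+
        then show ?thesis by simp
      qed
      ultimately show ?thesis by blast
    qed
    then show ?thesis using p by (auto simp: bump_fn_def bump_outside(1)[OF bump_pos])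
  qed
  have weak: "is_weak_deriv (elen comb e) (restr (bump_fn K n j) e) (restr (bump_fn' K n j) e)" if "e \<in> edges comb" for e
  proof (cases "e = Tooth n")
    case True
    have "is_weak_deriv (elen comb e) (\<lambda>x. of_real (bump ?h (x - real j / real K))) (\<lambda>x. of_real (bump' ?h (x - real j / real K)))"
    proof (rule weak_deriv_C1)
      show "0 \<le> elen comb e" using comb.elen_pos[OF that] by simp
      show "((\<lambda>x. bump ?h (x - real j / real K)) has_real_derivative bump' ?h (x - real j / real K)) (at x)" for x
      proof -
        have "((\<lambda>x. x - real j / real K) has_real_derivative 1) (at x)" by (auto intro!: derivative_eq_intros)
        from DERIV_chain2[OF DERIV_bump this] show ?thesis by simp
      qed
      show "continuous_on UNIV (\<lambda>x. bump' ?h (x - real j / real K))"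
        by (rule continuous_on_compose2[OF continuous_bump(2)]) (auto intro: continuous_intros)
    qed
    then show ?thesis using True by (simp add: restr_bump_fn)
  qed (simp add: restr_bump_fn is_weak_deriv_def)
  show "bump_fn K n j \<in> H1 comb"
    by (rule H1_from_derivative(1)[OF cont zero bump_fn_L2(1,2) weak])
  show "AE x in lebesgue_on {0..elen comb e}. restr (graph_deriv comb (bump_fn K n j)) e x = restr (bump_fn' K n j) e x"
    if "e \<in> edges comb" for e
    by (rule H1_from_derivative(2)[OF cont zero bump_fn_L2(1,2) weak that])
qed

text \<open>Only the power of \<open>h = 1/K\<close> matters: the squared derivative is at most \<open>h\<^sup>6/4\<close> on a segment of length \<open>h\<close>,
and the bump is at least \<open>(3h\<^sup>2/16)\<^sup>2\<close> on its middle half. The quotient of the resulting bounds is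
\<open>131072/324\<close> times \<open>K\<^sup>2\<close>, which is below \<open>405 K\<^sup>2\<close>.\<close>

lemma bump_Rayleigh:
  "energy comb (bump_fn K n j) \<le> 405 * (real K)\<^sup>2 * mass comb (bump_fn K n j)" "mass comb (bump_fn K n j) > 0"
proof -
  let ?h = "1 / real K" and ?M = "lebesgue_on {0..1 / real n}" and ?a = "real j / real K"
  interpret finite_measure ?M by (rule finite_measure_interval)
  have h: "?h > 0" by (rule bump_pos)
  have a: "0 \<le> ?a" by simp
  have mid: "0 \<le> ?a + ?h / 4" "?a + ?h / 4 \<le> ?a + 3 * ?h / 4" "?a + 3 * ?h / 4 \<le> 1 / real n"
  proof -
    have "0 \<le> a + h / 4 \<and> a + h / 4 \<le> a + 3 * h / 4 \<and> a + 3 * h / 4 \<le> t"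
      if "0 < h" "a + h \<le> t" "0 \<le> a" for a h t :: real using that by auto
    from this[OF h bump_end a] show "0 \<le> ?a + ?h / 4" "?a + ?h / 4 \<le> ?a + 3 * ?h / 4" "?a + 3 * ?h / 4 \<le> 1 / real n"
      by blast+
  qed
  have int: "(\<integral>x. c * indicator {x1..x2} x \<partial>?M) = c * (x2 - x1)" "integrable ?M (\<lambda>x. c * indicator {x1..x2} x)"
    if "0 \<le> x1" "x1 \<le> x2" "x2 \<le> 1 / real n" for c x1 x2 :: real
  proof -
    have "{x1..x2} \<inter> space ?M = {x1..x2}" using that by auto
    then have "(\<integral>x. indicator {x1..x2} x \<partial>?M) = x2 - x1"
      using measure_interval(4)[OF that] by (simp only: Bochner_Integration.integral_indicator)
    then show "(\<integral>x. c * indicator {x1..x2} x \<partial>?M) = c * (x2 - x1)" by (simp only: integral_mult_right_zero)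
    show "integrable ?M (\<lambda>x. c * indicator {x1..x2} x)"
      using measure_interval(3)[OF that] by (simp add: emeasure_eq_measure)
  qed
  have sq: "sqint ?M (restr (bump_fn K n j) (Tooth n))" "sqint ?M (restr (bump_fn' K n j) (Tooth n))"
    using L2_sqint[OF bump_fn_L2(1), of "Tooth n"] L2_sqint[OF bump_fn_L2(2), of "Tooth n"] n by simp_all
  have en: "energy comb (bump_fn K n j) = mass comb (bump_fn' K n j)"
    unfolding energy_eq nsq_L2
    by (intro infsum_cong edge_sq_cong bump_fn_H1(2))
      (use H1_D(3)[OF bump_fn_H1(1)] bump_fn_L2(2) in \<open>auto simp: L2_iff\<close>)
  have "edge_sq comb (bump_fn' K n j) (Tooth n) \<le> (\<integral>x. (?h ^ 3 / 2)\<^sup>2 * indicator {?a..?a + ?h} x \<partial>?M)"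
    unfolding edge_sq_def comb_elen
  proof (rule integral_mono)
    show "integrable ?M (\<lambda>x. (cmod (restr (bump_fn' K n j) (Tooth n) x))\<^sup>2)" using sq by (simp add: sqint_def)
    show "integrable ?M (\<lambda>x. (?h ^ 3 / 2)\<^sup>2 * indicator {?a..?a + ?h} x)"
      by (rule int(2)) (use h bump_end in auto)
    fix x
    show "(cmod (restr (bump_fn' K n j) (Tooth n) x))\<^sup>2 \<le> (?h ^ 3 / 2)\<^sup>2 * indicator {?a..?a + ?h} x"
    proof (cases "x \<in> {?a..?a + ?h}")
      case True
      have "\<bar>bump' ?h (x - ?a)\<bar>\<^sup>2 \<le> (?h ^ 3 / 2)\<^sup>2" by (intro power_mono bump'_bound h) auto
      then show ?thesis using True by (simp add: restr_bump_fn)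
    next
      case False
      then have "bump' ?h (x - ?a) = 0" by (intro bump_outside(2) h) auto
      then show ?thesis using False by (simp add: restr_bump_fn)
    qed
  qed
  also have "\<dots> = (?h ^ 3 / 2)\<^sup>2 * ((?a + ?h) - ?a)" by (rule int(1)) (use h bump_end in auto)
  also have "\<dots> = ?h ^ 7 / 4" by (simp add: power2_eq_square power3_eq_cube eval_nat_numeral)
  finally have E: "energy comb (bump_fn K n j) \<le> ?h ^ 7 / 4" by (simp add: en bump_fn_L2)
  \<comment> \<open>The middle half has length \<open>h/2\<close>, and \<open>(3/16)^4 / 2 = 81/131072\<close>.\<close>
  have "81 / 131072 * ?h ^ 9 = ((3 * ?h\<^sup>2 / 16)\<^sup>2)\<^sup>2 * ((?a + 3 * ?h / 4) - (?a + ?h / 4))"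
    by (simp add: power2_eq_square eval_nat_numeral)
  also have "\<dots> = (\<integral>x. ((3 * ?h\<^sup>2 / 16)\<^sup>2)\<^sup>2 * indicator {?a + ?h / 4..?a + 3 * ?h / 4} x \<partial>?M)"
    by (rule int(1)[OF mid, symmetric])
  also have "\<dots> \<le> edge_sq comb (bump_fn K n j) (Tooth n)"
    unfolding edge_sq_def comb_elen
  proof (rule integral_mono)
    show "integrable ?M (\<lambda>x. (cmod (restr (bump_fn K n j) (Tooth n) x))\<^sup>2)" using sq by (simp add: sqint_def)
    show "integrable ?M (\<lambda>x. ((3 * ?h\<^sup>2 / 16)\<^sup>2)\<^sup>2 * indicator {?a + ?h / 4..?a + 3 * ?h / 4} x)"
      by (rule int(2)[OF mid])
    fix x
    show "((3 * ?h\<^sup>2 / 16)\<^sup>2)\<^sup>2 * indicator {?a + ?h / 4..?a + 3 * ?h / 4} x \<le> (cmod (restr (bump_fn K n j) (Tooth n) x))\<^sup>2"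
    proof (cases "x \<in> {?a + ?h / 4..?a + 3 * ?h / 4}")
      case True
      then have "(3 * ?h\<^sup>2 / 16)\<^sup>2 \<le> bump ?h (x - ?a)" by (intro bump_middle h) auto
      then have "((3 * ?h\<^sup>2 / 16)\<^sup>2)\<^sup>2 \<le> (bump ?h (x - ?a))\<^sup>2" by (intro power_mono) auto
      then show ?thesis using True by (simp add: restr_bump_fn)
    qed simp
  qed
  finally have L: "81 / 131072 * ?h ^ 9 \<le> mass comb (bump_fn K n j)" by (simp add: bump_fn_L2)
  show "mass comb (bump_fn K n j) > 0" by (rule less_le_trans[OF _ L]) (use h in simp)
  have "?h ^ 7 / 4 \<le> 405 * (real K)\<^sup>2 * (81 / 131072 * ?h ^ 9)"
    using bump_K by (simp add: field_simps power2_eq_square eval_nat_numeral)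
  also have "\<dots> \<le> 405 * (real K)\<^sup>2 * mass comb (bump_fn K n j)" by (intro mult_left_mono L) simp
  finally show "energy comb (bump_fn K n j) \<le> 405 * (real K)\<^sup>2 * mass comb (bump_fn K n j)" using E by simp
qed

end

lemma bump_orthogonal:
  assumes i: "n \<ge> 1" "j < K div n" "n' \<ge> 1" "j' < K div n'" and ne: "(n, j) \<noteq> (n', j')"
  shows "L2_inner comb (bump_fn K n j) (bump_fn K n' j') = 0"
    "energy_form comb (bump_fn K n j) (bump_fn K n' j') = 0"
proof -
  let ?h = "1 / real K"
  have K: "real K > 0" and h: "?h > 0" using bump_K[OF i(1,2)] by auto
  have disj: "x - real j / real K \<notin> {0<..<?h} \<or> x - real j' / real K \<notin> {0<..<?h}" if "n = n'" for x
  proof (rule ccontr)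
    assume "\<not> ?thesis"
    then have "real j / real K < x" "x < (real j + 1) / real K" "real j' / real K < x" "x < (real j' + 1) / real K"
      by (auto simp: add_divide_distrib)
    then have "real j < x * real K" "x * real K < real j + 1" "real j' < x * real K" "x * real K < real j' + 1"
      using K by (simp_all only: pos_less_divide_eq pos_divide_less_eq)
    then have "real j < real j' + 1" "real j' < real j + 1" by linarith+
    then have "j = j'" by linarith
    then show False using ne that by simp
  qed
  have 0: "restr (bump_fn K n j) e x * cnj (restr (bump_fn K n' j') e x) = 0"
    "restr (bump_fn' K n j) e x * cnj (restr (bump_fn' K n' j') e x) = 0" for e x
    using disj[of x] bump_outside[OF h] by (auto simp: restr_bump_fn)
  show "L2_inner comb (bump_fn K n j) (bump_fn K n' j') = 0" by (simp add: L2_inner_def 0)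
  have "energy_form comb (bump_fn K n j) (bump_fn K n' j') = L2_inner comb (bump_fn' K n j) (bump_fn' K n' j')"
    by (rule energy_from_derivative[OF bump_fn_H1[OF i(1,2)] bump_fn_H1[OF i(3,4)] bump_fn_L2(2)[OF i(1,2)] bump_fn_L2(2)[OF i(3,4)]])
  then show "energy_form comb (bump_fn K n j) (bump_fn K n' j') = 0" by (simp add: L2_inner_def 0)
qed

definition bump_index :: "nat \<Rightarrow> (nat \<times> nat) set" where
  "bump_index K = (SIGMA n:{1..K}. {..<K div n})"

lemma bump_index_iff: "(n, j) \<in> bump_index K \<longleftrightarrow> n \<ge> 1 \<and> j < K div n"
  by (auto simp: bump_index_def) (metis div_less less_nat_zero_code linorder_not_le)

lemma finite_bump_index: "finite (bump_index K)"
  by (simp add: bump_index_def)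

text \<open>Rounding down loses at most \<open>1\<close> on each of the \<open>K\<close> teeth, and the harmonic sum is at least \<open>ln K\<close>.\<close>

lemma card_bump_index: "real (card (bump_index K)) \<ge> real K * ln (real K) - real K"
proof (cases "K = 0")
  case False
  have "real K * ln (real K) - real K \<le> real K * harm K - real K"
  proof -
    have "ln (real K) \<le> ln (real K + 1)" using False by simp
    then have "ln (real K) \<le> harm K" using ln_le_harm[of K] by linarith
    then show ?thesis by (simp add: mult_left_mono)
  qed
  also have "\<dots> = (\<Sum>n=1..K. real K / real n - 1)"
    by (simp add: harm_def sum_subtractf sum_distrib_left divide_inverse)
  also have "\<dots> \<le> (\<Sum>n=1..K. real (K div n))"
  proof (rule sum_mono)
    fix n assume "n \<in> {1..K}"
    then have "n > 0" by simp
    then have "K < Suc (K div n) * n" using dividend_less_div_times[of n K] by simp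
    then have "real K < (real (K div n) + 1) * real n" by (metis of_nat_Suc of_nat_less_iff of_nat_mult add.commute)
    then show "real K / real n - 1 \<le> real (K div n)" using \<open>n > 0\<close> by (simp add: field_simps)
  qed
  also have "\<dots> = real (card (bump_index K))" by (simp add: bump_index_def)
  finally show ?thesis .
qed simp

lemma nonzero_of_mass: "mass comb f > 0 \<Longrightarrow> f \<noteq> 0"
  using hermitian_form.zero_left[OF hermitian_form_H1 H1_zero, of comb]
  by (auto simp: hermitian_form.nsq_def[OF hermitian_form_H1])

interpretation spec: form_pair "H1 comb" "L2_inner comb" "energy_form comb"
proof
  fix f assume "f \<in> H1 comb" "mass comb f = 0"
  then show "f = 0" by (rule mass_eq_0_imp[OF comb_graph])
next
  show "\<exists>C>0. \<forall>f\<in>H1 comb. mass comb f \<le> C * energy comb f" by (intro exI[of _ 16]) (simp add: comb_mass_le)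
next
  fix F :: "nat \<Rightarrow> comb_edge \<times> real \<Rightarrow> complex" and B
  assume F: "\<And>k. F k \<in> H1 comb" "\<And>k. energy comb (F k) \<le> B"
  show "\<exists>r :: nat \<Rightarrow> nat. strict_mono r \<and> (\<forall>\<epsilon>>0. \<exists>N. \<forall>m\<ge>N. \<forall>n\<ge>N. mass comb (F (r m) - F (r n)) < \<epsilon>)"
    by (rule comb.energy_compact[OF F])
next
  fix F :: "nat \<Rightarrow> comb_edge \<times> real \<Rightarrow> complex"
  assume F: "\<And>k. F k \<in> H1 comb" "\<And>\<epsilon>. \<epsilon> > 0 \<Longrightarrow> \<exists>N. \<forall>m\<ge>N. \<forall>n\<ge>N. energy comb (F m - F n) < \<epsilon>"
  show "\<exists>g\<in>H1 comb. (\<lambda>n. energy comb (F n - g)) \<longlonglongrightarrow> 0" by (rule comb.energy_complete[OF F])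
next
  fix S assume S: "finite S" "S \<subseteq> H1 comb"
  \<comment> \<open>Tooth \<open>1\<close> has length \<open>1\<close> and carries \<open>K\<close> disjoint bumps, more than there are constraints.\<close>
  define K where "K = Suc (card S)"
  have i: "(1::nat) \<ge> 1" "j < K div 1" if "j \<in> {..<K}" for j using that by auto
  obtain c where c: "\<exists>j\<in>{..<K}. c j \<noteq> 0" "\<forall>s\<in>S. (\<Sum>j<K. c j * L2_inner comb (bump_fn K 1 j) s) = 0"
    using underdetermined_linear_system[of S "{..<K}" "\<lambda>s j. L2_inner comb (bump_fn K 1 j) s"] S(1) by (auto simp: K_def)
  let ?w = "\<Sum>j<K. (\<lambda>p. c j * bump_fn K 1 j p)"
  have H: "bump_fn K 1 j \<in> H1 comb" if "j \<in> {..<K}" for j using bump_fn_H1(1)[OF i[OF that]] .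
  have w: "?w \<in> H1 comb" by (intro comb.L.closed_sum comb.L.closed_scale H)
  have "mass comb ?w = (\<Sum>j<K. (cmod (c j))\<^sup>2 * mass comb (bump_fn K 1 j))"
    by (rule comb.L.orthogonal_combination) (use H bump_orthogonal(1)[of 1 _ K 1] in auto)
  moreover obtain j where j: "j \<in> {..<K}" "c j \<noteq> 0" using c(1) by blast
  have "(\<Sum>j<K. (cmod (c j))\<^sup>2 * mass comb (bump_fn K 1 j)) > 0"
    by (rule sum_pos2[OF _ j(1)]) (use j bump_Rayleigh(2)[OF i] comb.L.nsq_nonneg[OF H] in auto)
  ultimately have "?w \<noteq> 0" by (intro nonzero_of_mass) simp
  moreover have "L2_inner comb ?w s = 0" if "s \<in> S" for s
  proof -
    have s: "s \<in> H1 comb" using that S(2) by blast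
    have "L2_inner comb ?w s = (\<Sum>j<K. L2_inner comb (\<lambda>p. c j * bump_fn K 1 j p) s)"
      by (rule comb.L.sum_left) (use s H comb.L.closed_scale in auto)
    also have "\<dots> = (\<Sum>j<K. c j * L2_inner comb (bump_fn K 1 j) s)"
      by (intro sum.cong HOL.refl comb.L.scale_left H s)
    finally show ?thesis using c(2) that by simp
  qed
  ultimately show "\<exists>w\<in>H1 comb. w \<noteq> 0 \<and> (\<forall>s\<in>S. L2_inner comb w s = 0)" using w by blast
qed

section \<open>Enumeration of the eigenvalues\<close>

lemma has_finite_dim_unique: "has_finite_dim V m \<Longrightarrow> has_finite_dim V n \<Longrightarrow> m = n"
  unfolding has_finite_dim_def by (metis cfun.dim_eq_card_independent cfun.dim_span)

text \<open>At the first index where two enumerations differ, the smaller of the two values would be listed more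
often by the one that takes it there.\<close>

lemma enumerates_unique:
  assumes "enumerates_eigenvalues G ev" "enumerates_eigenvalues G ev'" "k \<ge> 1"
  shows "ev k = ev' k"
proof -
  have card: "card {k. 1 \<le> k \<and> ev k = \<mu>} = card {k. 1 \<le> k \<and> ev' k = \<mu>}" for \<mu>
    using assms(1,2) unfolding enumerates_eigenvalues_def by (meson has_finite_dim_unique)
  have fin: "finite {k. 1 \<le> k \<and> ev k = \<mu>}" "finite {k. 1 \<le> k \<and> ev' k = \<mu>}" for \<mu>
    using assms(1,2) unfolding enumerates_eigenvalues_def by auto
  \<comment> \<open>Stated for arbitrary \<open>f\<close> and \<open>g\<close> so that it can be used with both enumerations in either role.\<close>
  have no_less: "\<not> f k < g k"
    if fg: "mono_on {1..} f" "mono_on {1..} g" "\<And>i. 1 \<le> i \<Longrightarrow> i < k \<Longrightarrow> f i = g i" "k \<ge> 1"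
      "\<And>\<mu>. card {k. 1 \<le> k \<and> f k = \<mu>} = card {k. 1 \<le> k \<and> g k = \<mu>}" "\<And>\<mu>. finite {k. 1 \<le> k \<and> f k = \<mu>}"
    for f g :: "nat \<Rightarrow> real" and k
  proof
    assume lt: "f k < g k"
    have "i < k" if "1 \<le> i" "g i = f k" for i
    proof (rule ccontr)
      assume "\<not> i < k"
      then have "g k \<le> g i" using fg(2,4) by (auto simp: mono_on_def)
      then show False using that lt by simp
    qed
    then have "{i. 1 \<le> i \<and> g i = f k} \<subseteq> {i. 1 \<le> i \<and> f i = f k} - {k}" using fg(3) by auto
    then have "card {i. 1 \<le> i \<and> g i = f k} \<le> card ({i. 1 \<le> i \<and> f i = f k} - {k})"
      using fg(6) by (intro card_mono) auto
    also have "\<dots> < card {i. 1 \<le> i \<and> f i = f k}" using fg(4,6) by (intro card_Diff1_less) auto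
    finally show False using fg(5) by simp
  qed
  show ?thesis using assms(3)
  proof (induction k rule: less_induct)
    case (less k)
    have m: "mono_on {1..} ev" "mono_on {1..} ev'" using assms(1,2) by (auto simp: enumerates_eigenvalues_def)
    have "\<not> ev k < ev' k" by (rule no_less) (use m less card fin in auto)
    moreover have "\<not> ev' k < ev k" by (rule no_less) (use m less card fin in auto)
    ultimately show ?case by simp
  qed
qed

lemma neumann_eigenvalue_eq:
  assumes "enumerates_eigenvalues G ev" "k \<ge> 1"
  shows "neumann_eigenvalue G k = ev k"
  unfolding neumann_eigenvalue_def
proof (rule the_equality)
  show "\<exists>ev'. enumerates_eigenvalues G ev' \<and> ev k = ev' k" using assms by blast
  fix x assume "\<exists>ev'. enumerates_eigenvalues G ev' \<and> x = ev' k"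
  then obtain ev' where "enumerates_eigenvalues G ev'" "x = ev' k" by blast
  then show "x = ev k" using enumerates_unique[OF assms(1)] assms(2) by simp
qed

lemma eigenspace_comb: "eigenspace comb \<mu> = spec.eigen \<mu>"
proof -
  have "L2_inner comb (\<lambda>p. of_real \<mu> * \<phi> p) \<psi> = of_real \<mu> * L2_inner comb \<phi> \<psi>" if "\<phi> \<in> H1 comb" "\<psi> \<in> H1 comb" for \<phi> \<psi>
    using that by (rule comb.L.scale_left)
  then show ?thesis
    by (auto simp: eigenspace_def neumann_laplacian_def spec.eigen_def intro: L2_scale H1_D(2))
qed

text \<open>The eigensystem starts at index \<open>0\<close> and the enumeration at index \<open>1\<close>.\<close>

lemma comb_enumeration:
  assumes "spec.eigensystem u"
  shows "enumerates_eigenvalues comb (\<lambda>k. energy comb (u (k - 1)))"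
  unfolding enumerates_eigenvalues_def
proof (intro conjI allI)
  show "mono_on {1..} (\<lambda>k. energy comb (u (k - 1)))"
    by (intro mono_onI spec.sys_mono[OF assms]) auto
  fix \<mu>
  have eq: "{k. 1 \<le> k \<and> energy comb (u (k - 1)) = \<mu>} = Suc ` {k. energy comb (u k) = \<mu>}"
  proof (intro set_eqI iffI)
    fix k assume "k \<in> {k. 1 \<le> k \<and> energy comb (u (k - 1)) = \<mu>}"
    then show "k \<in> Suc ` {k. energy comb (u k) = \<mu>}" by (intro image_eqI[of _ _ "k - 1"]) auto
  qed auto
  have "finite {k. energy comb (u k) = \<mu>}"
    by (rule finite_subset[OF _ spec.sys_finite[OF assms, of \<mu>]]) auto
  then show "finite {k. 1 \<le> k \<and> energy comb (u (k - 1)) = \<mu>}" unfolding eq by (rule finite_imageI)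
  show "has_finite_dim (eigenspace comb \<mu>) (card {k. 1 \<le> k \<and> energy comb (u (k - 1)) = \<mu>})"
    unfolding eq eigenspace_comb using spec.sys_dim[OF assms, of \<mu>] by (simp add: card_image)
qed

section \<open>Eigenvalue bounds\<close>

lemma eigenvalue_upper_bound:
  assumes u: "spec.eigensystem u" and m: "real m < real K * ln (real K) - real K"
  shows "energy comb (u m) \<le> 405 * (real K)\<^sup>2"
proof (rule spec.sys_minmax[OF u finite_bump_index])
  let ?w = "\<lambda>(n, j). bump_fn K n j"
  show "m < card (bump_index K)" using card_bump_index[of K] m by linarith
  fix i assume i: "i \<in> bump_index K"
  obtain n j where nj: "i = (n, j)" "n \<ge> 1" "j < K div n" using i bump_index_iff by (cases i) auto
  show "?w i \<in> H1 comb" using bump_fn_H1(1)[OF nj(2,3)] nj(1) by simp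
  show "?w i \<noteq> 0" using nonzero_of_mass[OF bump_Rayleigh(2)[OF nj(2,3)]] nj(1) by simp
  show "energy comb (?w i) \<le> 405 * (real K)\<^sup>2 * mass comb (?w i)" using bump_Rayleigh(1)[OF nj(2,3)] nj(1) by simp
  fix i' assume i': "i' \<in> bump_index K" and ne: "i \<noteq> i'"
  obtain n' j' where nj': "i' = (n', j')" "n' \<ge> 1" "j' < K div n'" using i' bump_index_iff by (cases i') auto
  show "L2_inner comb (?w i) (?w i') = 0" "energy_form comb (?w i) (?w i') = 0"
    using bump_orthogonal[OF nj(2,3) nj'(2,3)] ne nj(1) nj'(1) by auto
qed

lemma eigenvalue_lower_bound:
  assumes u: "spec.eigensystem u" and K: "K \<ge> 1" and m: "28 * real K * (1 + ln (real K)) < real m + 1"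
  shows "energy comb (u m) > (real K)\<^sup>2"
proof (rule ccontr)
  assume "\<not> ?thesis"
  then have "energy comb (u i) \<le> (real K)\<^sup>2" if "i \<in> {..m}" for i
    using spec.sys_mono[OF u, of i m] that by simp
  then have "real (card {..m}) \<le> 28 * real K * (1 + ln (real K))"
    by (intro counting_bound[OF K, of "{..m}" u])
      (auto simp: spec.sys_H[OF u] spec.sys_norm[OF u] spec.sys_orthogonal[OF u] spec.sys_E_orthogonal[OF u])
  then show False using m by simp
qed

theorem theorem2p9:
  shows "\<exists>c C :: real. 0 < c \<and> 0 < C \<and>
    (\<forall>\<^sub>F k in sequentially.
       c * (real k ^ 2 / ln (real k) ^ 4) \<le> neumann_eigenvalue (diagonal_comb 1) k \<and>
       neumann_eigenvalue (diagonal_comb 1) k \<le> C * (real k ^ 2 / ln (real k) ^ 2))"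
proof -
  obtain u where u: "spec.eigensystem u" using spec.eigensystem_exists by blast
  have ev: "neumann_eigenvalue comb k = energy comb (u (k - 1))" if "k \<ge> 1" for k
    using neumann_eigenvalue_eq[OF comb_enumeration[OF u] that] .
  have lower: "\<forall>\<^sub>F k in sequentially. 28 * (real k / ln (real k) ^ 2 + 1) * (1 + ln (real k / ln (real k) ^ 2 + 1)) < real k"
    by real_asymp
  have upper: "\<forall>\<^sub>F k in sequentially. real k \<le> (4 * real k / ln (real k)) * (ln (4 * real k / ln (real k)) - 1)"
    by real_asymp
  have large: "\<forall>\<^sub>F k in sequentially. 1 \<le> ln (real k) \<and> 3 \<le> 4 * real k / ln (real k)"
    by (intro eventually_conj) real_asymp+
  have "\<forall>\<^sub>F k in sequentially. 1 * (real k ^ 2 / ln (real k) ^ 4) \<le> neumann_eigenvalue comb k \<and>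
       neumann_eigenvalue comb k \<le> 405 * 25 * (real k ^ 2 / ln (real k) ^ 2)"
    using lower upper large eventually_ge_at_top[of 2]
  proof eventually_elim
    case (elim k)
    have k: "real k \<ge> 2" and lnk: "ln (real k) \<ge> 1" using elim by auto
    have idx: "real (k - 1) + 1 = real k" using elim by simp
    have "real k ^ 2 / ln (real k) ^ 4 \<le> neumann_eigenvalue comb k"
    proof -
      \<comment> \<open>\<open>28 K (1 + ln K)\<close> is of order \<open>k/ln k\<close> for this \<open>K\<close>: too little for \<open>k\<close> eigenfunctions.\<close>
      define x where "x = real k / ln (real k) ^ 2"
      define K where "K = nat \<lceil>x\<rceil>"
      have x: "x > 0" using k lnk by (simp add: x_def)
      have K: "K \<ge> 1" "x \<le> real K" "real K \<le> x + 1" using x by (auto simp: K_def) linarith+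
      have "28 * real K * (1 + ln (real K)) \<le> 28 * (x + 1) * (1 + ln (x + 1))"
        using K by (intro mult_mono add_mono) auto
      also have "\<dots> < real k" using elim(1) by (simp add: x_def)
      finally have "(real K)\<^sup>2 < energy comb (u (k - 1))" using K(1) idx by (intro eigenvalue_lower_bound[OF u]) auto
      moreover have "x\<^sup>2 \<le> (real K)\<^sup>2" using K x by (intro power_mono) auto
      moreover have "x\<^sup>2 = real k ^ 2 / ln (real k) ^ 4" by (simp add: x_def power_divide flip: power_mult)
      ultimately show ?thesis using ev[of k] elim by simp
    qed
    moreover have "neumann_eigenvalue comb k \<le> 405 * 25 * (real k ^ 2 / ln (real k) ^ 2)"
    proof -
      \<comment> \<open>\<open>ln K\<close> is close to \<open>ln k\<close>, so the factor \<open>4\<close> makes \<open>K (ln K - 1)\<close> exceed \<open>k\<close>.\<close>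
      define y where "y = 4 * real k / ln (real k)"
      define K where "K = nat \<lceil>y\<rceil>"
      have y: "y \<ge> 3" using elim(3) by (simp add: y_def)
      have K: "y \<le> real K" "real K \<le> y + 1" using y by (auto simp: K_def)
      have lny: "ln y \<ge> 1" using y exp_le ln_ge_iff[of y 1] by simp
      have "real k \<le> y * (ln y - 1)" using elim(2) by (simp add: y_def)
      also have "\<dots> \<le> real K * (ln (real K) - 1)" using K y lny by (intro mult_mono diff_mono) auto
      finally have "energy comb (u (k - 1)) \<le> 405 * (real K)\<^sup>2"
        using idx by (intro eigenvalue_upper_bound[OF u]) (simp add: algebra_simps)
      also have "\<dots> \<le> 405 * (5 * (real k / ln (real k)))\<^sup>2"
      proof -
        have "1 \<le> real k / ln (real k)" using k lnk ln_le_minus_one[of "real k"] by simp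
        then have "real K \<le> 5 * (real k / ln (real k))" using K(2) by (simp add: y_def)
        then show ?thesis by (intro mult_left_mono power_mono) auto
      qed
      also have "\<dots> = 405 * 25 * (real k ^ 2 / ln (real k) ^ 2)" by (simp add: power_mult_distrib power_divide)
      finally show ?thesis using ev[of k] elim by simp
    qed
    ultimately show ?case by simp
  qed
  then show ?thesis by (intro exI[of _ 1] exI[of _ "405 * 25"]) auto
qed

end
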